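(* A DDAE system without causality loop is well-posed. That is, let $A,B,C,D$ be delay operators with memory length $r\ge0$ defining the DDAE system $\dot x(t)=Ax_t+By_t$, $y(t)=Cx_t+Dy_t$ with $x(t)\in\mathbb{C}^n$, $y(t)\in\mathbb{C}^m$, and assume that this system has no causality loop. Then for every $(\phi,\chi,\psi)\in X$ there is a unique (locally integrable) solution $(x,y)$ of the initial value problem with initial data $(\phi,\chi,\psi)$; it belongs to $L^2_{\rm loc}([-r,+\infty),\mathbb{C}^{n+m})$; $x$ is continuous on $(0,+\infty)$ (with $x(0^+)=\phi$); and for every $t>0$ there is some $\alpha>0$ (not depending on the initial data) such that for every $(\phi,\chi,\psi)\in X$ the corresponding solution satisfies $$\|(x(t),x_t,y_t)\|_X\le \alpha\,\|(\phi,\chi,\psi)\|_X .$$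
   Context: Delay operators: for integers $i,j$, a delay operator with memory length $r$ is a bounded linear operator $L:C([-r,0],\mathbb{C}^j)\to\mathbb{C}^i$, identified by Riesz's theorem with a (unique) $i\times j$ matrix $L$ of complex Borel measures supported on $[-r,0]$, through $L\varphi=\int dL\,\varphi$. The convolution kernel $L^*$ is the measure supported on $[0,r]$ given by $L^*(S)=L(-S)$ for bounded Borel sets $S$. Convolutions: functions defined on a proper subset of $\mathbb{R}$ (such as $[-r,0]$ or $[-r,+\infty)$) are extended by $0$; a locally integrable function is identified with the measure of which it is the density; convolutions of matrix-valued measures combine scalar convolution with the matrix product. In particular $(L^*\ast z)(t)=\int dL(\theta)\,z(t+\theta)$ for a.e. $t$. $e$ is the Heaviside function: $e(t)=1$ for $t\ge0$, $e(t)=0$ otherwise. DDAE system: $A,B,C,D$ are delay operators with memory length $r$ and values in matrices of sizes $n\times n$, $n\times m$, $m\times n$, $m\times m$. For a function $z$ on $[-r,+\infty)$ and $t\ge0$, $z_t(\theta)=z(t+\theta)$ for $\theta\in[-r,0]$. Solution: a pair of locally integrable functions $(x,y)$ on $[-r,+\infty)$ with values in $\mathbb{C}^{n+m}$ is a solution of the initial value problem with initial data $(\phi,\chi,\psi)$ if $(x(0^+),x_0,y_0)=(\phi,\chi,\psi)$ and there is $f\in\mathbb{C}^n$ such that for a.e. $t>0$ $$x(t)=(e\ast A^*\ast x)(t)+(e\ast B^*\ast y)(t)+f,\qquad y(t)=(C^*\ast x)(t)+(D^*\ast y)(t).$$ Functions are identified when equal almost everywhere; on $(0,+\infty)$, $x$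 is taken to be its continuous representative. Product space: $X=\mathbb{C}^n\times L^2([-r,0],\mathbb{C}^{n+m})$ with norm $\|(\phi,\chi,\psi)\|_X^2=|\phi|^2+\int_{-r}^0\left(|\chi(t)|^2+|\psi(t)|^2\right)dt$. Causality loop: a scalar measure $k^*$ is causal if its support is included in $[0,+\infty)$, and strictly causal if additionally $k^*\{0\}=0$. A causality loop of the DDAE system is a causality loop of its canonical block diagram representation, whose kernel matrix is the $(2n+m)\times(2n+m)$ matrix of scalar measures $$K^*=\begin{bmatrix}0&e I_n&0\\ A^*&0&B^*\\ C^*&0&D^*\end{bmatrix},$$ that is, a finite sequence of integers $i_0,i_1,\dots,i_j$ in $\{1,\dots,2n+m\}$, with $j\ge1$, such that $i_0=i_j$ and, for every $\ell\in\{0,\dots,j-1\}$, the kernel $K^*_{i_{\ell+1}i_\ell}$ is not strictly causal. *)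

theory Defs
  imports "HOL-Analysis.Analysis"
begin

text \<open>
  Vectors of \<open>\<complex>\<^sup>n\<close> are functions \<open>nat \<Rightarrow> complex\<close> of which only the components
  \<open>i < n\<close> matter, so that \<open>n = 0\<close> is allowed; indices start at \<open>0\<close>. Functions of a real
  variable are considered through Borel representatives of their classes modulo equality almost
  everywhere (whence \<open>lborel\<close>), so that they can be integrated against any Borel measure.
\<close>

definition vnorm :: "nat \<Rightarrow> (nat \<Rightarrow> complex) \<Rightarrow> real" where
  "vnorm n v = L2_set (\<lambda>i. cmod (v i)) {..<n}"


subsection \<open>Complex Borel measures\<close>

text \<open>Complex measures are set functions; only their values on Borel sets are relevant.\<close>

definition complex_borel_measure :: "(real set \<Rightarrow> complex) \<Rightarrow> bool" where
  "complex_borel_measure \<mu> \<longleftrightarrow>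
     (\<forall>F :: nat \<Rightarrow> real set. range F \<subseteq> sets borel \<longrightarrow> disjoint_family F \<longrightarrow>
        (\<lambda>i. \<mu> (F i)) sums \<mu> (\<Union>i. F i))"

text \<open>
  For a closed set \<open>S\<close>, this says that the support of \<open>\<mu>\<close> is included in \<open>S\<close>. Only bounded Borel
  sets are tested, so that it also makes sense for locally finite measures.
\<close>

definition supported_in :: "real set \<Rightarrow> (real set \<Rightarrow> complex) \<Rightarrow> bool" where
  "supported_in S \<mu> \<longleftrightarrow> (\<forall>T \<in> sets borel. bounded T \<longrightarrow> T \<inter> S = {} \<longrightarrow> \<mu> T = 0)"

text \<open>
  Positive part in the Jordan decomposition of a signed measure \<open>\<nu>\<close>. Since \<open>ennreal\<close> maps
  negative numbers to \<open>0\<close>, the supremum is that of \<open>\<nu> U\<close> over the Borel sets \<open>U \<subseteq> T\<close>.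
\<close>

definition jordan_pos :: "(real set \<Rightarrow> real) \<Rightarrow> real measure" where
  "jordan_pos \<nu> = measure_of UNIV (sets borel)
     (\<lambda>T. SUP U \<in> {U \<in> sets borel. U \<subseteq> T}. ennreal (\<nu> U))"

definition cm_integral :: "(real set \<Rightarrow> complex) \<Rightarrow> (real \<Rightarrow> complex) \<Rightarrow> complex" where
  "cm_integral \<mu> f =
     (integral\<^sup>L (jordan_pos (\<lambda>S. Re (\<mu> S))) f - integral\<^sup>L (jordan_pos (\<lambda>S. - Re (\<mu> S))) f)
     + \<i> * (integral\<^sup>L (jordan_pos (\<lambda>S. Im (\<mu> S))) f - integral\<^sup>L (jordan_pos (\<lambda>S. - Im (\<mu> S))) f)"


subsection \<open>Delay operators\<close>

definition cont_space :: "real \<Rightarrow> nat \<Rightarrow> (real \<Rightarrow> nat \<Rightarrow> complex) set" where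
  "cont_space r q = {\<phi>. \<forall>j<q. continuous_on {-r..0} (\<lambda>\<theta>. \<phi> \<theta> j)}"

text \<open>
  Bounded linear operators from \<open>C([-r,0], \<complex>\<^sup>q)\<close> to \<open>\<complex>\<^sup>p\<close>. The bound forces \<open>L \<phi>\<close> to depend only
  on the components \<open>j < q\<close> of the restriction of \<open>\<phi>\<close> to \<open>[-r,0]\<close>.
\<close>

definition delay_operator ::
    "real \<Rightarrow> nat \<Rightarrow> nat \<Rightarrow> ((real \<Rightarrow> nat \<Rightarrow> complex) \<Rightarrow> nat \<Rightarrow> complex) \<Rightarrow> bool" where
  "delay_operator r p q L \<longleftrightarrow>
     (\<forall>\<phi> \<in> cont_space r q. \<forall>\<psi> \<in> cont_space r q. \<forall>i<p.
        L (\<lambda>\<theta> j. \<phi> \<theta> j + \<psi> \<theta> j) i = L \<phi> i + L \<psi> i) \<and>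
     (\<forall>c. \<forall>\<phi> \<in> cont_space r q. \<forall>i<p. L (\<lambda>\<theta> j. c * \<phi> \<theta> j) i = c * L \<phi> i) \<and>
     (\<exists>K. \<forall>\<phi> \<in> cont_space r q. vnorm p (L \<phi>) \<le> K * (SUP \<theta>\<in>{-r..0}. vnorm q (\<phi> \<theta>)))"

text \<open>
  \<open>M\<close> is the matrix of complex measures identified with the delay operator \<open>L\<close> by Riesz's theorem
  (which provides its existence and uniqueness).
\<close>

definition riesz_matrix ::
    "real \<Rightarrow> nat \<Rightarrow> nat \<Rightarrow> ((real \<Rightarrow> nat \<Rightarrow> complex) \<Rightarrow> nat \<Rightarrow> complex) \<Rightarrow>
      (nat \<Rightarrow> nat \<Rightarrow> real set \<Rightarrow> complex) \<Rightarrow> bool" where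
  "riesz_matrix r p q L M \<longleftrightarrow>
     (\<forall>i<p. \<forall>j<q. complex_borel_measure (M i j) \<and> supported_in {-r..0} (M i j)) \<and>
     (\<forall>\<phi> \<in> cont_space r q. \<forall>i<p.
        L \<phi> i = (\<Sum>j<q. cm_integral (M i j) (\<lambda>\<theta>. if \<theta> \<in> {-r..0} then \<phi> \<theta> j else 0)))"


subsection \<open>Kernels and convolutions\<close>

definition reflect :: "(real set \<Rightarrow> complex) \<Rightarrow> real set \<Rightarrow> complex" where
  "reflect \<mu> S = \<mu> (uminus ` S)"

definition density_kernel :: "(real \<Rightarrow> complex) \<Rightarrow> real set \<Rightarrow> complex" where
  "density_kernel f S = (LINT t:S|lborel. f t)"

definition heaviside :: "real \<Rightarrow> complex" where
  "heaviside t = (if 0 \<le> t then 1 else 0)"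

definition fun_conv :: "(real \<Rightarrow> complex) \<Rightarrow> (real \<Rightarrow> complex) \<Rightarrow> real \<Rightarrow> complex" where
  "fun_conv f g t = (LINT s|lborel. f (t - s) * g s)"

definition meas_conv :: "(real set \<Rightarrow> complex) \<Rightarrow> (real \<Rightarrow> complex) \<Rightarrow> real \<Rightarrow> complex" where
  "meas_conv k z t = cm_integral k (\<lambda>s. z (t - s))"

text \<open>
  Row \<open>i\<close> of \<open>(L\<^sup>* \<ast> z)(t)\<close>, where \<open>L\<close> is a matrix of measures with \<open>q\<close> columns and \<open>z\<close> is a function
  on \<open>[-r,+\<infinity>)\<close>, extended by \<open>0\<close>.
\<close>

definition delay_conv ::
    "real \<Rightarrow> nat \<Rightarrow> (nat \<Rightarrow> nat \<Rightarrow> real set \<Rightarrow> complex) \<Rightarrow> (real \<Rightarrow> nat \<Rightarrow> complex) \<Rightarrow>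
      nat \<Rightarrow> real \<Rightarrow> complex" where
  "delay_conv r q L z i t =
     (\<Sum>j<q. meas_conv (reflect (L i j)) (\<lambda>s. if - r \<le> s then z s j else 0) t)"


subsection \<open>Causality loops\<close>

definition strictly_causal :: "(real set \<Rightarrow> complex) \<Rightarrow> bool" where
  "strictly_causal k \<longleftrightarrow> supported_in {0..} k \<and> k {0} = 0"

definition block_kernel ::
    "nat \<Rightarrow> (nat \<Rightarrow> nat \<Rightarrow> real set \<Rightarrow> complex) \<Rightarrow> (nat \<Rightarrow> nat \<Rightarrow> real set \<Rightarrow> complex) \<Rightarrow>
      (nat \<Rightarrow> nat \<Rightarrow> real set \<Rightarrow> complex) \<Rightarrow> (nat \<Rightarrow> nat \<Rightarrow> real set \<Rightarrow> complex) \<Rightarrow>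
      nat \<Rightarrow> nat \<Rightarrow> real set \<Rightarrow> complex" where
  "block_kernel n A B C D i j =
     (if i < n then
        (if j = n + i then density_kernel heaviside else (\<lambda>S. 0))
      else if i < 2 * n then
        (if j < n then reflect (A (i - n) j)
         else if j < 2 * n then (\<lambda>S. 0)
         else reflect (B (i - n) (j - 2 * n)))
      else
        (if j < n then reflect (C (i - 2 * n) j)
         else if j < 2 * n then (\<lambda>S. 0)
         else reflect (D (i - 2 * n) (j - 2 * n))))"

definition causality_loop ::
    "nat \<Rightarrow> (nat \<Rightarrow> nat \<Rightarrow> real set \<Rightarrow> complex) \<Rightarrow> nat \<Rightarrow> (nat \<Rightarrow> nat) \<Rightarrow> bool" where
  "causality_loop N K j i \<longleftrightarrow>
     1 \<le> j \<and> (\<forall>l\<le>j. i l < N) \<and> i 0 = i j \<and>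
     (\<forall>l<j. \<not> strictly_causal (K (i (Suc l)) (i l)))"

definition ddae_has_causality_loop ::
    "nat \<Rightarrow> nat \<Rightarrow> (nat \<Rightarrow> nat \<Rightarrow> real set \<Rightarrow> complex) \<Rightarrow> (nat \<Rightarrow> nat \<Rightarrow> real set \<Rightarrow> complex) \<Rightarrow>
      (nat \<Rightarrow> nat \<Rightarrow> real set \<Rightarrow> complex) \<Rightarrow> (nat \<Rightarrow> nat \<Rightarrow> real set \<Rightarrow> complex) \<Rightarrow> bool" where
  "ddae_has_causality_loop n m A B C D \<longleftrightarrow>
     (\<exists>j i. causality_loop (2 * n + m) (block_kernel n A B C D) j i)"


subsection \<open>The product space and solutions\<close>

definition L2_on :: "real set \<Rightarrow> nat \<Rightarrow> (real \<Rightarrow> nat \<Rightarrow> complex) \<Rightarrow> bool" where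
  "L2_on S n z \<longleftrightarrow>
     (\<forall>i<n. set_borel_measurable lborel S (\<lambda>t. z t i) \<and>
            set_integrable lborel S (\<lambda>t. (cmod (z t i))\<^sup>2))"

definition locally_L2 :: "real \<Rightarrow> nat \<Rightarrow> (real \<Rightarrow> nat \<Rightarrow> complex) \<Rightarrow> bool" where
  "locally_L2 r n z \<longleftrightarrow> (\<forall>b. L2_on {-r..b} n z)"

definition locally_L1 :: "real \<Rightarrow> nat \<Rightarrow> (real \<Rightarrow> nat \<Rightarrow> complex) \<Rightarrow> bool" where
  "locally_L1 r n z \<longleftrightarrow> (\<forall>b. \<forall>i<n. set_integrable lborel {-r..b} (\<lambda>t. z t i))"

definition product_space ::
    "real \<Rightarrow> nat \<Rightarrow> nat \<Rightarrow>
      ((nat \<Rightarrow> complex) \<times> (real \<Rightarrow> nat \<Rightarrow> complex) \<times> (real \<Rightarrow> nat \<Rightarrow> complex)) set" where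
  "product_space r n m = {(\<phi>, \<xi>, \<psi>). L2_on {-r..0} n \<xi> \<and> L2_on {-r..0} m \<psi>}"

definition product_norm ::
    "real \<Rightarrow> nat \<Rightarrow> nat \<Rightarrow>
      (nat \<Rightarrow> complex) \<times> (real \<Rightarrow> nat \<Rightarrow> complex) \<times> (real \<Rightarrow> nat \<Rightarrow> complex) \<Rightarrow> real" where
  "product_norm r n m = (\<lambda>(\<phi>, \<xi>, \<psi>).
     sqrt ((vnorm n \<phi>)\<^sup>2 + (LINT t:{-r..0}|lborel. (vnorm n (\<xi> t))\<^sup>2 + (vnorm m (\<psi> t))\<^sup>2)))"

definition segment :: "(real \<Rightarrow> nat \<Rightarrow> complex) \<Rightarrow> real \<Rightarrow> real \<Rightarrow> nat \<Rightarrow> complex" where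
  "segment z t \<theta> = z (t + \<theta>)"

definition ae_eq_on ::
    "real set \<Rightarrow> nat \<Rightarrow> (real \<Rightarrow> nat \<Rightarrow> complex) \<Rightarrow> (real \<Rightarrow> nat \<Rightarrow> complex) \<Rightarrow> bool" where
  "ae_eq_on S n z w \<longleftrightarrow> (AE t in lborel. t \<in> S \<longrightarrow> (\<forall>i<n. z t i = w t i))"

text \<open>
  The condition \<open>x(0\<^sup>+) = \<phi>\<close> is a limit along \<open>at_right 0\<close> up to null sets: it depends only on
  the class of \<open>x\<close>, and is the usual right limit when \<open>x\<close> is continuous on \<open>(0,+\<infinity>)\<close>.
\<close>

definition ddae_solution ::
    "real \<Rightarrow> nat \<Rightarrow> nat \<Rightarrow>
      (nat \<Rightarrow> nat \<Rightarrow> real set \<Rightarrow> complex) \<Rightarrow> (nat \<Rightarrow> nat \<Rightarrow> real set \<Rightarrow> complex) \<Rightarrow>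
      (nat \<Rightarrow> nat \<Rightarrow> real set \<Rightarrow> complex) \<Rightarrow> (nat \<Rightarrow> nat \<Rightarrow> real set \<Rightarrow> complex) \<Rightarrow>
      (nat \<Rightarrow> complex) \<times> (real \<Rightarrow> nat \<Rightarrow> complex) \<times> (real \<Rightarrow> nat \<Rightarrow> complex) \<Rightarrow>
      (real \<Rightarrow> nat \<Rightarrow> complex) \<Rightarrow> (real \<Rightarrow> nat \<Rightarrow> complex) \<Rightarrow> bool" where
  "ddae_solution r n m A B C D = (\<lambda>(\<phi>, \<xi>, \<psi>) x y.
     locally_L1 r n x \<and> locally_L1 r m y \<and>
     (\<forall>i<n. ((\<lambda>t. x t i) \<longlongrightarrow> \<phi> i) (inf (at_right 0) (ae_filter lborel))) \<and>
     ae_eq_on {-r..0} n (segment x 0) \<xi> \<and>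
     ae_eq_on {-r..0} m (segment y 0) \<psi> \<and>
     (\<exists>f :: nat \<Rightarrow> complex. AE t in lborel. 0 < t \<longrightarrow>
        (\<forall>i<n. x t i = fun_conv heaviside (delay_conv r n A x i) t
                      + fun_conv heaviside (delay_conv r m B y i) t + f i) \<and>
        (\<forall>i<m. y t i = delay_conv r n C x i t + delay_conv r m D y i t)))"

end

theory Submission
  imports Defs
begin

text \<open>
  Write the system in block diagram form \<open>z = K\<^sup>* \<ast> z + g\<close> on \<open>(0,+\<infinity>)\<close> for \<open>z = (x, v, y)\<close> with
  \<open>v\<close> the derivative of \<open>x\<close>, the initial data entering only through \<open>g\<close>. As \<open>\<lambda> \<rightarrow> \<infinity>\<close>, the Laplace
  transforms at \<open>\<lambda>\<close> of the variations of the entries of \<open>K\<^sup>*\<close> tend to their masses at \<open>0\<close>.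
  Without causality loop, the limit matrix vanishes except along the edges of an acyclic graph, so
  weighting component \<open>i\<close> by \<open>\<epsilon>\<close> to the power of its height in this graph makes the convolution a
  contraction in \<open>L\<^sup>1\<close> and \<open>L\<^sup>2\<close> spaces with weight \<open>e\<^sup>-\<^sup>\<lambda>\<^sup>t\<close>. The \<open>L\<^sup>2\<close> contraction
  gives existence and the estimate, and the \<open>L\<^sup>1\<close> one, localised by causality, uniqueness among
  locally integrable solutions.
\<close>

section \<open>Jordan parts of signed measures\<close>

text \<open>All estimates are carried by nonnegative convolutions in \<open>ennreal\<close>, where
  Tonelli applies without integrability conditions. The complex convolutions are Bochner integrals,
  0 by default when they diverge, so their linearity is available only where the nonnegative
  majorant is finite, that is almost everywhere. Two obstacles shape the norms. The integrator
  kernel has infinite total mass, so kernels are measured by their Laplace transforms. And a locally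
  integrable solution has no growth bound, so its weighted norm may be infinite: truncation at a
  time b restores finiteness, and kernels supported on the half line let the contraction survive the
  truncation. The derivative v is a component of its own because atoms of A and B at 0 act without
  delay; the integrator, which has no atom, then breaks every cycle through x. Convolution with e
  also integrates over negative times, and the free constant f of a solution compensates for this;
  the condition at 0+ determines it.\<close>

definition signed_borel :: "(real set \<Rightarrow> real) \<Rightarrow> bool" where
  "signed_borel \<nu> \<longleftrightarrow> (\<forall>F :: nat \<Rightarrow> real set. range F \<subseteq> sets borel \<longrightarrow> disjoint_family F \<longrightarrow>
     (\<lambda>i. \<nu> (F i)) sums \<nu> (\<Union>i. F i))"

lemma signed_borel_sums:
  "signed_borel \<nu> \<Longrightarrow> (\<And>i. F i \<in> sets borel) \<Longrightarrow> disjoint_family F \<Longrightarrow> (\<lambda>i. \<nu> (F i)) sums \<nu> (\<Union>i. F i)"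
  by (auto simp: signed_borel_def)

lemma signed_borel_empty:
  assumes "signed_borel \<nu>" shows "\<nu> {} = 0"
proof -
  have "(\<lambda>i::nat. \<nu> {}) sums \<nu> (\<Union>i::nat. {})"
    by (rule signed_borel_sums[OF assms]) (auto simp: disjoint_family_on_def)
  then show ?thesis by (simp add: sums_iff summable_const_iff)
qed

lemma signed_borel_Un:
  assumes \<nu>: "signed_borel \<nu>" and A: "A \<in> sets borel" and B: "B \<in> sets borel" and "A \<inter> B = {}"
  shows "\<nu> (A \<union> B) = \<nu> A + \<nu> B"
proof -
  let ?F = "\<lambda>i::nat. if i = 0 then A else if i = 1 then B else {}"
  have "(\<lambda>i. \<nu> (?F i)) sums \<nu> (\<Union>i. ?F i)"
    by (rule signed_borel_sums[OF \<nu>]) (use assms in \<open>auto simp: disjoint_family_on_def\<close>)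
  moreover have "(\<Union>i. ?F i) = A \<union> B" by (auto split: if_splits)
  moreover have "(\<lambda>i. \<nu> (?F i)) sums (\<Sum>i\<in>{0,1}. \<nu> (?F i))"
    by (rule sums_finite) (auto simp: signed_borel_empty[OF \<nu>])
  ultimately show ?thesis using sums_unique2 by fastforce
qed

lemma signed_borel_Diff:
  assumes \<nu>: "signed_borel \<nu>" and A: "A \<in> sets borel" and B: "B \<in> sets borel" and "B \<subseteq> A"
  shows "\<nu> (A - B) = \<nu> A - \<nu> B"
proof -
  have "(A - B) \<union> B = A" "(A - B) \<inter> B = {}" using \<open>B \<subseteq> A\<close> by auto
  then show ?thesis using signed_borel_Un[OF \<nu>, of "A - B" B] A B by simp
qed

text \<open>
  If the values on subsets of some set were unbounded, one could split off successively
  disjoint pieces of mass at least 1, contradicting convergence of the series.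
\<close>

lemma signed_borel_bounded:
  assumes \<nu>: "signed_borel \<nu>"
  shows "\<exists>K. \<forall>U\<in>sets borel. \<nu> U \<le> K"
proof (rule ccontr)
  assume neg: "\<not> ?thesis"
  define big where "big T \<longleftrightarrow> T \<in> sets borel \<and> (\<forall>K. \<exists>U\<in>sets borel. U \<subseteq> T \<and> K < \<nu> U)" for T
  have step: "\<exists>T'. big T' \<and> T' \<subseteq> T \<and> 1 \<le> \<bar>\<nu> (T - T')\<bar>" if T: "big T" for T
  proof -
    have Tm: "T \<in> sets borel" using T by (simp add: big_def)
    \<comment> \<open>The margin 1 beyond \<open>\<bar>\<nu> T\<bar>\<close> gives both
      \<open>U\<close> and \<open>T - U\<close> a mass of absolute value above 1. One of the two is
      still \<open>big\<close>; it is kept and the other is split off.\<close>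
    obtain U where U: "U \<in> sets borel" "U \<subseteq> T" "\<bar>\<nu> T\<bar> + 1 < \<nu> U"
      using T unfolding big_def by blast
    have d: "\<nu> (T - U) = \<nu> T - \<nu> U" by (rule signed_borel_Diff[OF \<nu> Tm U(1,2)])
    have "big U \<or> big (T - U)"
    proof (rule ccontr)
      assume "\<not> ?thesis"
      then have nb: "\<not> big U" "\<not> big (T - U)" by blast+
      obtain K1 where K1: "\<And>V. V \<in> sets borel \<Longrightarrow> V \<subseteq> U \<Longrightarrow> \<nu> V \<le> K1"
        using nb(1) U(1) unfolding big_def by (meson not_less)
      have "T - U \<in> sets borel" using Tm U by simp
      then obtain K2 where K2: "\<And>V. V \<in> sets borel \<Longrightarrow> V \<subseteq> T - U \<Longrightarrow> \<nu> V \<le> K2"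
        using nb(2) unfolding big_def by (meson not_less)
      obtain V where V: "V \<in> sets borel" "V \<subseteq> T" "K1 + K2 < \<nu> V"
        using T unfolding big_def by blast
      have "\<nu> V = \<nu> (V \<inter> U) + \<nu> (V - U)"
        using signed_borel_Un[OF \<nu>, of "V \<inter> U" "V - U"] V U by (auto simp: Int_Diff_Un Int_Diff_disjoint)
      also have "\<dots> \<le> K1 + K2" using V U by (intro add_mono K1 K2) auto
      finally show False using V by simp
    qed
    then show ?thesis
    proof
      assume "big U" then show ?thesis using U d by (intro exI[of _ U]) auto
    next
      assume b: "big (T - U)"
      have "T - (T - U) = U" using U by auto
      then show ?thesis using b U by (intro exI[of _ "T - U"]) auto
    qed
  qed
  have "big UNIV" using neg by (auto simp: big_def not_le)
  then obtain S where S: "\<And>n. big (S n)" "\<And>n. S (Suc n) \<subseteq> S n \<and> 1 \<le> \<bar>\<nu> (S n - S (Suc n))\<bar>"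
    using dependent_nat_choice[of "\<lambda>n T. big T" "\<lambda>n T T'. T' \<subseteq> T \<and> 1 \<le> \<bar>\<nu> (T - T')\<bar>"] step by metis
  have dec: "S j \<subseteq> S i" if "i \<le> j" for i j
    by (rule lift_Suc_antimono_le[of S, OF _ that]) (use S(2) in auto)
  have "disjoint_family (\<lambda>n. S n - S (Suc n))"
    unfolding disjoint_family_on_def
  proof (intro ballI impI)
    fix i j :: nat assume "i \<noteq> j"
    then consider "Suc i \<le> j" | "Suc j \<le> i" by linarith
    then show "(S i - S (Suc i)) \<inter> (S j - S (Suc j)) = {}"
      by cases (use dec[of "Suc i" j] dec[of "Suc j" i] in auto)
  qed
  then have "(\<lambda>n. \<nu> (S n - S (Suc n))) sums \<nu> (\<Union>n. S n - S (Suc n))"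
    using S(1) by (intro signed_borel_sums[OF \<nu>]) (auto simp: big_def)
  then have "(\<lambda>n. \<nu> (S n - S (Suc n))) \<longlonglongrightarrow> 0" by (intro summable_LIMSEQ_zero) (simp add: sums_iff)
  then have "eventually (\<lambda>n. \<bar>\<nu> (S n - S (Suc n))\<bar> < 1) sequentially"
    by (auto dest!: tendstoD[of _ _ _ 1] simp: dist_real_def)
  then show False using S(2) by (auto simp: eventually_sequentially not_less[symmetric])
qed

text \<open>This is the set function inside \<open>jordan_pos\<close>. It has to be shown to be a
  measure before \<open>emeasure\<close> of \<open>jordan_pos\<close> can be read off from it,
  because \<open>measure_of\<close> falls back to the zero measure otherwise.\<close>

definition pos_variation :: "(real set \<Rightarrow> real) \<Rightarrow> real set \<Rightarrow> ennreal" where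
  "pos_variation \<nu> T = (SUP U \<in> {U \<in> sets borel. U \<subseteq> T}. ennreal (\<nu> U))"

lemma pos_variation_upper: "U \<in> sets borel \<Longrightarrow> U \<subseteq> T \<Longrightarrow> ennreal (\<nu> U) \<le> pos_variation \<nu> T"
  unfolding pos_variation_def by (rule SUP_upper) auto

lemma pos_variation_mono: "S \<subseteq> T \<Longrightarrow> pos_variation \<nu> S \<le> pos_variation \<nu> T"
  unfolding pos_variation_def by (rule SUP_subset_mono) auto

lemma pos_variation_null:
  assumes "\<And>U. U \<in> sets borel \<Longrightarrow> U \<subseteq> T \<Longrightarrow> \<nu> U = 0" shows "pos_variation \<nu> T = 0"
  unfolding pos_variation_def using assms by (auto simp: SUP_eq_iff intro!: antisym SUP_least)

lemma pos_variation_superadd: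
  assumes \<nu>: "signed_borel \<nu>" and "A \<inter> B = {}"
  shows "pos_variation \<nu> A + pos_variation \<nu> B \<le> pos_variation \<nu> (A \<union> B)"
proof -
  have "ennreal (\<nu> U) + ennreal (\<nu> V) \<le> pos_variation \<nu> (A \<union> B)"
    if U: "U \<in> sets borel" "U \<subseteq> A" and V: "V \<in> sets borel" "V \<subseteq> B" for U V
  proof -
    \<comment> \<open>A nonpositive value becomes 0 in \<open>ennreal\<close>, and then the other
      set alone is a competitor for \<open>A \<union> B\<close>; the union
      \<open>U \<union> V\<close> is the competitor when both values are nonnegative.\<close>
    have le: "\<nu> U \<le> 0 \<or> \<nu> V \<le> 0 \<or> (0 \<le> \<nu> U \<and> 0 \<le> \<nu> V)" by linarith
    have "ennreal (\<nu> U) \<le> pos_variation \<nu> (A \<union> B)" "ennreal (\<nu> V) \<le> pos_variation \<nu> (A \<union> B)"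
      "ennreal (\<nu> (U \<union> V)) \<le> pos_variation \<nu> (A \<union> B)"
      using U V by (auto intro!: pos_variation_upper)
    moreover have "\<nu> (U \<union> V) = \<nu> U + \<nu> V" using assms U V by (intro signed_borel_Un[OF \<nu>]) auto
    ultimately show ?thesis using le by (auto simp: ennreal_neg ennreal_plus)
  qed
  then have "ennreal (\<nu> U) + pos_variation \<nu> B \<le> pos_variation \<nu> (A \<union> B)"
    if "U \<in> sets borel" "U \<subseteq> A" for U
    using that by (subst pos_variation_def[of _ B], subst ennreal_SUP_add_right)
      (auto intro!: SUP_least)
  then show ?thesis
    by (subst pos_variation_def[of _ A], subst ennreal_SUP_add_left[symmetric])
      (auto intro!: SUP_least)
qed

text \<open>Superadditivity bounds the partial sums by the value of the union. Conversely, a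
  competitor \<open>U\<close> for the union is cut into the pieces \<open>U \<inter> A i\<close>,
  whose values sum to \<open>\<nu> U\<close>; replacing negative pieces by 0 only increases the
  partial sums.\<close>

lemma countably_additive_pos_variation:
  assumes \<nu>: "signed_borel \<nu>"
  shows "countably_additive (sets borel) (pos_variation \<nu>)"
proof (rule countably_additiveI)
  fix A :: "nat \<Rightarrow> real set" assume A: "range A \<subseteq> sets borel" "disjoint_family A"
  have Am: "A i \<in> sets borel" for i using A by auto
  let ?P = "pos_variation \<nu>"
  have fin: "(\<Sum>i<k. ?P (A i)) \<le> ?P (\<Union>i<k. A i)" for k
  proof (induction k)
    case (Suc k)
    have "A i \<inter> A k = {}" if "i < k" for i
      using A(2) that unfolding disjoint_family_on_def by (metis UNIV_I less_irrefl)
    then have "(\<Union>i<k. A i) \<inter> A k = {}" by blast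
    then have "?P (\<Union>i<k. A i) + ?P (A k) \<le> ?P ((\<Union>i<k. A i) \<union> A k)"
      by (rule pos_variation_superadd[OF \<nu>])
    with Suc have "(\<Sum>i<k. ?P (A i)) + ?P (A k) \<le> ?P ((\<Union>i<k. A i) \<union> A k)"
      by (meson add_right_mono order_trans)
    then show ?case by (simp add: lessThan_Suc Un_commute add.commute)
  qed simp
  show "(\<Sum>i. ?P (A i)) = ?P (\<Union>i. A i)"
  proof (rule antisym)
    show "(\<Sum>i. ?P (A i)) \<le> ?P (\<Union>i. A i)"
      unfolding suminf_eq_SUP
      by (rule SUP_least) (rule order_trans[OF fin], rule pos_variation_mono, auto)
    show "?P (\<Union>i. A i) \<le> (\<Sum>i. ?P (A i))"
      unfolding pos_variation_def[of _ "\<Union>i. A i"]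
    proof (rule SUP_least, clarsimp)
      fix U assume U: "U \<in> sets borel" "U \<subseteq> (\<Union>i. A i)"
      have "(\<lambda>i. \<nu> (U \<inter> A i)) sums \<nu> (\<Union>i. U \<inter> A i)"
        using U Am disjoint_family_on_bisimulation[OF A(2), of "\<lambda>i. U \<inter> A i"]
        by (intro signed_borel_sums[OF \<nu>]) auto
      moreover have "(\<Union>i. U \<inter> A i) = U" using U by auto
      ultimately have "(\<lambda>k. \<Sum>i<k. \<nu> (U \<inter> A i)) \<longlonglongrightarrow> \<nu> U" by (simp add: sums_def)
      then have lim: "(\<lambda>k. ennreal (\<Sum>i<k. \<nu> (U \<inter> A i))) \<longlonglongrightarrow> ennreal (\<nu> U)" by (rule tendsto_ennrealI)
      have "ennreal (\<Sum>i<k. \<nu> (U \<inter> A i)) \<le> (\<Sum>i. ?P (A i))" for k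
      proof -
        have "ennreal (\<Sum>i<k. \<nu> (U \<inter> A i)) \<le> ennreal (\<Sum>i<k. max 0 (\<nu> (U \<inter> A i)))"
          by (intro ennreal_leI sum_mono) auto
        also have "\<dots> = (\<Sum>i<k. ennreal (max 0 (\<nu> (U \<inter> A i))))" by (simp add: sum_ennreal)
        also have "\<dots> \<le> (\<Sum>i<k. ?P (A i))"
        proof (intro sum_mono)
          fix i
          have "ennreal (\<nu> (U \<inter> A i)) \<le> ?P (A i)" by (rule pos_variation_upper) (use U Am in auto)
          then show "ennreal (max 0 (\<nu> (U \<inter> A i))) \<le> ?P (A i)"
            by (cases "0 \<le> \<nu> (U \<inter> A i)") (auto simp: max_def)
        qed
        also have "\<dots> \<le> (\<Sum>i. ?P (A i))" by (rule sum_le_suminf) auto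
        finally show ?thesis .
      qed
      with lim show "ennreal (\<nu> U) \<le> (\<Sum>i. ?P (A i))" by (intro LIMSEQ_le_const2) auto
    qed
  qed
qed

lemma sets_jordan_pos [simp, measurable_cong]: "sets (jordan_pos \<nu>) = sets borel"
  and space_jordan_pos [simp]: "space (jordan_pos \<nu>) = UNIV"
  using sets.sigma_sets_eq[of "borel :: real measure"]
  by (simp_all add: jordan_pos_def sets_measure_of_conv space_measure_of_conv)

lemma emeasure_jordan_pos:
  assumes "signed_borel \<nu>" "T \<in> sets borel"
  shows "emeasure (jordan_pos \<nu>) T = pos_variation \<nu> T"
proof (rule emeasure_measure_of[OF jordan_pos_def[unfolded pos_variation_def[symmetric]]])
  show "positive (sets (jordan_pos \<nu>)) (pos_variation \<nu>)"
    using assms by (auto simp: positive_def signed_borel_empty intro!: pos_variation_null)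
  show "countably_additive (sets (jordan_pos \<nu>)) (pos_variation \<nu>)"
    using assms by (simp add: countably_additive_pos_variation)
qed (use assms in auto)

lemma finite_measure_jordan_pos:
  assumes "signed_borel \<nu>" shows "finite_measure (jordan_pos \<nu>)"
proof (rule finite_measureI)
  obtain K where "\<forall>U\<in>sets borel. \<nu> U \<le> K" using signed_borel_bounded[OF assms] by blast
  then have "pos_variation \<nu> UNIV \<le> ennreal K"
    unfolding pos_variation_def by (intro SUP_least ennreal_leI) auto
  then have "pos_variation \<nu> UNIV \<noteq> \<infinity>" by (metis ennreal_less_top infinity_ennreal_def leD)
  then show "emeasure (jordan_pos \<nu>) (space (jordan_pos \<nu>)) \<noteq> \<infinity>"
    by (simp add: emeasure_jordan_pos[OF assms])
qed

text \<open>Vanishing is known on bounded Borel sets, so the complement of \<open>S\<close> is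
  exhausted by its intersections with the intervals \<open>[-k, k]\<close>.\<close>

lemma AE_jordan_pos:
  assumes "signed_borel \<nu>" and S: "S \<in> sets borel"
    and null: "\<And>T. T \<in> sets borel \<Longrightarrow> bounded T \<Longrightarrow> T \<inter> S = {} \<Longrightarrow> \<nu> T = 0"
  shows "AE s in jordan_pos \<nu>. s \<in> S"
proof -
  let ?A = "\<lambda>k::nat. {- real k..real k} - S"
  have "?A k \<in> null_sets (jordan_pos \<nu>)" for k
  proof (rule null_setsI)
    show "emeasure (jordan_pos \<nu>) (?A k) = 0"
      using S by (subst emeasure_jordan_pos[OF assms(1)])
        (auto intro!: pos_variation_null null intro: bounded_subset[of "{- real k..real k}"])
  qed (use S in auto)
  then have N: "(\<Union>k. ?A k) \<in> null_sets (jordan_pos \<nu>)" by (rule null_sets_UN)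
  have "x \<in> (\<Union>k. ?A k)" if "x \<notin> S" for x
  proof -
    obtain k :: nat where "\<bar>x\<bar> \<le> real k" using real_arch_simple by blast
    then show ?thesis using that by (intro UN_I[of k]) auto
  qed
  then have "{x \<in> space (jordan_pos \<nu>). x \<notin> S} \<subseteq> (\<Union>k. ?A k)" by auto
  with N show ?thesis by (rule AE_I')
qed

section \<open>The four positive parts of a complex measure\<close>

text \<open>Multiplication by \<open>(- \<i>) ^ p\<close> rotates the measure: p = 0, 1, 2, 3 select
  the positive parts of Re, Im, -Re and -Im. With the coefficients \<open>\<i> ^ p\<close> these
  four positive measures recombine to the complex one.\<close>

definition part :: "nat \<Rightarrow> (real set \<Rightarrow> complex) \<Rightarrow> real measure" where
  "part p k = jordan_pos (\<lambda>S. Re ((- \<i>) ^ p * k S))"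

lemma sets_part [simp, measurable_cong]: "sets (part p k) = sets borel"
  and space_part [simp]: "space (part p k) = UNIV"
  by (simp_all add: part_def)

lemma cm_integral_part: "cm_integral k f = (\<Sum>p<4. \<i> ^ p * integral\<^sup>L (part p k) f)"
  by (simp add: cm_integral_def part_def eval_nat_numeral lessThan_Suc algebra_simps)

lemma signed_borel_part:
  assumes "complex_borel_measure k" shows "signed_borel (\<lambda>S. Re ((- \<i>) ^ p * k S))"
  unfolding signed_borel_def
proof (intro allI impI)
  fix F :: "nat \<Rightarrow> real set" assume "range F \<subseteq> sets borel" "disjoint_family F"
  then have "(\<lambda>i. k (F i)) sums k (\<Union>i. F i)" using assms by (auto simp: complex_borel_measure_def)
  then show "(\<lambda>i. Re ((- \<i>) ^ p * k (F i))) sums Re ((- \<i>) ^ p * k (\<Union>i. F i))"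
    by (intro sums_Re sums_mult)
qed

lemma finite_measure_part: "complex_borel_measure k \<Longrightarrow> finite_measure (part p k)"
  unfolding part_def by (intro finite_measure_jordan_pos signed_borel_part)

lemma AE_part:
  assumes "complex_borel_measure k" "supported_in S k" "S \<in> sets borel"
  shows "AE s in part p k. s \<in> S"
  unfolding part_def using assms
  by (intro AE_jordan_pos signed_borel_part) (auto simp: supported_in_def)

text \<open>The only subsets of a singleton are itself and the empty set, so a point without mass
  carries no variation either. This transfers strict causality from a kernel to its four
  parts.\<close>

lemma emeasure_part_singleton:
  assumes "complex_borel_measure k" "k {a} = 0"
  shows "emeasure (part p k) {a} = 0"
proof -
  have "k {} = 0"
    using signed_borel_empty[OF signed_borel_part[OF assms(1), of 0]]
      signed_borel_empty[OF signed_borel_part[OF assms(1), of 1]] by (simp add: complex_eq_iff)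
  then show ?thesis
    unfolding part_def
    by (subst emeasure_jordan_pos[OF signed_borel_part[OF assms(1)]])
      (auto intro!: pos_variation_null simp: assms(2) subset_singleton_iff)
qed

lemma emeasure_part_zero [simp]: "emeasure (part p (\<lambda>S. 0)) T = 0"
proof -
  have "signed_borel (\<lambda>S. 0)" by (simp add: signed_borel_def)
  then have "emeasure (part p (\<lambda>S. 0)) UNIV = 0"
    by (simp add: part_def emeasure_jordan_pos pos_variation_null)
  then show ?thesis
    by (metis emeasure_notin_sets emeasure_mono sets.top space_part subset_UNIV le_zero_eq)
qed

lemma complex_borel_measure_reflect:
  assumes "complex_borel_measure k" shows "complex_borel_measure (reflect k)"
  unfolding complex_borel_measure_def
proof (intro allI impI)
  fix F :: "nat \<Rightarrow> real set" assume F: "range F \<subseteq> sets borel" "disjoint_family F"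
  have "uminus ` S \<in> sets borel" if "S \<in> sets borel" for S :: "real set"
  proof -
    have "uminus ` S = uminus -` S" by (force simp: image_iff)
    then show ?thesis using measurable_sets[OF borel_measurable_uminus[OF measurable_ident_sets[OF refl]] that] by simp
  qed
  then have "range (\<lambda>i. uminus ` F i) \<subseteq> sets borel" using F(1) by auto
  moreover have "disjoint_family (\<lambda>i. uminus ` F i)" using F(2)
    by (simp add: disjoint_family_on_def image_Int[of uminus, symmetric])
  ultimately have "(\<lambda>i. k (uminus ` F i)) sums k (\<Union>i. uminus ` F i)"
    using assms by (auto simp: complex_borel_measure_def)
  then show "(\<lambda>i. reflect k (F i)) sums reflect k (\<Union>i. F i)" by (simp add: reflect_def image_UN)
qed

lemma supported_in_reflect:
  assumes "supported_in {-r..0} k" shows "supported_in {0..} (reflect k)"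
  unfolding supported_in_def reflect_def
proof (intro ballI impI)
  fix T :: "real set" assume T: "T \<in> sets borel" "bounded T" "T \<inter> {0..} = {}"
  have "uminus ` T = uminus -` T" by (force simp: image_iff)
  then have "uminus ` T \<in> sets borel"
    using measurable_sets[OF borel_measurable_uminus[OF measurable_ident_sets[OF refl]] T(1)] by simp
  moreover have "bounded (uminus ` T)" using T(2) by simp
  moreover have "uminus ` T \<inter> {-r..0} = {}" using T(3) by force
  ultimately show "k (uminus ` T) = 0" using assms by (simp add: supported_in_def)
qed

section \<open>Weights for acyclic matrices\<close>

text \<open>The height is the number of strict ancestors. Along an edge from \<open>j\<close> to
  \<open>i\<close> the ancestors of \<open>j\<close> are ancestors of \<open>i\<close>, and so is
  \<open>j\<close> itself, which by acyclicity is not among its own ancestors.\<close>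

lemma acyclic_height:
  assumes fin: "finite R" and acyc: "acyclic R"
  shows "\<exists>h :: 'a \<Rightarrow> nat. \<forall>(j, i) \<in> R. h j < h i"
proof (intro exI[of _ "\<lambda>i. card {j. (j, i) \<in> R\<^sup>+}"] ballI, clarify)
  fix j i assume ji: "(j, i) \<in> R"
  have "{k. (k, i) \<in> R\<^sup>+} \<subseteq> Domain R" using trancl_domain[of R] by blast
  then have f: "finite {k. (k, i) \<in> R\<^sup>+}"
    by (rule finite_subset) (use fin in \<open>simp add: finite_Domain\<close>)
  have "{k. (k, j) \<in> R\<^sup>+} \<subset> {k. (k, i) \<in> R\<^sup>+}"
  proof (rule psubsetI)
    show "{k. (k, j) \<in> R\<^sup>+} \<subseteq> {k. (k, i) \<in> R\<^sup>+}" using ji by (auto intro: trancl_into_trancl)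
    have "j \<in> {k. (k, i) \<in> R\<^sup>+}" "j \<notin> {k. (k, j) \<in> R\<^sup>+}" using ji acyc by (auto simp: acyclic_def)
    then show "{k. (k, j) \<in> R\<^sup>+} \<noteq> {k. (k, i) \<in> R\<^sup>+}" by blast
  qed
  then show "card {k. (k, j) \<in> R\<^sup>+} < card {k. (k, i) \<in> R\<^sup>+}" by (rule psubset_card_mono[OF f])
qed

text \<open>Edges run from column to row, since component \<open>j\<close> feeds component
  \<open>i\<close>. A nonzero limit entry in column \<open>j\<close> therefore sits in a row of
  larger height, whose weight is at most \<open>\<epsilon> * w j\<close>. The limit inequality is
  strict, with half of \<open>c\<close> to spare, so it persists for large \<open>k\<close>.\<close>

lemma acyclic_limit_weights:
  fixes a :: "nat \<Rightarrow> nat \<Rightarrow> nat \<Rightarrow> real" and a0 :: "nat \<Rightarrow> nat \<Rightarrow> real"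
  assumes lim: "\<And>i j. i < N \<Longrightarrow> j < N \<Longrightarrow> (\<lambda>k. a k i j) \<longlonglongrightarrow> a0 i j"
    and acyc: "acyclic {(j, i). i < N \<and> j < N \<and> a0 i j \<noteq> 0}" and c: "0 < c"
  shows "\<exists>w. (\<forall>i. 0 < w i) \<and>
    eventually (\<lambda>k. \<forall>j<N. (\<Sum>i<N. w i * a k i j) \<le> c * w j) sequentially"
proof -
  let ?R = "{(j, i). i < N \<and> j < N \<and> a0 i j \<noteq> 0}"
  have "?R \<subseteq> {..<N} \<times> {..<N}" by auto
  then have "finite ?R" by (rule finite_subset) auto
  then obtain h :: "nat \<Rightarrow> nat" where h: "\<And>i j. (j, i) \<in> ?R \<Longrightarrow> h j < h i"
    using acyclic_height[OF _ acyc] by blast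
  define s where "s = (\<Sum>j<N. \<Sum>i<N. \<bar>a0 i j\<bar>)"
  \<comment> \<open>At most 1, so that powers decrease with the exponent; at most
    \<open>c / 2 / (1 + s)\<close>, so that \<epsilon> times the sum \<open>s\<close> of all
    absolute entries is at most \<open>c / 2\<close>. The summand 1 keeps the denominator
    positive.\<close>
  define \<epsilon> where "\<epsilon> = min 1 (c / 2 / (1 + s))"
  define w where "w i = \<epsilon> ^ h i" for i
  have s: "0 \<le> s" unfolding s_def by (intro sum_nonneg) auto
  have eps: "0 < \<epsilon>" "\<epsilon> \<le> 1" using s c by (auto simp: \<epsilon>_def)
  have "\<epsilon> * s \<le> c / 2 / (1 + s) * s" by (rule mult_right_mono) (use s in \<open>auto simp: \<epsilon>_def\<close>)
  also have "\<dots> \<le> c / 2" using s c by (simp add: field_simps)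
  finally have es: "\<epsilon> * s \<le> c / 2" .
  have w: "0 < w i" for i using eps by (simp add: w_def)
  have lt: "(\<Sum>i<N. w i * a0 i j) < c * w j" if j: "j < N" for j
  proof -
    have "(\<Sum>i<N. w i * a0 i j) \<le> (\<Sum>i<N. \<epsilon> * w j * \<bar>a0 i j\<bar>)"
    proof (intro sum_mono)
      fix i assume i: "i \<in> {..<N}"
      show "w i * a0 i j \<le> \<epsilon> * w j * \<bar>a0 i j\<bar>"
      proof (cases "a0 i j = 0")
        case False
        then have "Suc (h j) \<le> h i" using h i j by (simp add: Suc_le_eq)
        then have "w i \<le> \<epsilon> * w j"
          using power_decreasing[of "Suc (h j)" "h i" \<epsilon>] eps by (simp add: w_def)
        then show ?thesis
          by (meson abs_ge_self abs_ge_zero mult_mono order_trans mult_left_mono less_imp_le w mult_right_mono)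
      qed simp
    qed
    also have "\<dots> = w j * (\<epsilon> * (\<Sum>i<N. \<bar>a0 i j\<bar>))" by (simp add: sum_distrib_left mult_ac)
    also have "\<dots> \<le> w j * (\<epsilon> * s)"
      unfolding s_def using w[of j] eps j
      by (intro mult_left_mono member_le_sum) (auto intro!: sum_nonneg)
    also have "\<dots> \<le> w j * (c / 2)" using w[of j] es by (intro mult_left_mono) auto
    also have "\<dots> < c * w j" using w[of j] c by simp
    finally show ?thesis .
  qed
  have "eventually (\<lambda>k. (\<Sum>i<N. w i * a k i j) \<le> c * w j) sequentially" if j: "j < N" for j
  proof -
    have "(\<lambda>k. \<Sum>i<N. w i * a k i j) \<longlonglongrightarrow> (\<Sum>i<N. w i * a0 i j)"
      using lim j by (intro tendsto_sum tendsto_mult) auto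
    from order_tendstoD(2)[OF this lt[OF j]] show ?thesis by eventually_elim simp
  qed
  then have "eventually (\<lambda>k. \<forall>j\<in>{..<N}. (\<Sum>i<N. w i * a k i j) \<le> c * w j) sequentially"
    by (intro eventually_ball_finite) auto
  then show ?thesis using w by (intro exI[of _ w]) (auto elim: eventually_mono)
qed

section \<open>Laplace transforms of causal measures\<close>

definition laplace :: "real \<Rightarrow> real measure \<Rightarrow> ennreal" where
  "laplace l M = (\<integral>\<^sup>+s. ennreal (exp (- l * s)) \<partial>M)"

lemma laplace_antimono:
  assumes "AE s in M. 0 \<le> s" "a \<le> b" shows "laplace b M \<le> laplace a M"
  unfolding laplace_def
  by (rule nn_integral_mono_AE) (use assms in \<open>auto elim!: eventually_mono intro!: ennreal_leI mult_right_mono\<close>)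

text \<open>On the half line the integrands \<open>exp (- real (Suc k) * s)\<close> decrease to the
  indicator of \<open>{0}\<close> and are dominated by \<open>exp (- s)\<close>. Finiteness at rate
  1 stands in for finiteness of \<open>M\<close>, which fails for the Heaviside kernel.\<close>

lemma laplace_tendsto:
  assumes sets[measurable_cong]: "sets M = sets borel" and AE: "AE s in M. 0 \<le> s" and fin: "laplace 1 M < \<infinity>"
  shows "(\<lambda>k. enn2real (laplace (real (Suc k)) M)) \<longlonglongrightarrow> measure M {0}"
proof -
  have dom: "integrable M (\<lambda>s. exp (- s) :: real)"
    using fin by (auto simp: integrable_iff_bounded laplace_def)
  have eq: "enn2real (laplace (real (Suc k)) M) = (LINT s|M. exp (- real (Suc k) * s))" for k
    by (subst integral_eq_nn_integral) (auto simp: laplace_def)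
  have "(\<lambda>k. LINT s|M. exp (- real (Suc k) * s)) \<longlonglongrightarrow> (LINT s|M. indicator {0} s)"
  proof (rule integral_dominated_convergence[where w = "\<lambda>s. exp (- s)"])
    show "AE s in M. (\<lambda>k. exp (- real (Suc k) * s)) \<longlonglongrightarrow> indicator {0} s"
      using AE
    proof eventually_elim
      case (elim s)
      show ?case
      proof (cases "s = 0")
        case False
        then have "norm (exp (- s)) < 1" using elim by simp
        then have "(\<lambda>k. exp (- s) ^ Suc k) \<longlonglongrightarrow> 0" by (intro LIMSEQ_Suc LIMSEQ_power_zero)
        then show ?thesis using False by (simp add: exp_of_nat_mult[symmetric] algebra_simps del: power_Suc of_nat_Suc)
      qed simp
    qed
    show "AE s in M. norm (exp (- real (Suc k) * s)) \<le> exp (- s)" for k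
      using AE by eventually_elim (simp add: algebra_simps)
  qed (use dom in \<open>simp_all add: sets_eq_imp_space_eq[OF sets]\<close>)
  then show ?thesis unfolding eq using sets_eq_imp_space_eq[OF sets] by simp
qed

text \<open>Tonelli and translation invariance: the exponential weight at \<open>t\<close> factors
  into its values at \<open>s\<close> and at \<open>t - s\<close>. The factor \<open>h\<close> is 1
  for the L1 estimate and \<open>exp (l * s)\<close> for the L2 estimate, where it is left over from
  Cauchy-Schwarz.\<close>

lemma nn_integral_conv:
  fixes f h :: "real \<Rightarrow> ennreal"
  assumes M: "sigma_finite_measure M" and sets[measurable_cong]: "sets M = sets borel"
    and [measurable]: "f \<in> borel_measurable borel" "h \<in> borel_measurable borel"
  shows "(\<integral>\<^sup>+t. exp (- l * t) * (\<integral>\<^sup>+s. h s * f (t - s) \<partial>M) \<partial>lborel) =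
    (\<integral>\<^sup>+s. exp (- l * s) * h s \<partial>M) * (\<integral>\<^sup>+t. exp (- l * t) * f t \<partial>lborel)"
proof -
  interpret M: sigma_finite_measure M by fact
  interpret pair_sigma_finite lborel M ..
  have "(\<integral>\<^sup>+t. exp (- l * t) * (\<integral>\<^sup>+s. h s * f (t - s) \<partial>M) \<partial>lborel) =
      (\<integral>\<^sup>+t. (\<integral>\<^sup>+s. exp (- l * t) * (h s * f (t - s)) \<partial>M) \<partial>lborel)"
    by (subst nn_integral_cmult) auto
  also have "\<dots> = (\<integral>\<^sup>+s. (\<integral>\<^sup>+t. exp (- l * t) * (h s * f (t - s)) \<partial>lborel) \<partial>M)"
    by (rule Fubini'[symmetric]) simp
  also have "\<dots> = (\<integral>\<^sup>+s. exp (- l * s) * h s * (\<integral>\<^sup>+t. exp (- l * t) * f t \<partial>lborel) \<partial>M)"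
  proof (rule nn_integral_cong)
    fix s
    have "(\<integral>\<^sup>+t. exp (- l * t) * (h s * f (t - s)) \<partial>lborel) =
        (\<integral>\<^sup>+t. exp (- l * (s + 1 * t)) * (h s * f ((s + 1 * t) - s)) \<partial>lborel)"
      by (subst nn_integral_real_affine[where c = 1 and t = s]) auto
    also have "\<dots> = (\<integral>\<^sup>+t. exp (- l * s) * h s * (exp (- l * t) * f t) \<partial>lborel)"
    proof (intro nn_integral_cong)
      fix t
      have "exp (- l * (s + 1 * t)) = exp (- l * s) * exp (- l * t)"
        by (simp add: algebra_simps flip: exp_add)
      then show "exp (- l * (s + 1 * t)) * (h s * f ((s + 1 * t) - s)) =
          exp (- l * s) * h s * (exp (- l * t) * f t)"
        by (simp add: ennreal_mult mult_ac)
    qed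
    also have "\<dots> = exp (- l * s) * h s * (\<integral>\<^sup>+t. exp (- l * t) * f t \<partial>lborel)"
      by (subst nn_integral_cmult) auto
    finally show "(\<integral>\<^sup>+t. exp (- l * t) * (h s * f (t - s)) \<partial>lborel) =
        exp (- l * s) * h s * (\<integral>\<^sup>+t. exp (- l * t) * f t \<partial>lborel)" .
  qed
  also have "\<dots> = (\<integral>\<^sup>+s. exp (- l * s) * h s \<partial>M) * (\<integral>\<^sup>+t. exp (- l * t) * f t \<partial>lborel)"
    by (rule nn_integral_multc) simp
  finally show ?thesis .
qed

lemma nn_integral_conv_laplace:
  fixes f :: "real \<Rightarrow> ennreal"
  assumes "sigma_finite_measure M" "sets M = sets borel" "f \<in> borel_measurable borel"
  shows "(\<integral>\<^sup>+t. exp (- l * t) * (\<integral>\<^sup>+s. f (t - s) \<partial>M) \<partial>lborel) =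
    laplace l M * (\<integral>\<^sup>+t. exp (- l * t) * f t \<partial>lborel)"
  using nn_integral_conv[OF assms, of "\<lambda>_. 1" l] by (simp add: laplace_def)

text \<open>Cauchy--Schwarz with the splitting \<open>f = exp (- l s / 2) \<cdot> exp (l s / 2) f\<close>.\<close>

lemma nn_integral_conv_square:
  fixes f :: "real \<Rightarrow> ennreal"
  assumes M: "sigma_finite_measure M" and sets[measurable_cong]: "sets M = sets borel"
    and [measurable]: "f \<in> borel_measurable borel"
  shows "(\<integral>\<^sup>+t. exp (- (2 * l) * t) * (\<integral>\<^sup>+s. f (t - s) \<partial>M)\<^sup>2 \<partial>lborel) \<le>
    (laplace l M)\<^sup>2 * (\<integral>\<^sup>+t. exp (- (2 * l) * t) * (f t)\<^sup>2 \<partial>lborel)"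
proof -
  interpret M: sigma_finite_measure M by fact
  have cs: "(\<integral>\<^sup>+s. f (t - s) \<partial>M)\<^sup>2 \<le> laplace l M * (\<integral>\<^sup>+s. exp (l * s) * (f (t - s))\<^sup>2 \<partial>M)" for t
  proof -
    have "(\<integral>\<^sup>+s. f (t - s) \<partial>M) = (\<integral>\<^sup>+s. ennreal (exp (- l * s / 2)) * (exp (l * s / 2) * f (t - s)) \<partial>M)"
      by (intro nn_integral_cong) (simp add: mult.assoc[symmetric] ennreal_mult[symmetric] flip: exp_add)
    moreover have "(\<integral>\<^sup>+s. ennreal (exp (- l * s / 2)) * (exp (l * s / 2) * f (t - s)) \<partial>M)\<^sup>2 \<le>
        (\<integral>\<^sup>+s. (ennreal (exp (- l * s / 2)))\<^sup>2 \<partial>M) * (\<integral>\<^sup>+s. (exp (l * s / 2) * f (t - s))\<^sup>2 \<partial>M)"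
      by (rule Cauchy_Schwarz_nn_integral) auto
    moreover have "(ennreal (exp (- l * s / 2)))\<^sup>2 = exp (- l * s)" "(ennreal (exp (l * s / 2)))\<^sup>2 = exp (l * s)" for s
      by (simp_all add: ennreal_power exp_double[symmetric])
    ultimately show ?thesis by (simp add: laplace_def power_mult_distrib)
  qed
  have "(\<integral>\<^sup>+t. exp (- (2 * l) * t) * (\<integral>\<^sup>+s. f (t - s) \<partial>M)\<^sup>2 \<partial>lborel) \<le>
      (\<integral>\<^sup>+t. laplace l M * (exp (- (2 * l) * t) * (\<integral>\<^sup>+s. exp (l * s) * (f (t - s))\<^sup>2 \<partial>M)) \<partial>lborel)"
  proof (rule nn_integral_mono)
    fix t
    have "exp (- (2 * l) * t) * (\<integral>\<^sup>+s. f (t - s) \<partial>M)\<^sup>2 \<le>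
        exp (- (2 * l) * t) * (laplace l M * (\<integral>\<^sup>+s. exp (l * s) * (f (t - s))\<^sup>2 \<partial>M))"
      by (rule mult_left_mono[OF cs]) simp
    then show "exp (- (2 * l) * t) * (\<integral>\<^sup>+s. f (t - s) \<partial>M)\<^sup>2 \<le>
        laplace l M * (exp (- (2 * l) * t) * (\<integral>\<^sup>+s. exp (l * s) * (f (t - s))\<^sup>2 \<partial>M))"
      by (simp only: mult.left_commute)
  qed
  also have "\<dots> = laplace l M * (\<integral>\<^sup>+t. exp (- (2 * l) * t) * (\<integral>\<^sup>+s. exp (l * s) * (f (t - s))\<^sup>2 \<partial>M) \<partial>lborel)"
    by (subst nn_integral_cmult) auto
  also have "\<dots> = laplace l M * ((\<integral>\<^sup>+s. exp (- (2 * l) * s) * ennreal (exp (l * s)) \<partial>M) *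
      (\<integral>\<^sup>+t. exp (- (2 * l) * t) * (f t)\<^sup>2 \<partial>lborel))"
    by (subst nn_integral_conv[OF M sets]) auto
  \<comment> \<open>The factor \<open>exp (l * s)\<close> brings the rate \<open>2 * l\<close> back
    to \<open>l\<close>, so the Laplace transform enters squared at one and the same rate.\<close>
  also have "(\<integral>\<^sup>+s. exp (- (2 * l) * s) * ennreal (exp (l * s)) \<partial>M) = laplace l M"
    unfolding laplace_def by (intro nn_integral_cong) (simp add: ennreal_mult[symmetric] flip: exp_add)
  finally show ?thesis by (simp add: power2_eq_square mult.assoc)
qed

section \<open>Convolution systems with small loop gain\<close>

lemma sum_square_ennreal:
  fixes f :: "'a \<Rightarrow> ennreal"
  assumes "finite A" shows "(\<Sum>x\<in>A. f x)\<^sup>2 \<le> of_nat (card A) * (\<Sum>x\<in>A. (f x)\<^sup>2)"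
  using Cauchy_Schwarz_nn_integral[of f "count_space A" "\<lambda>_. 1"] assms
  by (simp add: nn_integral_count_space_finite mult.commute)

definition abv :: "(nat \<Rightarrow> real \<Rightarrow> complex) \<Rightarrow> nat \<Rightarrow> real \<Rightarrow> ennreal" where
  "abv z j t = ennreal (cmod (z j t))"

definition past :: "real \<Rightarrow> (nat \<Rightarrow> real \<Rightarrow> ennreal) \<Rightarrow> nat \<Rightarrow> real \<Rightarrow> ennreal" where
  "past b u j t = u j t * indicator {..b} t"

lemma measurable_abv: "(\<And>j. z j \<in> borel_measurable borel) \<Longrightarrow> abv z j \<in> borel_measurable borel"
  unfolding abv_def by measurable

lemma measurable_past: "(\<And>j. u j \<in> borel_measurable borel) \<Longrightarrow> past b u j \<in> borel_measurable borel"
  unfolding past_def[abs_def] by (intro borel_measurable_times_ennreal borel_measurable_indicator) auto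

text \<open>
  The kernels are \<open>k\<^sub>i\<^sub>j = (\<Sum>p<4. \<i> ^ p * M i j p)\<close>; \<open>P\<close> is convolution with \<open>\<Sum>p<4. M i j p\<close>, which
  dominates \<open>T\<close>, convolution with \<open>k\<close>. The column conditions make \<open>P\<close> a contraction of the
  exponentially weighted \<open>L\<^sup>1\<close> and \<open>L\<^sup>2\<close> spaces.
\<close>

locale causal_system =
  fixes N :: nat and M :: "nat \<Rightarrow> nat \<Rightarrow> nat \<Rightarrow> real measure" and l :: real and w :: "nat \<Rightarrow> real"
  assumes sets_M [simp, measurable_cong]: "sets (M i j p) = sets borel"
    and sigma_finite_M: "sigma_finite_measure (M i j p)"
    and AE_nonneg: "AE s in M i j p. 0 \<le> s"
    and l: "1 \<le> l" and w: "0 < w i"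
    and col1: "j < N \<Longrightarrow> (\<Sum>i<N. ennreal (w i) * (\<Sum>p<4. laplace l (M i j p))) \<le> ennreal (w j / 2)"
    and col2: "j < N \<Longrightarrow>
      (\<Sum>i<N. ennreal (w i) * (\<Sum>p<4. of_nat (4 * N) * (laplace l (M i j p))\<^sup>2)) \<le> ennreal (w j / 4)"
begin

definition P :: "(nat \<Rightarrow> real \<Rightarrow> ennreal) \<Rightarrow> nat \<Rightarrow> real \<Rightarrow> ennreal" where
  "P z i t = (\<Sum>j<N. \<Sum>p<4. \<integral>\<^sup>+s. z j (t - s) \<partial>M i j p)"

definition T :: "(nat \<Rightarrow> real \<Rightarrow> complex) \<Rightarrow> nat \<Rightarrow> real \<Rightarrow> complex" where
  "T z i t = (\<Sum>j<N. \<Sum>p<4. \<i> ^ p * (LINT s|M i j p. z j (t - s)))"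

definition energy1 :: "(nat \<Rightarrow> real \<Rightarrow> ennreal) \<Rightarrow> ennreal" where
  "energy1 z = (\<Sum>i<N. ennreal (w i) * (\<integral>\<^sup>+t. ennreal (exp (- l * t)) * z i t \<partial>lborel))"

text \<open>This is the square of a weighted L2 norm, which doubles the rate in the exponential;
  contraction of the norm by 1/2 shows up as the factor 1/4.\<close>

definition energy2 :: "(nat \<Rightarrow> real \<Rightarrow> ennreal) \<Rightarrow> ennreal" where
  "energy2 z = (\<Sum>i<N. ennreal (w i) * (\<integral>\<^sup>+t. ennreal (exp (- (2 * l) * t)) * (z i t)\<^sup>2 \<partial>lborel))"

text \<open>Vanishing before some time is built in because the weight \<open>exp (- l * t)\<close>
  is unbounded as t tends to minus infinity. With it every truncation has finite
  \<open>energy1\<close>, whatever the growth at plus infinity.\<close>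

definition locint :: "(nat \<Rightarrow> real \<Rightarrow> ennreal) \<Rightarrow> bool" where
  "locint u \<longleftrightarrow> (\<forall>j. u j \<in> borel_measurable borel) \<and> (\<exists>a. \<forall>j. \<forall>t<a. u j t = 0) \<and>
     (\<forall>b. \<forall>j<N. (\<integral>\<^sup>+t. past b u j t \<partial>lborel) < \<infinity>)"

lemma space_M [simp]: "space (M i j p) = UNIV"
  using sets_eq_imp_space_eq[OF sets_M] by simp

lemma measurable_conv_nn:
  assumes [measurable]: "f \<in> borel_measurable borel"
  shows "(\<lambda>t. \<integral>\<^sup>+s. f (t - s) \<partial>M i j p :: ennreal) \<in> borel_measurable borel"
proof -
  interpret sigma_finite_measure "M i j p" by (rule sigma_finite_M)
  show ?thesis by measurable
qed

lemma measurable_conv: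
  fixes f :: "real \<Rightarrow> complex"
  assumes [measurable]: "f \<in> borel_measurable borel"
  shows "(\<lambda>t. LINT s|M i j p. f (t - s)) \<in> borel_measurable borel"
proof -
  interpret sigma_finite_measure "M i j p" by (rule sigma_finite_M)
  show ?thesis by measurable
qed

lemma measurable_P: "(\<And>j. u j \<in> borel_measurable borel) \<Longrightarrow> P u i \<in> borel_measurable borel"
  unfolding P_def[abs_def] by (intro borel_measurable_sum measurable_conv_nn)

lemma measurable_T: "(\<And>j. z j \<in> borel_measurable borel) \<Longrightarrow> T z i \<in> borel_measurable borel"
  unfolding T_def[abs_def]
  by (intro borel_measurable_sum borel_measurable_times borel_measurable_const measurable_conv)

section \<open>Contraction of the majorant in the weighted energies\<close>

lemma energy1_P:
  assumes m[measurable]: "\<And>j. u j \<in> borel_measurable borel"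
  shows "energy1 (P u) \<le> ennreal (1 / 2) * energy1 u"
proof -
  let ?I = "\<lambda>j. \<integral>\<^sup>+t. ennreal (exp (- l * t)) * u j t \<partial>lborel"
  have "(\<integral>\<^sup>+t. ennreal (exp (- l * t)) * P u i t \<partial>lborel) = (\<Sum>j<N. (\<Sum>p<4. laplace l (M i j p)) * ?I j)" for i
  proof -
    have [measurable]: "(\<lambda>t. \<integral>\<^sup>+s. u j (t - s) \<partial>M i j p) \<in> borel_measurable borel" for j p
      by (intro measurable_conv_nn m)
    show ?thesis
      unfolding P_def sum_distrib_left sum_distrib_right
      by (subst nn_integral_sum, measurable, subst nn_integral_sum, measurable)
        (simp only: nn_integral_conv_laplace[OF sigma_finite_M sets_M m])
  qed
  then have "energy1 (P u) = (\<Sum>j<N. (\<Sum>i<N. ennreal (w i) * (\<Sum>p<4. laplace l (M i j p))) * ?I j)"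
    unfolding energy1_def
    by (simp add: sum_distrib_left sum_distrib_right mult.assoc) (rule sum.swap)
  also have "\<dots> \<le> (\<Sum>j<N. ennreal (w j / 2) * ?I j)" by (intro sum_mono mult_right_mono col1) auto
  also have "\<dots> = ennreal (1 / 2) * energy1 u"
  proof -
    have "ennreal (w j / 2) = ennreal (1 / 2) * ennreal (w j)" for j
      by (subst ennreal_mult[symmetric]) (use w in \<open>auto simp: less_imp_le\<close>)
    then show ?thesis by (simp only: energy1_def sum_distrib_left mult.assoc)
  qed
  finally show ?thesis .
qed

text \<open>The sum \<open>P u\<close> has \<open>4 * N\<close> terms, so squaring it costs a factor
  \<open>4 * N\<close> by Cauchy-Schwarz; this is the factor present in \<open>col2\<close>.
  Exchanging the sums over rows and columns then exposes the weighted column sums.\<close>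

lemma energy2_P:
  assumes m[measurable]: "\<And>j. u j \<in> borel_measurable borel"
  shows "energy2 (P u) \<le> ennreal (1 / 4) * energy2 u"
proof -
  let ?I = "\<lambda>j. \<integral>\<^sup>+t. ennreal (exp (- (2 * l) * t)) * (u j t)\<^sup>2 \<partial>lborel"
  let ?c = "of_nat (4 * N) :: ennreal"
  have "(\<integral>\<^sup>+t. ennreal (exp (- (2 * l) * t)) * (P u i t)\<^sup>2 \<partial>lborel) \<le>
      (\<Sum>j<N. (\<Sum>p<4. ?c * (laplace l (M i j p))\<^sup>2) * ?I j)" for i
  proof -
    have [measurable]: "(\<lambda>t. \<integral>\<^sup>+s. u j (t - s) \<partial>M i j p) \<in> borel_measurable borel" for j p
      by (intro measurable_conv_nn m)
    have "(P u i t)\<^sup>2 \<le> ?c * (\<Sum>j<N. \<Sum>p<4. (\<integral>\<^sup>+s. u j (t - s) \<partial>M i j p)\<^sup>2)" for t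
      using sum_square_ennreal[of "{..<N} \<times> {..<4::nat}" "\<lambda>(j, p). \<integral>\<^sup>+s. u j (t - s) \<partial>M i j p"]
      by (simp add: P_def sum.cartesian_product mult.commute[of N] split_beta)
    then have "(\<integral>\<^sup>+t. ennreal (exp (- (2 * l) * t)) * (P u i t)\<^sup>2 \<partial>lborel) \<le>
        (\<integral>\<^sup>+t. ennreal (exp (- (2 * l) * t)) * (?c * (\<Sum>j<N. \<Sum>p<4. (\<integral>\<^sup>+s. u j (t - s) \<partial>M i j p)\<^sup>2)) \<partial>lborel)"
      by (intro nn_integral_mono mult_left_mono) auto
    also have "\<dots> = (\<integral>\<^sup>+t. (\<Sum>j<N. \<Sum>p<4. ?c * (exp (- (2 * l) * t) * (\<integral>\<^sup>+s. u j (t - s) \<partial>M i j p)\<^sup>2)) \<partial>lborel)"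
      by (simp add: sum_distrib_left mult_ac)
    also have "\<dots> = (\<Sum>j<N. \<Sum>p<4. ?c * (\<integral>\<^sup>+t. ennreal (exp (- (2 * l) * t)) * (\<integral>\<^sup>+s. u j (t - s) \<partial>M i j p)\<^sup>2 \<partial>lborel))"
      by (subst nn_integral_sum, measurable, subst nn_integral_sum, measurable, subst nn_integral_cmult, measurable)
    also have "\<dots> \<le> (\<Sum>j<N. \<Sum>p<4. ?c * ((laplace l (M i j p))\<^sup>2 * ?I j))"
      by (intro sum_mono mult_left_mono nn_integral_conv_square sigma_finite_M sets_M m) auto
    finally show ?thesis by (simp only: sum_distrib_right mult.assoc)
  qed
  then have "energy2 (P u) \<le> (\<Sum>i<N. ennreal (w i) * (\<Sum>j<N. (\<Sum>p<4. ?c * (laplace l (M i j p))\<^sup>2) * ?I j))"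
    unfolding energy2_def by (intro sum_mono mult_left_mono) auto
  also have "\<dots> = (\<Sum>i<N. \<Sum>j<N. ennreal (w i) * (\<Sum>p<4. ?c * (laplace l (M i j p))\<^sup>2) * ?I j)"
    by (simp only: sum_distrib_left[of _ _ "{..<N}"] mult.assoc)
  also have "\<dots> = (\<Sum>j<N. (\<Sum>i<N. ennreal (w i) * (\<Sum>p<4. ?c * (laplace l (M i j p))\<^sup>2)) * ?I j)"
    by (subst sum.swap) (simp only: sum_distrib_right)
  also have "\<dots> \<le> (\<Sum>j<N. ennreal (w j / 4) * ?I j)" by (intro sum_mono mult_right_mono col2) auto
  also have "\<dots> = ennreal (1 / 4) * energy2 u"
  proof -
    have "ennreal (w j / 4) = ennreal (1 / 4) * ennreal (w j)" for j
      by (subst ennreal_mult[symmetric]) (use w in \<open>auto simp: less_imp_le\<close>)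
    then show ?thesis by (simp only: energy2_def sum_distrib_left mult.assoc)
  qed
  finally show ?thesis .
qed

section \<open>Causality, domination and almost everywhere linearity\<close>

lemma P_cong_past:
  assumes "\<And>j s. j < N \<Longrightarrow> s \<le> t \<Longrightarrow> u j s = v j s" shows "P u i t = P v i t"
  unfolding P_def using assms
  by (intro sum.cong refl nn_integral_cong_AE eventually_mono[OF AE_nonneg]) auto

lemma T_cong_past:
  assumes m: "\<And>j. u j \<in> borel_measurable borel" "\<And>j. v j \<in> borel_measurable borel"
    and "\<And>j s. j < N \<Longrightarrow> s \<le> t \<Longrightarrow> u j s = v j s"
  shows "T u i t = T v i t"
proof -
  note [measurable] = m
  have "(LINT s|M i j p. u j (t - s)) = (LINT s|M i j p. v j (t - s))" if "j < N" for j p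
    by (intro integral_cong_AE, measurable)
      (use assms(3) that in \<open>auto intro!: eventually_mono[OF AE_nonneg]\<close>)
  then show ?thesis unfolding T_def by (intro sum.cong refl) simp
qed

lemma P_mono: "(\<And>j s. j < N \<Longrightarrow> u j s \<le> v j s) \<Longrightarrow> P u i t \<le> P v i t"
  unfolding P_def by (intro sum_mono nn_integral_mono) auto

lemma P_zero_past: "(\<And>j s. s \<le> t \<Longrightarrow> u j s = 0) \<Longrightarrow> P u i t = 0"
  using P_cong_past[of t u "\<lambda>_ _. 0"] by (simp add: P_def)

text \<open>A divergent Bochner integral is 0 by default, so the bound holds at every point and not
  merely where the convolutions converge.\<close>

lemma T_le_P: "ennreal (cmod (T z i t)) \<le> P (abv z) i t"
proof -
  have "ennreal (cmod (LINT s|M i j p. z j (t - s))) \<le> (\<integral>\<^sup>+s. abv z j (t - s) \<partial>M i j p)" for j p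
    unfolding abv_def
    by (cases "integrable (M i j p) (\<lambda>s. z j (t - s))")
      (auto intro: integral_norm_bound_ennreal simp: not_integrable_integral_eq)
  moreover have "cmod (T z i t) \<le> (\<Sum>j<N. \<Sum>p<4. cmod (LINT s|M i j p. z j (t - s)))"
    unfolding T_def
    by (intro sum_norm_le order_trans[OF sum_norm_le]) (auto simp: norm_mult norm_power)
  then have "ennreal (cmod (T z i t)) \<le> (\<Sum>j<N. \<Sum>p<4. ennreal (cmod (LINT s|M i j p. z j (t - s))))"
    by (simp add: sum_ennreal sum_nonneg ennreal_leI)
  ultimately show ?thesis unfolding P_def by (meson order_trans sum_mono)
qed

lemma integrable_if_P_finite:
  assumes [measurable]: "\<And>j. z j \<in> borel_measurable borel"
    and fin: "P (abv z) i t < \<infinity>" and "j < N" "p < 4"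
  shows "integrable (M i j p) (\<lambda>s. z j (t - s))"
proof (rule integrableI_bounded)
  have "(\<integral>\<^sup>+s. abv z j (t - s) \<partial>M i j p) \<le> (\<Sum>p<4. \<integral>\<^sup>+s. abv z j (t - s) \<partial>M i j p)"
    by (rule member_le_sum) (use assms in auto)
  also have "\<dots> \<le> P (abv z) i t"
    unfolding P_def by (rule member_le_sum) (use assms in auto)
  finally show "(\<integral>\<^sup>+s. norm (z j (t - s)) \<partial>M i j p) < \<infinity>" using fin by (simp add: abv_def)
qed measurable

text \<open>Finiteness of both majorants at the point \<open>t\<close> makes every integral in
  \<open>T\<close> converge there; with the default value of divergent integrals additivity could
  fail.\<close>

lemma T_add:
  assumes "\<And>j. u j \<in> borel_measurable borel" "\<And>j. v j \<in> borel_measurable borel"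
    and "P (abv u) i t < \<infinity>" "P (abv v) i t < \<infinity>"
  shows "T (\<lambda>j s. u j s + v j s) i t = T u i t + T v i t"
  unfolding T_def sum.distrib[symmetric] distrib_left[symmetric]
  by (intro sum.cong refl arg_cong2[of _ _ _ _ "(*)"] Bochner_Integration.integral_add
      integrable_if_P_finite assms) auto

text \<open>For a kernel with atoms, a null set can matter at a single \<open>t\<close>. But the
  convolution of its indicator with the kernel has zero Lebesgue integral by Tonelli, so for almost
  every \<open>t\<close> the two integrands agree almost everywhere with respect to the
  kernel.\<close>

lemma T_cong_AE:
  assumes m: "\<And>j. u j \<in> borel_measurable borel" "\<And>j. v j \<in> borel_measurable borel"
    and eq: "AE t in lborel. \<forall>j<N. u j t = v j t"
  shows "AE t in lborel. \<forall>i. T u i t = T v i t"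
proof -
  note [measurable] = m
  have "AE t in lborel. AE s in M i j p. u j (t - s) = v j (t - s)" if j: "j < N" for i j p
  proof -
    interpret sigma_finite_measure "M i j p" by (rule sigma_finite_M)
    define f :: "real \<Rightarrow> ennreal" where "f = indicator {t. u j t \<noteq> v j t}"
    have [measurable]: "f \<in> borel_measurable borel" unfolding f_def by measurable
    have "(\<integral>\<^sup>+t. ennreal (exp (- 0 * t)) * f t \<partial>lborel) = 0"
      by (subst nn_integral_0_iff_AE, measurable) (use eq j in \<open>auto simp: f_def elim!: eventually_mono\<close>)
    \<comment> \<open>Rate 0 turns the weighted identity into plain Tonelli. The value
      \<open>laplace 0\<close> may be infinite, but its product with 0 is 0 in
      \<open>ennreal\<close>.\<close>
    then have "(\<integral>\<^sup>+t. ennreal (exp (- 0 * t)) * (\<integral>\<^sup>+s. f (t - s) \<partial>M i j p) \<partial>lborel) = 0"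
      by (subst nn_integral_conv_laplace) (auto simp: sigma_finite_M)
    then have "AE t in lborel. (\<integral>\<^sup>+s. f (t - s) \<partial>M i j p) = 0"
      by (subst (asm) nn_integral_0_iff_AE) (auto intro!: measurable_conv_nn)
    then show ?thesis
      by eventually_elim (subst (asm) nn_integral_0_iff_AE, measurable, auto simp: f_def indicator_eq_0_iff)
  qed
  then have "AE t in lborel. \<forall>i. \<forall>j\<in>{..<N}. \<forall>p. AE s in M i j p. u j (t - s) = v j (t - s)"
    by (intro AE_all_countable[THEN iffD2] allI AE_finite_allI) auto
  then show ?thesis
  proof eventually_elim
    case (elim t)
    then have "(LINT s|M i j p. u j (t - s)) = (LINT s|M i j p. v j (t - s))" if "j < N" for i j p
      using that by (intro integral_cong_AE) auto
    then show ?case by (simp add: T_def)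
  qed
qed

lemma energy1_component:
  "i < N \<Longrightarrow> ennreal (w i) * (\<integral>\<^sup>+t. ennreal (exp (- l * t)) * u i t \<partial>lborel) \<le> energy1 u"
  unfolding energy1_def
  by (rule member_le_sum[of i "{..<N}" "\<lambda>i. ennreal (w i) * (\<integral>\<^sup>+t. ennreal (exp (- l * t)) * u i t \<partial>lborel)"])
    auto

lemma energy2_component:
  "i < N \<Longrightarrow> ennreal (w i) * (\<integral>\<^sup>+t. ennreal (exp (- (2 * l) * t)) * (u i t)\<^sup>2 \<partial>lborel) \<le> energy2 u"
  unfolding energy2_def
  by (rule member_le_sum[of i "{..<N}"
      "\<lambda>i. ennreal (w i) * (\<integral>\<^sup>+t. ennreal (exp (- (2 * l) * t)) * (u i t)\<^sup>2 \<partial>lborel)"]) auto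

lemma ennreal_w: "ennreal (w i) \<noteq> 0"
  using w[of i] by (simp add: ennreal_eq_0_iff)

lemma energy1_mono: "(\<And>j t. u j t \<le> v j t) \<Longrightarrow> energy1 u \<le> energy1 v"
  unfolding energy1_def by (intro sum_mono mult_left_mono nn_integral_mono) auto

lemma energy1_mono_AE:
  "AE t in lborel. \<forall>j<N. u j t \<le> v j t \<Longrightarrow> energy1 u \<le> energy1 v"
  unfolding energy1_def
  by (intro sum_mono mult_left_mono nn_integral_mono_AE) (auto elim!: eventually_mono intro!: mult_left_mono)

lemma energy2_mono: "(\<And>j t. u j t \<le> v j t) \<Longrightarrow> energy2 u \<le> energy2 v"
  unfolding energy2_def by (intro sum_mono mult_left_mono nn_integral_mono power_mono) auto

section \<open>Local integrability and uniqueness\<close>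

lemma locint_energy1_past:
  assumes "locint u" shows "energy1 (past b u) < \<infinity>"
proof -
  obtain a where a: "\<And>j t. t < a \<Longrightarrow> u j t = 0" using assms by (auto simp: locint_def)
  have m: "past b u j \<in> borel_measurable borel" for j using assms by (intro measurable_past) (auto simp: locint_def)
  have "ennreal (w j) * (\<integral>\<^sup>+t. ennreal (exp (- l * t)) * past b u j t \<partial>lborel) < \<infinity>" if j: "j < N" for j
  proof -
    have "(\<integral>\<^sup>+t. ennreal (exp (- l * t)) * past b u j t \<partial>lborel) \<le>
        (\<integral>\<^sup>+t. ennreal (exp (- l * a)) * past b u j t \<partial>lborel)"
    proof (rule nn_integral_mono)
      fix t show "ennreal (exp (- l * t)) * past b u j t \<le> ennreal (exp (- l * a)) * past b u j t"
      proof (cases "t < a")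
        case True then show ?thesis by (simp add: past_def a)
      next
        case False then show ?thesis using l by (intro mult_right_mono ennreal_leI) auto
      qed
    qed
    also have "\<dots> = ennreal (exp (- l * a)) * (\<integral>\<^sup>+t. past b u j t \<partial>lborel)"
      by (intro nn_integral_cmult) (simp add: m)
    also have "\<dots> < \<infinity>" using assms j by (simp add: locint_def ennreal_mult_less_top)
    finally show ?thesis by (simp add: ennreal_mult_less_top)
  qed
  then show ?thesis unfolding energy1_def by (simp add: ennreal_sum_less_top)
qed

text \<open>The values of \<open>P u\<close> up to time \<open>b\<close> involve \<open>u\<close> up
  to time \<open>b\<close> only, so \<open>past b (P u)\<close> is at most
  \<open>P (past b u)\<close> and the contraction factor survives truncation at every
  \<open>b\<close>.\<close>

lemma energy1_past_P:
  assumes "\<And>j. u j \<in> borel_measurable borel"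
  shows "energy1 (past b (P u)) \<le> ennreal (1 / 2) * energy1 (past b u)"
proof -
  have "past b (P u) j t \<le> P (past b u) j t" for j t
  proof (cases "t \<le> b")
    case True
    then have "P (past b u) j t = P u j t" by (intro P_cong_past) (simp add: past_def)
    then show ?thesis by (simp add: past_def indicator_def)
  qed (simp add: past_def)
  then have "energy1 (past b (P u)) \<le> energy1 (P (past b u))" by (rule energy1_mono)
  also have "\<dots> \<le> ennreal (1 / 2) * energy1 (past b u)"
    using assms by (intro energy1_P measurable_past)
  finally show ?thesis .
qed

text \<open>Up to time \<open>b\<close> the weight is at least \<open>exp (- l * b)\<close>, so
  finiteness of the truncated energy of \<open>P u\<close> gives back plain integrability.\<close>

lemma locint_P:
  assumes u: "locint u" shows "locint (P u)"
  unfolding locint_def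
proof (intro conjI allI impI)
  have mu: "u j \<in> borel_measurable borel" for j using u by (simp add: locint_def)
  show m: "P u j \<in> borel_measurable borel" for j by (rule measurable_P) (rule mu)
  obtain a where a: "\<And>j t. t < a \<Longrightarrow> u j t = 0" using u by (auto simp: locint_def)
  show "\<exists>a. \<forall>j. \<forall>t<a. P u j t = 0" using a by (intro exI[of _ a]) (auto intro: P_zero_past)
  fix b j assume j: "j < N"
  let ?I = "\<integral>\<^sup>+t. ennreal (exp (- l * t)) * past b (P u) j t \<partial>lborel"
  have "ennreal (w j) * ?I \<le> energy1 (past b (P u))"
    by (rule energy1_component[OF j])
  also have "\<dots> \<le> ennreal (1 / 2) * energy1 (past b u)" by (rule energy1_past_P[OF mu])
  also have "\<dots> < \<infinity>" using locint_energy1_past[OF u]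
    by (metis ennreal_mult_less_top ennreal_less_top infinity_ennreal_def)
  finally have fin: "?I < \<infinity>" using ennreal_w[of j] by (auto simp: ennreal_mult_less_top)
  have "(\<integral>\<^sup>+t. past b (P u) j t \<partial>lborel) \<le>
      (\<integral>\<^sup>+t. ennreal (exp (l * b)) * (ennreal (exp (- l * t)) * past b (P u) j t) \<partial>lborel)"
  proof (rule nn_integral_mono)
    fix t show "past b (P u) j t \<le> ennreal (exp (l * b)) * (ennreal (exp (- l * t)) * past b (P u) j t)"
    proof (cases "t \<le> b")
      case True
      then have "0 \<le> l * (b - t)" using l by simp
      then have "ennreal 1 \<le> ennreal (exp (l * b) * exp (- l * t))"
        by (intro ennreal_leI) (simp add: algebra_simps flip: exp_add)
      then have "1 * past b (P u) j t \<le> (ennreal (exp (l * b)) * ennreal (exp (- l * t))) * past b (P u) j t"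
        by (intro mult_right_mono) (simp_all add: ennreal_mult)
      then show ?thesis by (simp add: mult.assoc)
    qed (simp add: past_def)
  qed
  also have "\<dots> = ennreal (exp (l * b)) * ?I"
    using measurable_past[of "P u", OF m] by (intro nn_integral_cmult) simp
  also have "\<dots> < \<infinity>" using fin by (simp add: ennreal_mult_less_top)
  finally show "(\<integral>\<^sup>+t. past b (P u) j t \<partial>lborel) < \<infinity>" .
qed

lemma AE_from_past:
  assumes "\<And>b. AE t in lborel. t \<le> b \<longrightarrow> Q t"
  shows "AE t in (lborel :: real measure). Q t"
proof -
  have "AE t in lborel. \<forall>b::nat. t \<le> real b \<longrightarrow> Q t" using assms by (intro AE_all_countable[THEN iffD2] allI)
  then show ?thesis by eventually_elim (meson real_arch_simple)
qed

text \<open>Applied to a majorant \<open>P (abv z)\<close>, this makes the convolutions in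
  \<open>T z\<close> absolutely convergent almost everywhere.\<close>

lemma locint_AE_finite:
  assumes u: "locint u" shows "AE t in lborel. \<forall>i<N. u i t < \<infinity>"
proof -
  have "AE t in lborel. u i t < \<infinity>" if "i < N" for i
  proof (rule AE_from_past)
    fix b
    have "(\<integral>\<^sup>+t. past b u i t \<partial>lborel) \<noteq> \<infinity>" using u that by (auto simp: locint_def less_top)
    then have "AE t in lborel. past b u i t \<noteq> \<infinity>"
      using u by (intro nn_integral_PInf_AE) (auto simp: locint_def intro!: measurable_past)
    then show "AE t in lborel. t \<le> b \<longrightarrow> u i t < \<infinity>"
      by eventually_elim (auto simp: past_def less_top)
  qed
  then have "AE t in lborel. \<forall>i\<in>{..<N}. u i t < \<infinity>" by (intro AE_finite_allI) auto
  then show ?thesis by eventually_elim simp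
qed

text \<open>The truncated energy is finite and at most half of itself, hence 0, and \<open>b\<close>
  is arbitrary. An inequality is assumed because this is what the absolute value of the difference
  of two solutions satisfies.\<close>

lemma subfixed_point_zero:
  assumes u: "locint u" and le: "AE t in lborel. \<forall>i<N. u i t \<le> P u i t"
  shows "AE t in lborel. \<forall>i<N. u i t = 0"
proof (rule AE_from_past)
  fix b
  have mu: "u j \<in> borel_measurable borel" for j using u by (simp add: locint_def)
  have m: "past b u j \<in> borel_measurable borel" for j by (rule measurable_past) (rule mu)
  let ?E = "energy1 (past b u)"
  have "?E \<le> energy1 (past b (P u))"
    by (rule energy1_mono_AE) (use le in \<open>auto elim!: eventually_mono simp: past_def intro!: mult_right_mono\<close>)
  also have "\<dots> \<le> ennreal (1 / 2) * ?E" by (rule energy1_past_P[OF mu])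
  finally have half: "?E \<le> ennreal (1 / 2) * ?E" .
  have "?E < \<infinity>" by (rule locint_energy1_past[OF u])
  then obtain e where e: "?E = ennreal e" "0 \<le> e" by (cases ?E) auto
  from half have "e \<le> 1 / 2 * e" unfolding e(1) using e(2) by (simp only: ennreal_mult[symmetric]) (simp add: ennreal_le_iff)
  then have "?E = 0" using e by simp
  then have "(\<integral>\<^sup>+t. ennreal (exp (- l * t)) * past b u i t \<partial>lborel) = 0" if "i < N" for i
    using energy1_component[OF that, of "past b u"] ennreal_w[of i] by simp
  then have "AE t in lborel. past b u i t = 0" if "i < N" for i
    using m that by (subst (asm) nn_integral_0_iff_AE) auto
  then have "AE t in lborel. \<forall>i\<in>{..<N}. past b u i t = 0" by (intro AE_finite_allI) auto
  then show "AE t in lborel. t \<le> b \<longrightarrow> (\<forall>i<N. u i t = 0)"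
    by eventually_elim (auto simp: past_def)
qed

lemma locint_mono:
  assumes v: "locint v" and m: "\<And>j. u j \<in> borel_measurable borel" and le: "\<And>j t. u j t \<le> v j t"
  shows "locint u"
  unfolding locint_def
proof (intro conjI allI impI m)
  obtain a where "\<And>j t. t < a \<Longrightarrow> v j t = 0" using v by (auto simp: locint_def)
  then show "\<exists>a. \<forall>j. \<forall>t<a. u j t = 0" using le by (metis le_zero_eq)
  fix b j assume "j < N"
  have "(\<integral>\<^sup>+t. past b u j t \<partial>lborel) \<le> (\<integral>\<^sup>+t. past b v j t \<partial>lborel)"
    using le by (intro nn_integral_mono) (auto simp: past_def intro!: mult_right_mono)
  also have "\<dots> < \<infinity>" using v \<open>j < N\<close> by (simp add: locint_def)
  finally show "(\<integral>\<^sup>+t. past b u j t \<partial>lborel) < \<infinity>" .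
qed

lemma locint_add:
  assumes "locint u" "locint v" shows "locint (\<lambda>j t. u j t + v j t)"
  unfolding locint_def
proof (intro conjI allI impI)
  have m: "u j \<in> borel_measurable borel" "v j \<in> borel_measurable borel" for j
    using assms by (auto simp: locint_def)
  then show "(\<lambda>t. u j t + v j t) \<in> borel_measurable borel" for j by simp
  obtain a a' where "\<And>j t. t < a \<Longrightarrow> u j t = 0" "\<And>j t. t < a' \<Longrightarrow> v j t = 0"
    using assms by (auto simp: locint_def)
  then show "\<exists>a. \<forall>j. \<forall>t<a. u j t + v j t = 0" by (intro exI[of _ "min a a'"]) auto
  fix b j assume j: "j < N"
  have "(\<integral>\<^sup>+t. past b (\<lambda>j t. u j t + v j t) j t \<partial>lborel) = (\<integral>\<^sup>+t. past b u j t + past b v j t \<partial>lborel)"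
    by (simp add: past_def distrib_right)
  also have "\<dots> = (\<integral>\<^sup>+t. past b u j t \<partial>lborel) + (\<integral>\<^sup>+t. past b v j t \<partial>lborel)"
    using measurable_past[of u, OF m(1)] measurable_past[of v, OF m(2)] by (intro nn_integral_add) simp_all
  also have "\<dots> < \<infinity>" using assms j by (simp add: locint_def)
  finally show "(\<integral>\<^sup>+t. past b (\<lambda>j t. u j t + v j t) j t \<partial>lborel) < \<infinity>" .
qed

lemma locint_abv_diff:
  assumes "locint (abv z)" "locint (abv z')"
    and m: "\<And>j. z j \<in> borel_measurable borel" "\<And>j. z' j \<in> borel_measurable borel"
  shows "locint (abv (\<lambda>j t. z j t - z' j t))"
proof (rule locint_mono[OF locint_add[OF assms(1,2)] measurable_abv])
  show "(\<lambda>t. z j t - z' j t) \<in> borel_measurable borel" for j by (intro borel_measurable_diff m)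
qed (simp add: abv_def norm_triangle_ineq4 ennreal_leI flip: ennreal_plus)

lemma solution_unique:
  assumes li: "locint (abv z)" "locint (abv z')"
    and m: "\<And>j. z j \<in> borel_measurable borel" "\<And>j. z' j \<in> borel_measurable borel"
    and eq: "AE t in lborel. \<forall>i<N. z i t = g i t + T z i t"
      "AE t in lborel. \<forall>i<N. z' i t = g i t + T z' i t"
  shows "AE t in lborel. \<forall>i<N. z i t = z' i t"
proof -
  define d where "d = (\<lambda>j t. z j t - z' j t)"
  have md: "d j \<in> borel_measurable borel" for j unfolding d_def by (intro borel_measurable_diff m)
  have ld: "locint (abv d)" unfolding d_def by (rule locint_abv_diff[OF li m])
  have "AE t in lborel. \<forall>i<N. abv d i t \<le> P (abv d) i t"
    using locint_AE_finite[OF locint_P[OF ld]] locint_AE_finite[OF locint_P[OF li(2)]] eq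
  proof eventually_elim
    case (elim t)
    show ?case
    proof (intro allI impI)
      fix i assume i: "i < N"
      \<comment> \<open>Linearity is used in the form z = d + z', at points where the majorants of
        both summands are finite.\<close>
      have "T (\<lambda>j s. d j s + z' j s) i t = T d i t + T z' i t"
        using elim i by (intro T_add md m) auto
      then have "d i t = T d i t" using elim i by (simp add: d_def)
      then show "abv d i t \<le> P (abv d) i t" using T_le_P[of d i t] by (simp add: abv_def)
    qed
  qed
  from subfixed_point_zero[OF ld this] show ?thesis
    by eventually_elim (auto simp: d_def abv_def)
qed

section \<open>The Neumann series in the weighted L2 space\<close>

lemma energy2_tendsto:
  assumes m: "\<And>k j. U k j \<in> borel_measurable borel" and inc: "\<And>j t. incseq (\<lambda>k. U k j t)"
    and lim: "\<And>j t. (\<lambda>k. U k j t) \<longlonglongrightarrow> V j t" and le: "\<And>k. energy2 (U k) \<le> c"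
  shows "energy2 V \<le> c"
proof (rule LIMSEQ_le_const2)
  show "(\<lambda>k. energy2 (U k)) \<longlonglongrightarrow> energy2 V"
    unfolding energy2_def
  proof (intro tendsto_sum ennreal_tendsto_cmult)
    fix i
    show "(\<lambda>k. \<integral>\<^sup>+t. ennreal (exp (- (2 * l) * t)) * (U k i t)\<^sup>2 \<partial>lborel) \<longlonglongrightarrow>
        (\<integral>\<^sup>+t. ennreal (exp (- (2 * l) * t)) * (V i t)\<^sup>2 \<partial>lborel)"
    proof (rule nn_integral_LIMSEQ)
      show "incseq (\<lambda>k t. ennreal (exp (- (2 * l) * t)) * (U k i t)\<^sup>2)"
        using inc by (auto simp: incseq_def le_fun_def intro!: mult_left_mono power_mono)
      show "(\<lambda>k. ennreal (exp (- (2 * l) * t)) * (U k i t)\<^sup>2) \<longlonglongrightarrow>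
          ennreal (exp (- (2 * l) * t)) * (V i t)\<^sup>2" for t
        unfolding power2_eq_square by (intro ennreal_tendsto_cmult tendsto_mult_ennreal lim) auto
      show "(\<lambda>t. ennreal (exp (- (2 * l) * t)) * (U k i t)\<^sup>2) \<in> borel_measurable lborel" for k
        using m[of k i] by measurable
    qed
  qed auto
qed (use le in auto)

text \<open>The crude bound by twice the sum of the squares replaces Minkowski, so that only squares
  occur; the factor 1/4 of \<open>energy2_P\<close> absorbs the loss.\<close>

lemma energy2_add:
  assumes m: "\<And>j. u j \<in> borel_measurable borel" "\<And>j. v j \<in> borel_measurable borel"
  shows "energy2 (\<lambda>j t. u j t + v j t) \<le> 2 * energy2 u + 2 * energy2 v"
proof -
  note [measurable] = m
  have sq: "(a + b)\<^sup>2 \<le> 2 * a\<^sup>2 + 2 * b\<^sup>2" for a b :: ennreal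
    using sum_square_ennreal[of "UNIV :: bool set" "\<lambda>x. if x then a else b"]
    by (simp add: UNIV_bool distrib_left add.commute)
  have "(\<integral>\<^sup>+t. ennreal (exp (- (2 * l) * t)) * (u i t + v i t)\<^sup>2 \<partial>lborel) \<le>
     2 * (\<integral>\<^sup>+t. ennreal (exp (- (2 * l) * t)) * (u i t)\<^sup>2 \<partial>lborel) +
     2 * (\<integral>\<^sup>+t. ennreal (exp (- (2 * l) * t)) * (v i t)\<^sup>2 \<partial>lborel)" for i
  proof -
    have "(\<integral>\<^sup>+t. ennreal (exp (- (2 * l) * t)) * (u i t + v i t)\<^sup>2 \<partial>lborel) \<le>
        (\<integral>\<^sup>+t. 2 * (ennreal (exp (- (2 * l) * t)) * (u i t)\<^sup>2) + 2 * (ennreal (exp (- (2 * l) * t)) * (v i t)\<^sup>2) \<partial>lborel)"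
    proof (rule nn_integral_mono)
      fix t
      have "ennreal (exp (- (2 * l) * t)) * (u i t + v i t)\<^sup>2 \<le>
          ennreal (exp (- (2 * l) * t)) * (2 * (u i t)\<^sup>2 + 2 * (v i t)\<^sup>2)"
        by (rule mult_left_mono[OF sq]) simp
      then show "ennreal (exp (- (2 * l) * t)) * (u i t + v i t)\<^sup>2 \<le>
          2 * (ennreal (exp (- (2 * l) * t)) * (u i t)\<^sup>2) + 2 * (ennreal (exp (- (2 * l) * t)) * (v i t)\<^sup>2)"
        by (simp only: distrib_left mult.left_commute[of _ 2])
    qed
    also have "\<dots> = 2 * (\<integral>\<^sup>+t. ennreal (exp (- (2 * l) * t)) * (u i t)\<^sup>2 \<partial>lborel) +
        2 * (\<integral>\<^sup>+t. ennreal (exp (- (2 * l) * t)) * (v i t)\<^sup>2 \<partial>lborel)"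
      by (subst nn_integral_add, measurable, subst nn_integral_cmult, measurable, subst nn_integral_cmult, measurable)
    finally show ?thesis .
  qed
  then have "energy2 (\<lambda>j t. u j t + v j t) \<le> (\<Sum>i<N. ennreal (w i) *
     (2 * (\<integral>\<^sup>+t. ennreal (exp (- (2 * l) * t)) * (u i t)\<^sup>2 \<partial>lborel) +
     2 * (\<integral>\<^sup>+t. ennreal (exp (- (2 * l) * t)) * (v i t)\<^sup>2 \<partial>lborel)))"
    unfolding energy2_def by (intro sum_mono mult_left_mono) auto
  also have "\<dots> = 2 * energy2 u + 2 * energy2 v"
    unfolding energy2_def sum_distrib_left sum.distrib[symmetric]
    by (intro sum.cong refl) (simp only: distrib_left mult.left_commute[of _ 2])
  finally show ?thesis .
qed

primrec Pn :: "(nat \<Rightarrow> real \<Rightarrow> ennreal) \<Rightarrow> nat \<Rightarrow> nat \<Rightarrow> real \<Rightarrow> ennreal" where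
  "Pn u 0 = u"
| "Pn u (Suc k) = P (Pn u k)"

primrec Tn :: "(nat \<Rightarrow> real \<Rightarrow> complex) \<Rightarrow> nat \<Rightarrow> nat \<Rightarrow> real \<Rightarrow> complex" where
  "Tn g 0 = g"
| "Tn g (Suc k) = T (Tn g k)"

lemma measurable_Pn: "(\<And>j. u j \<in> borel_measurable borel) \<Longrightarrow> Pn u k j \<in> borel_measurable borel"
  by (induction k arbitrary: j) (auto intro: measurable_P)

lemma measurable_Tn: "(\<And>j. g j \<in> borel_measurable borel) \<Longrightarrow> Tn g k j \<in> borel_measurable borel"
  by (induction k arbitrary: j) (auto intro: measurable_T)

lemma Tn_le_Pn: "abv (Tn g k) j t \<le> Pn (abv g) k j t"
proof (induction k arbitrary: j t)
  case (Suc k)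
  have "abv (Tn g (Suc k)) j t \<le> P (abv (Tn g k)) j t" using T_le_P by (simp add: abv_def)
  also have "\<dots> \<le> P (Pn (abv g) k) j t" by (rule P_mono) (rule Suc)
  finally show ?case by simp
qed simp

lemma Tn_zero_past:
  assumes m: "\<And>j. g j \<in> borel_measurable borel" and z: "\<And>j t. t \<le> 0 \<Longrightarrow> g j t = 0"
  shows "t \<le> 0 \<Longrightarrow> Tn g k j t = 0"
proof (induction k arbitrary: j t)
  case (Suc k)
  have "T (Tn g k) j t = T (\<lambda>_ _. 0) j t"
    by (rule T_cong_past) (use measurable_Tn[OF m] Suc in auto)
  then show ?case by (simp add: T_def)
qed (use z in simp)

lemma P_sum:
  assumes "\<And>k j. U k j \<in> borel_measurable borel"
  shows "P (\<lambda>j t. \<Sum>k<n. U k j t) i t = (\<Sum>k<n. P (U k) i t)"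
proof -
  have [measurable]: "(\<lambda>s. U k j (t - s)) \<in> borel_measurable borel" for k j
    using assms[of k j] by measurable
  have "P (\<lambda>j t. \<Sum>k<n. U k j t) i t = (\<Sum>j<N. \<Sum>p<4. \<Sum>k<n. \<integral>\<^sup>+s. U k j (t - s) \<partial>M i j p)"
    unfolding P_def by (intro sum.cong refl nn_integral_sum) measurable
  also have "\<dots> = (\<Sum>j<N. \<Sum>k<n. \<Sum>p<4. \<integral>\<^sup>+s. U k j (t - s) \<partial>M i j p)"
    by (intro sum.cong refl sum.swap)
  also have "\<dots> = (\<Sum>k<n. P (U k) i t)" unfolding P_def by (rule sum.swap)
  finally show ?thesis .
qed

lemma P_suminf:
  assumes "\<And>k j. U k j \<in> borel_measurable borel"
  shows "P (\<lambda>j t. \<Sum>k. U k j t) i t = (\<Sum>k. P (U k) i t)"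
proof -
  have [measurable]: "(\<lambda>s. U k j (t - s)) \<in> borel_measurable borel" for k j
    using assms[of k j] by measurable
  have "P (\<lambda>j t. \<Sum>k. U k j t) i t = (\<Sum>j<N. \<Sum>p<4. \<Sum>k. \<integral>\<^sup>+s. U k j (t - s) \<partial>M i j p)"
    unfolding P_def by (intro sum.cong refl nn_integral_suminf) measurable
  also have "\<dots> = (\<Sum>k. P (U k) i t)" unfolding P_def by (simp add: suminf_sum)
  finally show ?thesis .
qed

text \<open>The partial sums satisfy S(n+1) = u + P S(n), so their energies obey E(n+1) \<le> 2 E(u)
  + E(n) / 2, a recursion whose fixed point is 4 E(u).\<close>

lemma energy2_Pn_sum:
  assumes m: "\<And>j. u j \<in> borel_measurable borel"
  shows "energy2 (\<lambda>j t. \<Sum>k<n. Pn u k j t) \<le> 4 * energy2 u"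
proof (induction n)
  case 0 show ?case by (simp add: energy2_def)
next
  case (Suc n)
  let ?S = "\<lambda>j t. \<Sum>k<n. Pn u k j t"
  have mP: "Pn u k j \<in> borel_measurable borel" for k j by (rule measurable_Pn[OF m])
  then have mS: "?S j \<in> borel_measurable borel" for j by (intro borel_measurable_sum)
  have "(\<lambda>j t. \<Sum>k<Suc n. Pn u k j t) = (\<lambda>j t. u j t + P ?S j t)"
    by (simp only: sum.lessThan_Suc_shift P_sum[of "Pn u", OF mP] Pn.simps)
  then have "energy2 (\<lambda>j t. \<Sum>k<Suc n. Pn u k j t) \<le> 2 * energy2 u + 2 * energy2 (P ?S)"
    using energy2_add[of u "P ?S", OF m measurable_P, OF mS] by simp
  also have "\<dots> \<le> 2 * energy2 u + 2 * (ennreal (1 / 4) * energy2 ?S)"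
    by (intro add_left_mono mult_left_mono energy2_P mS) auto
  also have "\<dots> \<le> 2 * energy2 u + 2 * (ennreal (1 / 4) * (4 * energy2 u))"
    by (intro add_left_mono mult_left_mono Suc) auto
  also have "2 * (ennreal (1 / 4) * (4 * energy2 u)) = (ennreal 2 * ennreal (1 / 4) * ennreal 4) * energy2 u"
    by (simp only: mult.assoc ennreal_numeral)
  also have "ennreal 2 * ennreal (1 / 4) * ennreal 4 = 2"
    by (subst ennreal_mult[symmetric], simp, simp, subst ennreal_mult[symmetric]) simp_all
  also have "2 * energy2 u + 2 * energy2 u = 4 * energy2 u"
    by (simp flip: distrib_right)
  finally show ?case .
qed

lemma integral_suminf_ennreal:
  fixes f :: "nat \<Rightarrow> 'a \<Rightarrow> complex"
  assumes f: "\<And>k. f k \<in> borel_measurable K" and b: "\<And>k. b k \<in> borel_measurable K"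
    and le: "\<And>k s. ennreal (cmod (f k s)) \<le> b k s"
    and fin: "(\<integral>\<^sup>+s. (\<Sum>k. b k s) \<partial>K) < \<infinity>"
  shows "(\<lambda>k. integral\<^sup>L K (f k)) sums (LINT s|K. (\<Sum>k. f k s))"
proof (rule sums_integral)
  have fin': "(\<Sum>k. \<integral>\<^sup>+s. b k s \<partial>K) < \<infinity>" using fin b by (simp add: nn_integral_suminf)
  have bf: "(\<integral>\<^sup>+s. ennreal (cmod (f k s)) \<partial>K) \<le> (\<integral>\<^sup>+s. b k s \<partial>K)" for k
    by (intro nn_integral_mono le)
  have "(\<integral>\<^sup>+s. b k s \<partial>K) < \<infinity>" for k
    using fin' sum_le_suminf[of "\<lambda>k. \<integral>\<^sup>+s. b k s \<partial>K" "{k}"] by (auto intro: le_less_trans)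
  then show int: "integrable K (f k)" for k
    using f bf by (intro integrableI_bounded) (auto intro: le_less_trans)
  have "AE s in K. (\<Sum>k. b k s) \<noteq> \<infinity>"
    using fin b by (intro nn_integral_PInf_AE) auto
  then show "AE s in K. summable (\<lambda>k. norm (f k s))"
  proof eventually_elim
    case (elim s)
    have "(\<Sum>k. ennreal (cmod (f k s))) \<le> (\<Sum>k. b k s)" by (intro suminf_le le) auto
    then show ?case using elim by (intro summable_suminf_not_top) (auto simp: top_unique)
  qed
  have "(\<Sum>k. ennreal (LINT s|K. cmod (f k s))) = (\<Sum>k. \<integral>\<^sup>+s. ennreal (cmod (f k s)) \<partial>K)"
    using int by (intro suminf_cong nn_integral_eq_integral[symmetric]) auto
  also have "\<dots> \<le> (\<Sum>k. \<integral>\<^sup>+s. b k s \<partial>K)" by (intro suminf_le bf) auto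
  finally show "summable (\<lambda>k. LINT s|K. cmod (f k s))"
    using fin' by (intro summable_suminf_not_top) (auto simp: top_unique)
qed

text \<open>
  The Neumann series \<open>\<Sum>k. T\<^sup>k g\<close> converges wherever its majorant \<open>\<Sum>k. P\<^sup>k \<bar>g\<bar>\<close> is finite, and
  at such points all the convolutions in \<open>T\<close> converge absolutely.
\<close>

lemma solution_exists:
  assumes m: "\<And>j. g j \<in> borel_measurable borel" and fin: "energy2 (abv g) < \<infinity>"
    and zero: "\<And>j t. t \<le> 0 \<Longrightarrow> g j t = 0"
  obtains z where "\<And>j. z j \<in> borel_measurable borel" "\<And>j t. t \<le> 0 \<Longrightarrow> z j t = 0"
    "AE t in lborel. \<forall>i<N. z i t = g i t + T z i t" "energy2 (abv z) \<le> 4 * energy2 (abv g)"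
proof
  define G where "G = (\<lambda>j t. \<Sum>k. Pn (abv g) k j t)"
  define z where "z = (\<lambda>j t. \<Sum>k. Tn g k j t)"
  have ma: "abv g j \<in> borel_measurable borel" for j by (rule measurable_abv[OF m])
  have mP: "Pn (abv g) k j \<in> borel_measurable borel" for k j by (rule measurable_Pn[OF ma])
  have mT: "Tn g k j \<in> borel_measurable borel" for k j by (rule measurable_Tn[OF m])
  have mG: "G j \<in> borel_measurable borel" for j
    unfolding G_def by (intro borel_measurable_suminf_order mP)
  show mz: "z j \<in> borel_measurable borel" for j
    unfolding z_def by (intro borel_measurable_suminf mT)
  show "z j t = 0" if "t \<le> 0" for j t
    unfolding z_def using Tn_zero_past[OF m zero that] by simp
  have EG: "energy2 G \<le> 4 * energy2 (abv g)"
  proof (rule energy2_tendsto[of "\<lambda>n j t. \<Sum>k<n. Pn (abv g) k j t"])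
    show "(\<lambda>n. \<Sum>k<n. Pn (abv g) k j t) \<longlonglongrightarrow> G j t" for j t
      unfolding G_def by (intro summable_LIMSEQ) auto
    show "incseq (\<lambda>n. \<Sum>k<n. Pn (abv g) k j t)" for j t
      by (intro incseq_SucI) simp
  qed (auto intro!: borel_measurable_sum mP energy2_Pn_sum ma)
  \<comment> \<open>The majorant solves its own fixed point equation. Hence \<open>P G\<close> is
    finite wherever \<open>G\<close> is, which is exactly what termwise integration of the series
    requires at that point.\<close>
  have Gsum: "G i t = abv g i t + P G i t" for i t
  proof -
    have "G i t = (\<Sum>k. Pn (abv g) (Suc k) i t) + Pn (abv g) 0 i t"
      unfolding G_def by (subst suminf_offset[of _ 1]) auto
    also have "(\<Sum>k. Pn (abv g) (Suc k) i t) = P G i t"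
      unfolding G_def by (simp add: P_suminf[OF mP])
    finally show ?thesis by (simp add: add.commute)
  qed
  have zG: "abv z j t \<le> G j t" for j t
  proof (cases "G j t = \<infinity>")
    case False
    have le: "(\<Sum>k. ennreal (cmod (Tn g k j t))) \<le> G j t"
      unfolding G_def using Tn_le_Pn[of g _ j t] by (intro suminf_le) (auto simp: abv_def)
    then have sm: "summable (\<lambda>k. cmod (Tn g k j t))"
      using False by (intro summable_suminf_not_top) (auto simp: top_unique)
    have "ennreal (cmod (z j t)) \<le> ennreal (\<Sum>k. cmod (Tn g k j t))"
      unfolding z_def by (intro ennreal_leI summable_norm sm)
    also have "\<dots> = (\<Sum>k. ennreal (cmod (Tn g k j t)))" using sm by (intro suminf_ennreal2[symmetric]) auto
    finally show ?thesis using le by (simp add: abv_def)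
  qed simp
  show "energy2 (abv z) \<le> 4 * energy2 (abv g)"
    using energy2_mono[OF zG] EG by (rule order_trans)
  have "energy2 G < \<infinity>" using EG fin by (auto simp: ennreal_mult_less_top intro: le_less_trans)
  then have fi: "(\<integral>\<^sup>+t. ennreal (exp (- (2 * l) * t)) * (G i t)\<^sup>2 \<partial>lborel) < \<infinity>" if "i < N" for i
    using le_less_trans[OF energy2_component[OF that, of G] \<open>energy2 G < \<infinity>\<close>] ennreal_w[of i]
    by (auto simp: ennreal_mult_less_top)
  have fa: "AE t in lborel. ennreal (exp (- (2 * l) * t)) * (G i t)\<^sup>2 \<noteq> \<infinity>" if "i < N" for i
    using fi[OF that] mG[of i] by (intro nn_integral_PInf_AE) auto
  have "AE t in lborel. G i t < \<infinity>" if "i < N" for i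
    using fa[OF that] by eventually_elim (auto simp: ennreal_mult_eq_top_iff less_top power_less_top_ennreal)
  then have "AE t in lborel. \<forall>i\<in>{..<N}. G i t < \<infinity>" by (intro AE_finite_allI) auto
  then show "AE t in lborel. \<forall>i<N. z i t = g i t + T z i t"
  proof eventually_elim
    case (elim t)
    show ?case
    proof (intro allI impI)
      fix i assume i: "i < N"
      have Gi: "G i t < \<infinity>" using elim i by simp
      then have PG: "P G i t < \<infinity>" using Gsum[of i t] by (simp add: less_top)
      have sums: "(\<lambda>k. LINT s|M i j p. Tn g k j (t - s)) sums (LINT s|M i j p. z j (t - s))"
        if "j < N" "p < 4" for j p
        unfolding z_def
      proof (rule integral_suminf_ennreal[where b = "\<lambda>k s. Pn (abv g) k j (t - s)"])
        show "(\<lambda>s. Tn g k j (t - s)) \<in> borel_measurable (M i j p)" for k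
          using mT[of k j] by measurable
        show "(\<lambda>s. Pn (abv g) k j (t - s)) \<in> borel_measurable (M i j p)" for k
          using mP[of k j] by measurable
        show "ennreal (cmod (Tn g k j (t - s))) \<le> Pn (abv g) k j (t - s)" for k s
          using Tn_le_Pn[of g k j "t - s"] by (simp add: abv_def)
        have "(\<integral>\<^sup>+s. G j (t - s) \<partial>M i j p) \<le> (\<Sum>p<4. \<integral>\<^sup>+s. G j (t - s) \<partial>M i j p)"
          by (rule member_le_sum) (use that in auto)
        also have "\<dots> \<le> P G i t" unfolding P_def by (rule member_le_sum) (use that in auto)
        finally show "(\<integral>\<^sup>+s. (\<Sum>k. Pn (abv g) k j (t - s)) \<partial>M i j p) < \<infinity>"
          using PG by (simp add: G_def)
      qed
      have "(\<lambda>k. T (Tn g k) i t) sums T z i t"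
        unfolding T_def by (intro sums_sum sums_mult sums) auto
      then have "(\<lambda>k. Tn g (Suc k) i t) sums T z i t" by simp
      then have "(\<lambda>k. Tn g k i t) sums (T z i t + Tn g 0 i t)" by (rule sums_Suc)
      then show "z i t = g i t + T z i t" by (simp add: z_def sums_iff add.commute)
    qed
  qed
qed

end

text \<open>The rate is sought among the integers \<open>Suc k\<close>. Both column conditions come
  from one application of the weight lemma, to a single matrix that dominates the Laplace transforms
  as well as \<open>4 * N\<close> times their squares.\<close>

lemma causal_system_exists:
  assumes sets: "\<And>i j p. sets (M i j p) = sets borel"
    and sf: "\<And>i j p. sigma_finite_measure (M i j p)"
    and pos: "\<And>i j p. AE s in M i j p. 0 \<le> s"
    and fin: "\<And>i j p. laplace 1 (M i j p) < \<infinity>"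
    and acyc: "acyclic {(j, i). i < N \<and> j < N \<and> (\<exists>p<4. emeasure (M i j p) {0} \<noteq> 0)}"
  shows "\<exists>l w. causal_system N M l w"
proof -
  define \<kappa> where "\<kappa> k i j p = enn2real (laplace (real (Suc k)) (M i j p))" for k i j p
  define a where "a k i j = (\<Sum>p<4. \<kappa> k i j p + real (4 * N) * (\<kappa> k i j p)\<^sup>2)" for k i j
  define a0 where "a0 i j = (\<Sum>p<4. measure (M i j p) {0} + real (4 * N) * (measure (M i j p) {0})\<^sup>2)" for i j
  have lim: "(\<lambda>k. a k i j) \<longlonglongrightarrow> a0 i j" for i j
    unfolding a_def a0_def \<kappa>_def
    by (intro tendsto_intros laplace_tendsto sets pos fin)
  have "{(j, i). i < N \<and> j < N \<and> a0 i j \<noteq> 0} \<subseteq> {(j, i). i < N \<and> j < N \<and> (\<exists>p<4. emeasure (M i j p) {0} \<noteq> 0)}"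
  proof safe
    fix i j assume "a0 i j \<noteq> 0"
    then obtain p where "p < 4" "measure (M i j p) {0} + real (4 * N) * (measure (M i j p) {0})\<^sup>2 \<noteq> 0"
      unfolding a0_def by (metis (no_types, lifting) lessThan_iff sum.neutral)
    then show "\<exists>p<4. emeasure (M i j p) {0} \<noteq> 0" by (auto simp: measure_def intro!: exI[of _ p])
  qed
  then have "acyclic {(j, i). i < N \<and> j < N \<and> a0 i j \<noteq> 0}" by (rule acyclic_subset[OF acyc])
  then obtain w where w: "\<And>i. 0 < w i"
    and ev: "eventually (\<lambda>k. \<forall>j<N. (\<Sum>i<N. w i * a k i j) \<le> 1 / 4 * w j) sequentially"
    using acyclic_limit_weights[of N a a0 "1 / 4", OF lim] by auto
  obtain k where le: "\<And>j. j < N \<Longrightarrow> (\<Sum>i<N. w i * a k i j) \<le> 1 / 4 * w j"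
    using eventually_happens[OF ev] by auto
  have lap: "laplace (real (Suc k)) (M i j p) = ennreal (\<kappa> k i j p)" for i j p
  proof -
    have "laplace (real (Suc k)) (M i j p) \<le> laplace 1 (M i j p)" by (intro laplace_antimono pos) simp
    then have "laplace (real (Suc k)) (M i j p) < \<infinity>" using fin le_less_trans by blast
    then show ?thesis by (simp add: \<kappa>_def less_top)
  qed
  have \<kappa>: "0 \<le> \<kappa> k i j p" for i j p by (simp add: \<kappa>_def)
  \<comment> \<open>Used with \<open>c = 2\<close> for the Laplace transforms and with
    \<open>c = 4\<close> for \<open>4 * N\<close> times their squares. Both are dominated by the
    summands of \<open>a\<close>, whose weighted column sums are at most
    \<open>w j / 4\<close>.\<close>
  have bound: "(\<Sum>i<N. ennreal (w i) * (\<Sum>p<4. ennreal (b i p))) \<le> ennreal (w j / c)"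
    if j: "j < N" and c: "0 < c" "c \<le> 4" and b: "\<And>i p. 0 \<le> b i p" "\<And>i p. b i p \<le> \<kappa> k i j p + real (4 * N) * (\<kappa> k i j p)\<^sup>2"
    for b c j
  proof -
    have "(\<Sum>i<N. ennreal (w i) * (\<Sum>p<4. ennreal (b i p))) = ennreal (\<Sum>i<N. w i * (\<Sum>p<4. b i p))"
      using b(1) w by (simp add: sum_ennreal sum_nonneg ennreal_mult less_imp_le flip: ennreal_mult)
    also have "\<dots> \<le> ennreal (\<Sum>i<N. w i * a k i j)"
      unfolding a_def using w by (intro ennreal_leI sum_mono mult_left_mono b) (auto simp: less_imp_le)
    also have "\<dots> \<le> ennreal (w j / c)"
    proof (rule ennreal_leI)
      have "1 / 4 * w j \<le> w j / c" using c w[of j] by (simp add: field_simps)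
      then show "(\<Sum>i<N. w i * a k i j) \<le> w j / c" by (rule order_trans[OF le[OF j]])
    qed
    finally show ?thesis .
  qed
  have "causal_system N M (real (Suc k)) w"
  proof (rule causal_system.intro)
    fix j assume j: "j < N"
    show "(\<Sum>i<N. ennreal (w i) * (\<Sum>p<4. laplace (real (Suc k)) (M i j p))) \<le> ennreal (w j / 2)"
      unfolding lap by (rule bound[OF j]) (use \<kappa> in auto)
    have "of_nat (4 * N) * (ennreal (\<kappa> k i j p))\<^sup>2 = ennreal (real (4 * N) * (\<kappa> k i j p)\<^sup>2)" for i p
      using \<kappa> by (subst ennreal_mult) (auto simp: ennreal_power ennreal_of_nat_eq_real_of_nat)
    then show "(\<Sum>i<N. ennreal (w i) * (\<Sum>p<4. of_nat (4 * N) * (laplace (real (Suc k)) (M i j p))\<^sup>2)) \<le> ennreal (w j / 4)"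
      unfolding lap by (simp only:, intro bound[OF j]) (use \<kappa> in auto)
  qed (rule sets sf pos w | simp)+
  then show ?thesis by blast
qed

section \<open>The block diagram of a DDAE system\<close>

text \<open>As a set function on all Borel sets, \<open>density_kernel heaviside\<close> is not a
  complex measure: it takes the default value 0 where the density is not integrable. So the
  integrator entry is given directly by its one nonzero part, Lebesgue measure on the half line.
  Null measures outside the index range let the locale conditions hold for all indices.\<close>

definition ddae_meas ::
    "nat \<Rightarrow> nat \<Rightarrow> (nat \<Rightarrow> nat \<Rightarrow> real set \<Rightarrow> complex) \<Rightarrow> (nat \<Rightarrow> nat \<Rightarrow> real set \<Rightarrow> complex) \<Rightarrow>
      (nat \<Rightarrow> nat \<Rightarrow> real set \<Rightarrow> complex) \<Rightarrow> (nat \<Rightarrow> nat \<Rightarrow> real set \<Rightarrow> complex) \<Rightarrow>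
      nat \<Rightarrow> nat \<Rightarrow> nat \<Rightarrow> real measure" where
  "ddae_meas n m A B C D i j p =
     (if i < 2 * n + m \<and> j < 2 * n + m \<and> p < 4 then
        (if i < n then
           (if j = n + i \<and> p = 0 then density lborel (\<lambda>s. ennreal (indicator {0..} s)) else null_measure borel)
         else part p (block_kernel n A B C D i j))
      else null_measure borel)"

definition causal_kernels ::
    "real \<Rightarrow> nat \<Rightarrow> nat \<Rightarrow> (nat \<Rightarrow> nat \<Rightarrow> real set \<Rightarrow> complex) \<Rightarrow> bool" where
  "causal_kernels r p q L \<longleftrightarrow> (\<forall>i<p. \<forall>j<q. complex_borel_measure (L i j) \<and> supported_in {-r..0} (L i j))"

lemma causal_kernels_riesz: "riesz_matrix r p q L M \<Longrightarrow> causal_kernels r p q M"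
  by (simp add: riesz_matrix_def causal_kernels_def)

lemma block_kernel_causal:
  assumes "causal_kernels r n n A" "causal_kernels r n m B" "causal_kernels r m n C" "causal_kernels r m m D"
    and "n \<le> i" "i < 2 * n + m" "j < 2 * n + m"
  shows "complex_borel_measure (block_kernel n A B C D i j)" "supported_in {0..} (block_kernel n A B C D i j)"
proof -
  have z: "complex_borel_measure (\<lambda>S. 0)" "supported_in {0..} (\<lambda>S. 0)"
    by (simp_all add: complex_borel_measure_def supported_in_def)
  show "complex_borel_measure (block_kernel n A B C D i j)" "supported_in {0..} (block_kernel n A B C D i j)"
    using assms z
    by (auto simp: block_kernel_def causal_kernels_def intro!: complex_borel_measure_reflect supported_in_reflect[of r])
qed

text \<open>A pair in the transitive closure is joined by a chain of edges, and a chain from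
  \<open>x\<close> back to \<open>x\<close> is a loop. Pairs are ordered from column to row to match
  the kernels \<open>K (i (Suc l)) (i l)\<close>.\<close>

lemma acyclic_no_causality_loop:
  assumes "\<not> (\<exists>j i. causality_loop N K j i)"
  shows "acyclic {(j, i). i < N \<and> j < N \<and> \<not> strictly_causal (K i j)}" (is "acyclic ?R")
proof (rule acyclicI, intro allI notI)
  fix x assume "(x, x) \<in> ?R\<^sup>+"
  then obtain k where k: "0 < k" "(x, x) \<in> ?R ^^ k" by (auto simp: trancl_power)
  then obtain f where f: "f 0 = x" "f k = x" "\<And>l. l < k \<Longrightarrow> (f l, f (Suc l)) \<in> ?R"
    by (auto simp: relpow_fun_conv)
  have "f l < N" if "l \<le> k" for l
    using f(3)[of l] f(3)[of 0] f(1,2) k(1) that by (cases "l = k") auto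
  then have "causality_loop N K k f" using k f by (auto simp: causality_loop_def)
  then show False using assms by blast
qed

lemma laplace_null_measure [simp]: "laplace a (null_measure M) = 0"
  by (simp add: laplace_def nn_integral_null_measure)

lemma nn_integral_exp_Ici: "(\<integral>\<^sup>+s. ennreal (exp (- s)) * indicator {0..} s \<partial>lborel) = 1"
proof -
  have "(\<integral>\<^sup>+s. ennreal (exp (- s)) * indicator {0..} s \<partial>lborel) = ennreal (0 - (- exp (- 0)))"
  proof (rule nn_integral_FTC_atLeast)
    show "((\<lambda>s. - exp (- s) :: real) \<longlongrightarrow> 0) at_top"
      using tendsto_minus[OF filterlim_compose[OF exp_at_bot filterlim_uminus_at_bot_at_top]] by simp
  qed (auto intro!: derivative_eq_intros)
  then show ?thesis by simp
qed

lemma ddae_causal_system: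
  assumes ker: "causal_kernels r n n A" "causal_kernels r n m B" "causal_kernels r m n C" "causal_kernels r m m D"
    and loop: "\<not> ddae_has_causality_loop n m A B C D"
  shows "\<exists>l w. causal_system (2 * n + m) (ddae_meas n m A B C D) l w"
proof (rule causal_system_exists)
  let ?M = "ddae_meas n m A B C D" and ?N = "2 * n + m"
  note bk = block_kernel_causal[OF ker]
  let ?E = "density lborel (\<lambda>s. ennreal (indicator {0..} s)) :: real measure"
  \<comment> \<open>Entries are of three kinds, so each property is checked for Lebesgue measure on
    the half line, for the null measure and for the parts of a causal complex measure.\<close>
  have cases_M: "Q (?M i j p)"
    if "Q ?E" "Q (null_measure borel)"
      "\<And>k. complex_borel_measure k \<Longrightarrow> supported_in {0..} k \<Longrightarrow> Q (part p k)" for Q i j p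
    using that bk[of i j] by (auto simp: ddae_meas_def)
  have sf_null: "sigma_finite_measure (null_measure (borel :: real measure))"
    by (intro finite_measure.axioms(1) finite_measureI) simp
  show "sets (?M i j p) = sets borel" for i j p by (rule cases_M) auto
  show "sigma_finite_measure (?M i j p)" for i j p
  proof (rule cases_M)
    show "sigma_finite_measure ?E"
      by (rule sigma_finite_measure.sigma_finite_iff_density_finite[THEN iffD2, OF sigma_finite_lborel])
        auto
  qed (auto intro: sf_null finite_measure.axioms(1) finite_measure_part)
  show "AE s in ?M i j p. 0 \<le> s" for i j p
  proof (rule cases_M)
    show "AE s in ?E. 0 \<le> s" by (subst AE_density) (auto simp: indicator_def)
    show "AE s in null_measure borel. (0::real) \<le> s" by (rule AE_I'[of UNIV]) (auto simp: null_sets_def)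
    show "AE s in part p k. 0 \<le> s" if "complex_borel_measure k" "supported_in {0..} k" for k
      using AE_part[OF that] by simp
  qed
  show "laplace 1 (?M i j p) < \<infinity>" for i j p
  proof (rule cases_M)
    have "laplace 1 ?E = (\<integral>\<^sup>+s. ennreal (exp (- s)) * indicator {0..} s \<partial>lborel)"
      unfolding laplace_def by (subst nn_integral_density) (auto simp: mult.commute ennreal_indicator)
    also have "\<dots> = 1" by (rule nn_integral_exp_Ici)
    finally show "laplace 1 ?E < \<infinity>" by simp
    show "laplace 1 (part p k) < \<infinity>" if k: "complex_borel_measure k" "supported_in {0..} k" for k
    proof -
      have "laplace 1 (part p k) \<le> laplace 0 (part p k)"
        using AE_part[OF k] by (intro laplace_antimono) auto
      also have "\<dots> = emeasure (part p k) UNIV" by (simp add: laplace_def)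
      also have "\<dots> < \<infinity>"
        using finite_measure.emeasure_finite[OF finite_measure_part[OF k(1)], of p UNIV] by (simp add: less_top)
      finally show ?thesis .
    qed
  qed simp
  show "acyclic {(j, i). i < ?N \<and> j < ?N \<and> (\<exists>p<4. emeasure (?M i j p) {0} \<noteq> 0)}"
  proof (rule acyclic_subset)
    show "acyclic {(j, i). i < ?N \<and> j < ?N \<and> \<not> strictly_causal (block_kernel n A B C D i j)}"
      using loop by (intro acyclic_no_causality_loop) (simp add: ddae_has_causality_loop_def)
    \<comment> \<open>Lebesgue measure has no atom, so the integrator produces no edge; in the other
      rows strict causality removes the mass at 0 from all four parts.\<close>
    have "emeasure (?M i j p) {0} = 0"
      if "i < ?N" "j < ?N" "strictly_causal (block_kernel n A B C D i j)" for i j p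
      using that bk[of i j]
      by (auto simp: ddae_meas_def emeasure_density nn_integral_indicator_singleton
          strictly_causal_def intro!: emeasure_part_singleton)
    then show "{(j, i). i < ?N \<and> j < ?N \<and> (\<exists>p<4. emeasure (?M i j p) {0} \<noteq> 0)} \<subseteq>
      {(j, i). i < ?N \<and> j < ?N \<and> \<not> strictly_causal (block_kernel n A B C D i j)}" by blast
  qed
qed

locale ddae_system = causal_system "2 * n + m" "ddae_meas n m A B C D" l w
  for n m :: nat and A B C D :: "nat \<Rightarrow> nat \<Rightarrow> real set \<Rightarrow> complex" and l :: real and w :: "nat \<Rightarrow> real" +
  fixes r :: real
  assumes r: "0 \<le> r"
begin

text \<open>The integrator row has a single nonzero entry, e in column \<open>n + i\<close>; the
  substitution of \<open>t - s\<close> for \<open>s\<close> turns the convolution into a running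
  integral.\<close>

lemma T_x:
  assumes i: "i < n" and m: "\<And>j. z j \<in> borel_measurable borel"
  shows "T z i t = (LINT s|lborel. indicator {..t} s *\<^sub>R z (n + i) s)"
proof -
  let ?E = "density lborel (\<lambda>s. ennreal (indicator {0..} s)) :: real measure"
  have zn[measurable]: "z (n + i) \<in> borel_measurable borel" by (rule m)
  have null: "(LINT s|null_measure borel. f s) = 0" for f :: "real \<Rightarrow> complex"
    by (rule integral_eq_zero_AE, rule AE_I'[of UNIV]) (auto simp: null_sets_def)
  have "T z i t = (\<Sum>j<2 * n + m. \<Sum>p<4::nat. if j = n + i then (if p = 0 then (LINT s|?E. z (n + i) (t - s)) else 0) else 0)"
    unfolding T_def using i by (intro sum.cong refl) (auto simp: ddae_meas_def null)
  also have "\<dots> = (LINT s|?E. z (n + i) (t - s))"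
    using i by (subst sum.swap) (simp add: sum.delta)
  also have "\<dots> = (LINT s|lborel. indicator {0..} s *\<^sub>R z (n + i) (t - s))"
    by (subst integral_density) auto
  also have "\<dots> = (LINT s|lborel. indicator {..t} s *\<^sub>R z (n + i) s)"
    by (subst lborel_integral_real_affine[where c = "-1" and t = t])
      (auto intro!: Bochner_Integration.integral_cong simp: indicator_def)
  finally show ?thesis .
qed

lemma cm_integral_zero [simp]: "cm_integral (\<lambda>S. 0) f = 0"
proof -
  have "AE s in part p (\<lambda>S. 0). Q s" for p Q
    by (rule AE_I'[of UNIV]) (auto simp: null_sets_def)
  then show ?thesis by (auto simp: cm_integral_part intro!: sum.neutral integral_eq_zero_AE)
qed

lemma T_block:
  assumes "n \<le> i" "i < 2 * n + m"
  shows "T z i t = (\<Sum>j<2 * n + m. meas_conv (block_kernel n A B C D i j) (z j) t)"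
  unfolding T_def meas_conv_def cm_integral_part using assms
  by (intro sum.cong refl) (simp add: ddae_meas_def)

lemma sum_blocks:
  fixes f :: "nat \<Rightarrow> 'a :: comm_monoid_add"
  assumes "\<And>j. n \<le> j \<Longrightarrow> j < 2 * n \<Longrightarrow> f j = 0"
  shows "(\<Sum>j<2 * n + m. f j) = (\<Sum>j<n. f j) + (\<Sum>j<m. f (2 * n + j))"
proof -
  have "(\<Sum>j<2 * n + m. f j) = (\<Sum>j<n + n. f j) + (\<Sum>j<m. f (2 * n + j))"
    by (induction m) (simp_all add: mult_2 add.assoc)
  also have "(\<Sum>j<n + n. f j) = (\<Sum>j<n. f j) + (\<Sum>j=n..<n + n. f j)"
    by (simp add: lessThan_atLeast0 sum.atLeastLessThan_concat)
  also have "(\<Sum>j=n..<n + n. f j) = 0" using assms by (intro sum.neutral) auto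
  finally show ?thesis by simp
qed

lemma T_v:
  assumes "i < n"
  shows "T z (n + i) t = (\<Sum>j<n. meas_conv (reflect (A i j)) (z j) t) + (\<Sum>j<m. meas_conv (reflect (B i j)) (z (2 * n + j)) t)"
  using assms by (subst T_block, simp, simp, subst sum_blocks) (auto simp: block_kernel_def meas_conv_def)

lemma T_y:
  assumes "i < m"
  shows "T z (2 * n + i) t = (\<Sum>j<n. meas_conv (reflect (C i j)) (z j) t) + (\<Sum>j<m. meas_conv (reflect (D i j)) (z (2 * n + j)) t)"
  using assms by (subst T_block, simp, simp, subst sum_blocks) (auto simp: block_kernel_def meas_conv_def)

text \<open>In the rows from \<open>n\<close> on, the columns of the derivative block vanish, so the
  middle components can be altered freely. \<open>T_split\<close> rests on this freedom.\<close>

lemma T_row_cong: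
  assumes i: "n \<le> i" "i < 2 * n + m" and eq: "\<And>j. j < n \<or> 2 * n \<le> j \<Longrightarrow> u j = v j"
  shows "T u i t = T v i t"
proof (cases "i < 2 * n")
  case True
  then have "T u (n + (i - n)) t = T v (n + (i - n)) t" using i eq by (simp only: T_v, simp)
  then show ?thesis using i by simp
next
  case False
  then have "T u (2 * n + (i - 2 * n)) t = T v (2 * n + (i - 2 * n)) t" using i eq by (simp only: T_y, simp)
  then show ?thesis using False by simp
qed

text \<open>The derivative block is filled with 0, a value that the rows from \<open>n\<close> on do
  not read. Extension by 0 to the left of \<open>- r\<close> is built in, so that
  \<open>T (U x y)\<close> reproduces the delay convolutions at every time.\<close>

definition U :: "(real \<Rightarrow> nat \<Rightarrow> complex) \<Rightarrow> (real \<Rightarrow> nat \<Rightarrow> complex) \<Rightarrow> nat \<Rightarrow> real \<Rightarrow> complex" where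
  "U x y j t = (if - r \<le> t then (if j < n then x t j
     else if 2 * n \<le> j \<and> j < 2 * n + m then y t (j - 2 * n) else 0) else 0)"

lemma delay_conv_v:
  "i < n \<Longrightarrow> delay_conv r n A x i t + delay_conv r m B y i t = T (U x y) (n + i) t"
  by (auto simp: T_v delay_conv_def U_def[abs_def] cong: if_cong
      intro!: arg_cong2[of _ _ _ _ "(+)"] sum.cong)

lemma delay_conv_y:
  "i < m \<Longrightarrow> delay_conv r n C x i t + delay_conv r m D y i t = T (U x y) (2 * n + i) t"
  by (auto simp: T_y delay_conv_def U_def[abs_def] cong: if_cong
      intro!: arg_cong2[of _ _ _ _ "(+)"] sum.cong)

end

section \<open>Solutions of the initial value problem\<close>

lemma measurable_extension:
  fixes f :: "real \<Rightarrow> complex"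
  assumes "\<And>b. (\<lambda>t. indicator {a..b} t *\<^sub>R f t) \<in> borel_measurable borel"
  shows "(\<lambda>t. if a \<le> t then f t else 0) \<in> borel_measurable borel"
proof (rule borel_measurable_LIMSEQ_metric)
  show "(\<lambda>t. indicator {a..real k} t *\<^sub>R f t) \<in> borel_measurable borel" for k :: nat by (rule assms)
  show "(\<lambda>k. indicator {a..real k} t *\<^sub>R f t) \<longlonglongrightarrow> (if a \<le> t then f t else 0)" for t
  proof (rule tendsto_eventually)
    obtain k0 :: nat where "t \<le> real k0" using real_arch_simple by blast
    then show "eventually (\<lambda>k. indicator {a..real k} t *\<^sub>R f t = (if a \<le> t then f t else 0)) sequentially"
      by (intro eventually_sequentiallyI[of k0]) (auto simp: indicator_def)
  qed
qed

text \<open>The set where two continuous functions differ is open, and a nonempty open set is not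
  null. This carries equations known almost everywhere over to the single time at which the state
  norm evaluates x.\<close>

lemma continuous_AE_eq:
  fixes f g :: "real \<Rightarrow> complex"
  assumes "continuous_on {0<..} f" "continuous_on {0<..} g"
    and AE: "AE t in lborel. 0 < t \<longrightarrow> f t = g t" and "0 < t"
  shows "f t = g t"
proof (rule ccontr)
  assume "f t \<noteq> g t"
  let ?S = "{s \<in> {0<..}. f s - g s \<in> - {0}}"
  have "open ?S"
    using assms by (intro continuous_open_preimage[unfolded vimage_def Int_def mem_Collect_eq] continuous_intros) auto
  moreover have "?S \<noteq> {}" using \<open>f t \<noteq> g t\<close> \<open>0 < t\<close> by auto
  ultimately have "\<not> negligible ?S" by (rule open_not_negligible)
  moreover have "AE t in lebesgue. t \<notin> ?S"
    using AE_completion[OF AE] by eventually_elim auto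
  then have "negligible ?S"
    unfolding negligible_iff_null_sets by (subst AE_iff_null_sets) (use \<open>open ?S\<close> in auto)
  ultimately show False by blast
qed

context causal_system
begin

lemma locint_if_square:
  assumes m: "\<And>j. u j \<in> borel_measurable borel" and a: "\<And>j t. t < a \<Longrightarrow> u j t = 0"
    and fin: "\<And>b j. j < N \<Longrightarrow> (\<integral>\<^sup>+t. (u j t)\<^sup>2 * indicator {..b} t \<partial>lborel) < \<infinity>"
  shows "locint u"
  unfolding locint_def
proof (intro conjI allI impI m)
  show "\<exists>a. \<forall>j. \<forall>t<a. u j t = 0" using a by blast
  fix b j assume j: "j < N"
  have [measurable]: "u j \<in> borel_measurable borel" by (rule m)
  have x: "x \<le> 1 + x\<^sup>2" for x :: ennreal
  proof (cases "x \<le> 1")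
    case True then show ?thesis by (rule order_trans) simp
  next
    case False
    then have "1 * x \<le> x * x" by (intro mult_right_mono) auto
    then show ?thesis by (simp add: power2_eq_square) (metis add_increasing zero_le)
  qed
  have "(\<integral>\<^sup>+t. past b u j t \<partial>lborel) \<le>
      (\<integral>\<^sup>+t. indicator {a..b} t + (u j t)\<^sup>2 * indicator {..b} t \<partial>lborel)"
    by (intro nn_integral_mono) (use x a in \<open>auto simp: past_def indicator_def not_le\<close>)
  also have "\<dots> = emeasure lborel {a..b} + (\<integral>\<^sup>+t. (u j t)\<^sup>2 * indicator {..b} t \<partial>lborel)"
    by (subst nn_integral_add) auto
  also have "\<dots> < \<infinity>" using fin[OF j] emeasure_lborel_cbox_finite[of a b] by (simp add: less_top)
  finally show "(\<integral>\<^sup>+t. past b u j t \<partial>lborel) < \<infinity>" .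
qed

lemma locint_integrable:
  assumes "locint (abv z)" and m: "z j \<in> borel_measurable borel" and j: "j < N"
  shows "integrable lborel (\<lambda>s. indicator {..b} s *\<^sub>R z j s)"
proof (rule integrableI_bounded)
  show "(\<lambda>s. indicator {..b} s *\<^sub>R z j s) \<in> borel_measurable lborel" using m by simp
  have "(\<integral>\<^sup>+s. norm (indicator {..b} s *\<^sub>R z j s) \<partial>lborel) = (\<integral>\<^sup>+s. past b (abv z) j s \<partial>lborel)"
    by (intro nn_integral_cong) (simp add: past_def abv_def indicator_def)
  then show "(\<integral>\<^sup>+s. norm (indicator {..b} s *\<^sub>R z j s) \<partial>lborel) < \<infinity>" using assms by (simp add: locint_def)
qed

text \<open>Up to time \<open>b\<close> the weight is at least \<open>exp (- 2 * l * b)\<close>;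
  dividing by it and by the component weight \<open>w i\<close> gives the constant.\<close>

lemma square_integral_le_energy2:
  assumes [measurable]: "u i \<in> borel_measurable borel" and i: "i < N"
  shows "(\<integral>\<^sup>+t. (u i t)\<^sup>2 * indicator {..b} t \<partial>lborel) \<le> ennreal (exp (2 * l * b) / w i) * energy2 u"
proof -
  have "(\<integral>\<^sup>+t. (u i t)\<^sup>2 * indicator {..b} t \<partial>lborel) \<le>
      (\<integral>\<^sup>+t. ennreal (exp (2 * l * b)) * (ennreal (exp (- (2 * l) * t)) * (u i t)\<^sup>2) \<partial>lborel)"
  proof (rule nn_integral_mono)
    fix t show "(u i t)\<^sup>2 * indicator {..b} t \<le> ennreal (exp (2 * l * b)) * (ennreal (exp (- (2 * l) * t)) * (u i t)\<^sup>2)"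
    proof (cases "t \<le> b")
      case True
      then have "0 \<le> 2 * l * (b - t)" using l by simp
      then have "ennreal 1 \<le> ennreal (exp (2 * l * b) * exp (- (2 * l) * t))"
        by (intro ennreal_leI) (simp add: algebra_simps flip: exp_add)
      then have "1 * (u i t)\<^sup>2 \<le> (ennreal (exp (2 * l * b)) * ennreal (exp (- (2 * l) * t))) * (u i t)\<^sup>2"
        by (intro mult_right_mono) (simp_all add: ennreal_mult)
      then show ?thesis using True by (simp add: mult.assoc)
    qed simp
  qed
  also have "\<dots> = ennreal (exp (2 * l * b)) * (\<integral>\<^sup>+t. ennreal (exp (- (2 * l) * t)) * (u i t)\<^sup>2 \<partial>lborel)"
    by (intro nn_integral_cmult) simp
  also have "ennreal (exp (2 * l * b)) = ennreal (exp (2 * l * b) / w i) * ennreal (w i)"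
    using w[of i] by (simp flip: ennreal_mult)
  also have "ennreal (exp (2 * l * b) / w i) * ennreal (w i) * (\<integral>\<^sup>+t. ennreal (exp (- (2 * l) * t)) * (u i t)\<^sup>2 \<partial>lborel) \<le>
      ennreal (exp (2 * l * b) / w i) * energy2 u"
    unfolding mult.assoc by (intro mult_left_mono energy2_component i) simp
  finally show ?thesis .
qed

lemma locint_if_energy2:
  assumes m: "\<And>j. u j \<in> borel_measurable borel" and "\<And>j t. t < a \<Longrightarrow> u j t = 0"
    and fin: "energy2 u < \<infinity>"
  shows "locint u"
proof (rule locint_if_square)
  fix b j assume "j < N"
  have "(\<integral>\<^sup>+t. (u j t)\<^sup>2 * indicator {..b} t \<partial>lborel) \<le> ennreal (exp (2 * l * b) / w j) * energy2 u"
    by (rule square_integral_le_energy2) fact+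
  also have "\<dots> < \<infinity>" using fin by (simp add: ennreal_mult_less_top)
  finally show "(\<integral>\<^sup>+t. (u j t)\<^sup>2 * indicator {..b} t \<partial>lborel) < \<infinity>" .
qed fact+

end

section \<open>Splitting a solution at time 0\<close>

context ddae_system
begin

definition init :: "(real \<Rightarrow> nat \<Rightarrow> complex) \<Rightarrow> (real \<Rightarrow> nat \<Rightarrow> complex) \<Rightarrow> nat \<Rightarrow> real \<Rightarrow> complex" where
  "init \<xi> \<psi> j t = (if t \<le> 0 then U \<xi> \<psi> j t else 0)"

text \<open>The solution after time 0, with the derivative block defined as A x + B y in terms of
  the whole of x and y, their past included.\<close>

definition diagram :: "(real \<Rightarrow> nat \<Rightarrow> complex) \<Rightarrow> (real \<Rightarrow> nat \<Rightarrow> complex) \<Rightarrow> nat \<Rightarrow> real \<Rightarrow> complex" where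
  "diagram x y j t = (if t \<le> 0 then 0 else if n \<le> j \<and> j < 2 * n then T (U x y) j t else U x y j t)"

text \<open>The forcing by the initial data: the constant \<phi> in the integrator rows and the
  effect of the past in the other rows. The cut at 0 makes the solution of the diagram vanish up to
  time 0.\<close>

definition source :: "(nat \<Rightarrow> complex) \<Rightarrow> (real \<Rightarrow> nat \<Rightarrow> complex) \<Rightarrow> (real \<Rightarrow> nat \<Rightarrow> complex) \<Rightarrow>
    nat \<Rightarrow> real \<Rightarrow> complex" where
  "source \<phi> \<xi> \<psi> i t = (if t \<le> 0 \<or> 2 * n + m \<le> i then 0 else if i < n then \<phi> i else T (init \<xi> \<psi>) i t)"

lemma measurable_U:
  assumes "locally_L1 r n x" "locally_L1 r m y" shows "U x y j \<in> borel_measurable borel"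
proof -
  have z: "(\<lambda>t. if - r \<le> t then z t i else 0) \<in> borel_measurable borel" if "locally_L1 r q z" "i < q"
    for q i and z :: "real \<Rightarrow> nat \<Rightarrow> complex"
  proof (rule measurable_extension)
    fix b
    have "integrable lborel (\<lambda>t. indicator {- r..b} t *\<^sub>R z t i)"
      using that by (simp add: locally_L1_def set_integrable_def)
    from borel_measurable_integrable[OF this]
    show "(\<lambda>t. indicator {- r..b} t *\<^sub>R z t i) \<in> borel_measurable borel" by simp
  qed
  note x = z[OF assms(1)] and y = z[OF assms(2)]
  show ?thesis
  proof (cases "j < n")
    case True then show ?thesis using x by (simp add: U_def[abs_def] cong: if_cong)
  next
    case False
    then show ?thesis using y[of "j - 2 * n"]
      by (cases "2 * n \<le> j \<and> j < 2 * n + m") (auto simp: U_def[abs_def] cong: if_cong)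
  qed
qed

lemma locint_U:
  assumes x: "locally_L1 r n x" and y: "locally_L1 r m y" shows "locint (abv (U x y))"
  unfolding locint_def
proof (intro conjI allI impI)
  show "abv (U x y) j \<in> borel_measurable borel" for j by (intro measurable_abv measurable_U x y)
  show "\<exists>a. \<forall>j. \<forall>t<a. abv (U x y) j t = 0" by (intro exI[of _ "- r"]) (auto simp: abv_def U_def)
  fix b j assume j: "j < 2 * n + m"
  have fin: "(\<integral>\<^sup>+t. norm (indicator {- r..b} t *\<^sub>R z t i) \<partial>lborel) < \<infinity>" if "locally_L1 r q z" "i < q"
    for q i and z :: "real \<Rightarrow> nat \<Rightarrow> complex"
    using that by (auto simp: locally_L1_def set_integrable_def integrable_iff_bounded)
  consider "j < n" | "n \<le> j" "j < 2 * n" | "2 * n \<le> j" "j - 2 * n < m" using j by linarith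
  then show "(\<integral>\<^sup>+t. past b (abv (U x y)) j t \<partial>lborel) < \<infinity>"
  proof cases
    case 1
    have "(\<integral>\<^sup>+t. past b (abv (U x y)) j t \<partial>lborel) = (\<integral>\<^sup>+t. norm (indicator {- r..b} t *\<^sub>R x t j) \<partial>lborel)"
      using 1 by (intro nn_integral_cong) (auto simp: past_def abv_def U_def indicator_def)
    then show ?thesis using fin[OF x 1] by simp
  next
    case 2
    then have "past b (abv (U x y)) j t = 0" for t by (simp add: past_def abv_def U_def)
    then show ?thesis by simp
  next
    case 3
    have "(\<integral>\<^sup>+t. past b (abv (U x y)) j t \<partial>lborel) = (\<integral>\<^sup>+t. norm (indicator {- r..b} t *\<^sub>R y t (j - 2 * n)) \<partial>lborel)"
      using 3 j by (intro nn_integral_cong) (auto simp: past_def abv_def U_def indicator_def)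
    then show ?thesis using fin[OF y 3(2)] by simp
  qed
qed

text \<open>A solution is the sum of its past and its future in the x and y blocks only, as
  \<open>U\<close> carries 0 in the derivative block. The auxiliary \<open>u'\<close> fills that
  block with the sum, which leaves the rows considered unchanged, and additivity then applies
  wherever both majorants are finite.\<close>

lemma T_split:
  assumes m: "\<And>j. u j \<in> borel_measurable borel" "\<And>j. v j \<in> borel_measurable borel" "\<And>j. z j \<in> borel_measurable borel"
    and li: "locint (abv v)" "locint (abv z)"
    and eq: "AE t in lborel. \<forall>j<2 * n + m. j < n \<or> 2 * n \<le> j \<longrightarrow> u j t = v j t + z j t"
  shows "AE t in lborel. \<forall>i<2 * n + m. n \<le> i \<longrightarrow> T u i t = T v i t + T z i t"
proof -
  define u' where "u' j = (if j < n \<or> 2 * n \<le> j then u j else (\<lambda>t. v j t + z j t))" for j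
  have "AE t in lborel. \<forall>i. T u' i t = T (\<lambda>j s. v j s + z j s) i t"
  proof (rule T_cong_AE)
    show "AE t in lborel. \<forall>j<2 * n + m. u' j t = v j t + z j t"
      using eq by eventually_elim (auto simp: u'_def)
  qed (use m in \<open>auto simp: u'_def\<close>)
  then show ?thesis
    using locint_AE_finite[OF locint_P[OF li(1)]] locint_AE_finite[OF locint_P[OF li(2)]]
  proof eventually_elim
    case (elim t)
    show ?case
    proof (intro allI impI)
      fix i assume i: "i < 2 * n + m" "n \<le> i"
      have "T u i t = T u' i t" using i by (intro T_row_cong) (auto simp: u'_def)
      also have "\<dots> = T (\<lambda>j s. v j s + z j s) i t" using elim by simp
      also have "\<dots> = T v i t + T z i t" using elim i by (intro T_add m) auto
      finally show "T u i t = T v i t + T z i t" .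
    qed
  qed
qed

lemma fun_conv_heaviside: "fun_conv heaviside f t = (LINT s|lborel. indicator {..t} s *\<^sub>R f s)"
  unfolding fun_conv_def heaviside_def
  by (intro Bochner_Integration.integral_cong refl) (auto simp: indicator_def)

text \<open>The constant \<open>c\<close> is the integral of A x + B y over negative times, which
  convolution with e includes for every positive \<open>t\<close>. It is to be absorbed by the free
  vector f in the definition of a solution.\<close>

lemma integral_form:
  assumes xy: "locally_L1 r n x" "locally_L1 r m y" and i: "i < n"
    and m: "\<And>j. z j \<in> borel_measurable borel" and zero: "\<And>j t. t \<le> 0 \<Longrightarrow> z j t = 0"
    and v: "AE t in lborel. 0 < t \<longrightarrow> z (n + i) t = T (U x y) (n + i) t"
  obtains c where "\<And>t. 0 < t \<Longrightarrow> fun_conv heaviside (delay_conv r n A x i) t +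
      fun_conv heaviside (delay_conv r m B y i) t = c + T z i t"
proof
  define h where "h = T (U x y)"
  fix t :: real assume t: "0 < t"
  have mU: "U x' y' j \<in> borel_measurable borel" if "locally_L1 r n x'" "locally_L1 r m y'" for x' y' j
    by (rule measurable_U[OF that])
  have int: "integrable lborel (\<lambda>s. indicator {..b} s *\<^sub>R T (U x' y') (n + i) s)"
    if "locally_L1 r n x'" "locally_L1 r m y'" for x' y' b
  proof (rule locint_integrable)
    have li: "locint (P (abv (U x' y')))" by (intro locint_P locint_U that)
    have mT: "T (U x' y') j \<in> borel_measurable borel" for j by (intro measurable_T mU that)
    show "locint (abv (T (U x' y')))"
      by (rule locint_mono[OF li measurable_abv[OF mT]]) (simp add: abv_def T_le_P)
    show "T (U x' y') (n + i) \<in> borel_measurable borel" by (rule mT)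
  qed (use i in auto)
  \<comment> \<open>Pairing each of \<open>x\<close> and \<open>y\<close> with the zero function
    exhibits the A and B terms separately as rows of \<open>T\<close>, so that the integrability
    statement \<open>int\<close> covers both and their integrals may be added.\<close>
  have z0: "locally_L1 r n (\<lambda>_ _. 0)" "locally_L1 r m (\<lambda>_ _. 0)" by (simp_all add: locally_L1_def set_integrable_def)
  have part0: "cm_integral k (\<lambda>s. 0) = 0" for k by (simp add: cm_integral_part)
  have dA: "delay_conv r n A x i s = T (U x (\<lambda>_ _. 0)) (n + i) s" for s
    using delay_conv_v[OF i, of x s "\<lambda>_ _. 0"] by (simp add: delay_conv_def meas_conv_def part0)
  have dB: "delay_conv r m B y i s = T (U (\<lambda>_ _. 0) y) (n + i) s" for s
    using delay_conv_v[OF i, of "\<lambda>_ _. 0" s y] by (simp add: delay_conv_def meas_conv_def part0)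
  have ih: "integrable lborel (\<lambda>s. indicator {..b} s *\<^sub>R h (n + i) s)" for b
    unfolding h_def by (rule int[OF xy])
  have "fun_conv heaviside (delay_conv r n A x i) t + fun_conv heaviside (delay_conv r m B y i) t =
      (LINT s|lborel. indicator {..t} s *\<^sub>R delay_conv r n A x i s + indicator {..t} s *\<^sub>R delay_conv r m B y i s)"
    unfolding fun_conv_heaviside dA dB
    by (intro Bochner_Integration.integral_add[symmetric] int xy z0)
  also have "\<dots> = (LINT s|lborel. indicator {..t} s *\<^sub>R h (n + i) s)"
    unfolding h_def by (simp only: scaleR_add_right[symmetric] delay_conv_v[OF i])
  also have "\<dots> = (LINT s|lborel. indicator {..0} s *\<^sub>R h (n + i) s) +
      ((LINT s|lborel. indicator {..t} s *\<^sub>R h (n + i) s) - (LINT s|lborel. indicator {..0} s *\<^sub>R h (n + i) s))"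
    by simp
  also have "(LINT s|lborel. indicator {..t} s *\<^sub>R h (n + i) s) - (LINT s|lborel. indicator {..0} s *\<^sub>R h (n + i) s) =
      (LINT s|lborel. indicator {..t} s *\<^sub>R h (n + i) s - indicator {..0} s *\<^sub>R h (n + i) s)"
    by (intro Bochner_Integration.integral_diff[symmetric] ih)
  also have "\<dots> = (LINT s|lborel. indicator {..t} s *\<^sub>R z (n + i) s)"
  proof (rule integral_cong_AE)
    show "AE s in lborel. indicator {..t} s *\<^sub>R h (n + i) s - indicator {..0} s *\<^sub>R h (n + i) s =
        indicator {..t} s *\<^sub>R z (n + i) s"
      using v by eventually_elim (use t zero in \<open>auto simp: indicator_def h_def\<close>)
  qed (use ih m[of "n + i"] in \<open>auto dest!: borel_measurable_integrable\<close>)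
  also have "\<dots> = T z i t" by (rule T_x[OF i m, symmetric])
  finally show "fun_conv heaviside (delay_conv r n A x i) t + fun_conv heaviside (delay_conv r m B y i) t =
      (LINT s|lborel. indicator {..0} s *\<^sub>R h (n + i) s) + T z i t" .
qed

text \<open>A running integral of a locally integrable function is continuous. Its value 0 at time 0
  is what makes \<phi> the right limit of x.\<close>

lemma continuous_T_x:
  assumes i: "i < n" and m: "\<And>j. z j \<in> borel_measurable borel" and zero: "\<And>j t. t \<le> 0 \<Longrightarrow> z j t = 0"
    and li: "locint (abv z)"
  shows "continuous_on {0..} (T z i)" "T z i 0 = 0"
proof -
  show "T z i 0 = 0"
    unfolding T_x[OF i m] by (intro integral_eq_zero_AE) (auto simp: indicator_def zero)
  have si: "set_integrable lborel {0..b} (z (n + i))" for b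
  proof -
    have "integrable lborel (\<lambda>s. indicator {..b} s *\<^sub>R z (n + i) s)"
      using i by (intro locint_integrable li m) auto
    moreover have "indicator {..b} s *\<^sub>R z (n + i) s = indicator {0..b} s *\<^sub>R z (n + i) s" for s
      using zero by (auto simp: indicator_def)
    ultimately show ?thesis by (simp add: set_integrable_def)
  qed
  have eq: "T z i t = integral {0..t} (z (n + i))" for t
  proof -
    have "T z i t = (LINT s:{0..t}|lborel. z (n + i) s)"
      unfolding T_x[OF i m] set_lebesgue_integral_def
      by (intro Bochner_Integration.integral_cong) (auto simp: indicator_def zero)
    then show ?thesis by (simp add: set_borel_integral_eq_integral(2)[OF si])
  qed
  show "continuous_on {0..} (T z i)"
    unfolding continuous_on_eq_continuous_within
  proof
    fix t :: real assume t: "t \<in> {0..}"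
    have "continuous_on {0..t + 1} (\<lambda>s. integral {0..s} (z (n + i)))"
      by (intro indefinite_integral_continuous_1 set_borel_integral_eq_integral(1) si)
    then have "continuous (at t within {0..t + 1}) (T z i)"
      using t unfolding eq[abs_def] by (auto simp: continuous_on_eq_continuous_within)
    moreover have "at t within {0..t + 1} = at t within {0..}"
      by (rule at_within_nhd[of _ "{..<t + 1}"]) auto
    ultimately show "continuous (at t within {0..}) (T z i)" by (simp add: continuous_within)
  qed
qed

end

lemma locally_L1_if_L2:
  assumes "locally_L2 r q z" shows "locally_L1 r q z"
  unfolding locally_L1_def set_integrable_def
proof (intro allI impI)
  fix b i assume i: "i < q"
  let ?I = "indicator {- r..b} :: real \<Rightarrow> real"
  have sq: "integrable lborel (\<lambda>t. ?I t *\<^sub>R (cmod (z t i))\<^sup>2)"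
    and m: "(\<lambda>t. ?I t *\<^sub>R z t i) \<in> borel_measurable lborel"
    using assms i by (auto simp: locally_L2_def L2_on_def set_integrable_def set_borel_measurable_def)
  have c: "integrable lborel ?I"
    using emeasure_lborel_cbox_finite[of "- r" b] by (simp add: integrable_indicator_iff)
  show "integrable lborel (\<lambda>t. ?I t *\<^sub>R z t i)"
  proof (rule Bochner_Integration.integrable_bound[OF Bochner_Integration.integrable_add[OF c sq] m])
    have "a \<le> 1 + a\<^sup>2" if "0 \<le> a" for a :: real
      using zero_le_power2[of "a - 1"] that by (simp add: power2_eq_square algebra_simps)
    then show "AE t in lborel. norm (?I t *\<^sub>R z t i) \<le> norm (?I t + ?I t *\<^sub>R (cmod (z t i))\<^sup>2)"
      by (intro AE_I2) (auto simp: indicator_def)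
  qed
qed

lemma vnorm_square: "(vnorm q v)\<^sup>2 = (\<Sum>i<q. (cmod (v i))\<^sup>2)"
  by (simp add: vnorm_def L2_set_def sum_nonneg)

text \<open>An interval to the right of 0 has positive measure, hence meets every set of full
  measure. Limits along this filter are therefore unique, which is how the constant f gets
  determined.\<close>

lemma at_right_ae_filter: "inf (at_right (0::real)) (ae_filter lborel) \<noteq> bot"
proof
  assume "inf (at_right (0::real)) (ae_filter lborel) = bot"
  then obtain Q R where Q: "eventually Q (at_right (0::real))" and R: "AE t in lborel. R t"
    and no: "\<And>t. Q t \<Longrightarrow> R t \<Longrightarrow> False"
    unfolding trivial_limit_def eventually_inf by blast
  obtain b :: real where b: "0 < b" "\<And>t. 0 < t \<Longrightarrow> t < b \<Longrightarrow> Q t"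
    using Q by (auto simp: eventually_at_right_field)
  have "AE t in lborel. t \<notin> {0<..<b}" using R by eventually_elim (use b no in auto)
  then have "{0<..<b} \<in> null_sets lborel" by (subst (asm) AE_iff_null_sets[symmetric]) auto
  then show False using b(1) by (simp add: null_sets_def)
qed

section \<open>From solutions of the delay equations to the block diagram\<close>

context ddae_system
begin

lemma sum_abv_U_square:
  "(\<Sum>j<2 * n + m. (abv (U x y) j t)\<^sup>2) = ennreal (indicator {- r..} t * ((vnorm n (x t))\<^sup>2 + (vnorm m (y t))\<^sup>2))"
  by (subst sum_blocks)
    (auto simp: abv_def U_def indicator_def vnorm_square ennreal_power sum_nonneg simp flip: ennreal_plus)

lemma measurable_init:
  assumes "(\<phi>, \<xi>, \<psi>) \<in> product_space r n m" shows "init \<xi> \<psi> j \<in> borel_measurable borel"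
proof -
  have x: "(\<lambda>t. indicator {- r..0} t *\<^sub>R \<xi> t i) \<in> borel_measurable borel" if "i < n" for i
    using assms that by (auto simp: product_space_def L2_on_def set_borel_measurable_def)
  have y: "(\<lambda>t. indicator {- r..0} t *\<^sub>R \<psi> t i) \<in> borel_measurable borel" if "i < m" for i
    using assms that by (auto simp: product_space_def L2_on_def set_borel_measurable_def)
  consider "j < n" | "2 * n \<le> j" "j < 2 * n + m" | "n \<le> j" "\<not> (2 * n \<le> j \<and> j < 2 * n + m)" by linarith
  then show ?thesis
  proof cases
    case 1
    then have "init \<xi> \<psi> j = (\<lambda>t. indicator {- r..0} t *\<^sub>R \<xi> t j)"
      by (auto simp: init_def U_def indicator_def)
    then show ?thesis using x[OF 1] by simp
  next
    case 2
    then have "init \<xi> \<psi> j = (\<lambda>t. indicator {- r..0} t *\<^sub>R \<psi> t (j - 2 * n))"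
      by (auto simp: init_def U_def indicator_def)
    then show ?thesis using y[of "j - 2 * n"] 2 by simp
  next
    case 3
    then have "init \<xi> \<psi> j = (\<lambda>t. 0)" by (auto simp: init_def U_def)
    then show ?thesis by simp
  qed
qed

text \<open>The norm is spread over the components of the block vector, the form in which it
  compares with the energies; the derivative block contributes 0.\<close>

lemma product_norm_square:
  assumes D: "(\<phi>, \<xi>, \<psi>) \<in> product_space r n m"
  shows "ennreal ((product_norm r n m (\<phi>, \<xi>, \<psi>))\<^sup>2) =
    ennreal ((vnorm n \<phi>)\<^sup>2) + (\<Sum>j<2 * n + m. \<integral>\<^sup>+t. (abv (init \<xi> \<psi>) j t)\<^sup>2 \<partial>lborel)"
proof -
  let ?f = "\<lambda>t. indicator {- r..0} t *\<^sub>R ((vnorm n (\<xi> t))\<^sup>2 + (vnorm m (\<psi> t))\<^sup>2)"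
  have [measurable]: "abv (init \<xi> \<psi>) j \<in> borel_measurable borel" for j
    by (intro measurable_abv measurable_init[OF D])
  have "integrable lborel (\<lambda>t. (\<Sum>i<n. indicator {- r..0} t *\<^sub>R (cmod (\<xi> t i))\<^sup>2) +
      (\<Sum>i<m. indicator {- r..0} t *\<^sub>R (cmod (\<psi> t i))\<^sup>2))"
    using D by (intro Bochner_Integration.integrable_add Bochner_Integration.integrable_sum)
      (auto simp: product_space_def L2_on_def set_integrable_def)
  then have int: "integrable lborel ?f"
    by (simp add: vnorm_square sum_distrib_left distrib_left)
  have nn: "0 \<le> ?f t" for t by (simp add: indicator_def)
  have "(\<Sum>j<2 * n + m. \<integral>\<^sup>+t. (abv (init \<xi> \<psi>) j t)\<^sup>2 \<partial>lborel) = (\<integral>\<^sup>+t. (\<Sum>j<2 * n + m. (abv (init \<xi> \<psi>) j t)\<^sup>2) \<partial>lborel)"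
    by (intro nn_integral_sum[symmetric]) simp
  also have "\<dots> = (\<integral>\<^sup>+t. ennreal (?f t) \<partial>lborel)"
  proof (rule nn_integral_cong)
    fix t
    show "(\<Sum>j<2 * n + m. (abv (init \<xi> \<psi>) j t)\<^sup>2) = ennreal (?f t)"
    proof (cases "t \<le> 0")
      case True
      then have "(\<Sum>j<2 * n + m. (abv (init \<xi> \<psi>) j t)\<^sup>2) = (\<Sum>j<2 * n + m. (abv (U \<xi> \<psi>) j t)\<^sup>2)"
        by (simp add: abv_def init_def)
      then show ?thesis using True unfolding sum_abv_U_square by (simp add: indicator_def)
    qed (simp add: abv_def init_def)
  qed
  also have "\<dots> = ennreal (integral\<^sup>L lborel ?f)"
    by (intro nn_integral_eq_integral int) (use nn in auto)
  finally have e: "(\<Sum>j<2 * n + m. \<integral>\<^sup>+t. (abv (init \<xi> \<psi>) j t)\<^sup>2 \<partial>lborel) = ennreal (integral\<^sup>L lborel ?f)" .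
  have "0 \<le> integral\<^sup>L lborel ?f" by (intro integral_nonneg_AE AE_I2 nn)
  then show ?thesis
    unfolding e by (simp add: product_norm_def set_lebesgue_integral_def flip: ennreal_plus)
qed

lemma init_square_finite:
  assumes "(\<phi>, \<xi>, \<psi>) \<in> product_space r n m" "j < 2 * n + m"
  shows "(\<integral>\<^sup>+t. (abv (init \<xi> \<psi>) j t)\<^sup>2 \<partial>lborel) < \<infinity>"
proof -
  have "(\<Sum>j<2 * n + m. \<integral>\<^sup>+t. (abv (init \<xi> \<psi>) j t)\<^sup>2 \<partial>lborel) \<le> ennreal ((product_norm r n m (\<phi>, \<xi>, \<psi>))\<^sup>2)"
    unfolding product_norm_square[OF assms(1)] by simp
  also have "\<dots> < \<infinity>" by simp
  finally show ?thesis using assms(2) by (auto simp: ennreal_sum_less_top)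
qed

lemma locint_init:
  assumes D: "(\<phi>, \<xi>, \<psi>) \<in> product_space r n m" shows "locint (abv (init \<xi> \<psi>))"
proof (rule locint_if_square)
  show "abv (init \<xi> \<psi>) j \<in> borel_measurable borel" for j by (intro measurable_abv measurable_init[OF D])
  show "abv (init \<xi> \<psi>) j t = 0" if "t < - r" for j t using that by (simp add: abv_def init_def U_def)
  fix b j assume j: "j < 2 * n + m"
  have "(\<integral>\<^sup>+t. (abv (init \<xi> \<psi>) j t)\<^sup>2 * indicator {..b} t \<partial>lborel) \<le> (\<integral>\<^sup>+t. (abv (init \<xi> \<psi>) j t)\<^sup>2 \<partial>lborel)"
    by (intro nn_integral_mono) (auto simp: indicator_def)
  then show "(\<integral>\<^sup>+t. (abv (init \<xi> \<psi>) j t)\<^sup>2 * indicator {..b} t \<partial>lborel) < \<infinity>"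
    using init_square_finite[OF D j] by (rule le_less_trans)
qed

lemma measurable_source:
  assumes D: "(\<phi>, \<xi>, \<psi>) \<in> product_space r n m" shows "source \<phi> \<xi> \<psi> i \<in> borel_measurable borel"
proof -
  have [measurable]: "T (init \<xi> \<psi>) i \<in> borel_measurable borel" by (intro measurable_T measurable_init[OF D])
  show ?thesis unfolding source_def[abs_def] by measurable
qed

lemma T_zero_past: "(\<And>j t. t \<le> 0 \<Longrightarrow> z j t = 0) \<Longrightarrow> (\<And>j. z j \<in> borel_measurable borel) \<Longrightarrow> t \<le> 0 \<Longrightarrow> T z i t = 0"
  using T_cong_past[of z "\<lambda>_ _. 0" t i] by (simp add: T_def)

lemma solution_U_split:
  assumes "ddae_solution r n m A B C D (\<phi>, \<xi>, \<psi>) x y"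
  shows "AE t in lborel. \<forall>j<2 * n + m. j < n \<or> 2 * n \<le> j \<longrightarrow> U x y j t = init \<xi> \<psi> j t + diagram x y j t"
proof -
  have "AE t in lborel. t \<in> {-r..0} \<longrightarrow> (\<forall>i<n. x t i = \<xi> t i)" "AE t in lborel. t \<in> {-r..0} \<longrightarrow> (\<forall>i<m. y t i = \<psi> t i)"
    using assms by (auto simp: ddae_solution_def ae_eq_on_def segment_def)
  then show ?thesis
    by eventually_elim (auto simp: init_def diagram_def U_def)
qed

text \<open>It concerns an arbitrary solution, and so yields both uniqueness and the estimate. The
  derivative rows hold by the definition of \<open>diagram\<close> and the y rows by the second
  equation, once \<open>T_split\<close> has moved the past into \<open>source\<close>; the x rows
  require the constant of integration to be identified.\<close>

lemma solution_diagram: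
  assumes D: "(\<phi>, \<xi>, \<psi>) \<in> product_space r n m" and sol: "ddae_solution r n m A B C D (\<phi>, \<xi>, \<psi>) x y"
  shows "diagram x y j \<in> borel_measurable borel" "locint (abv (diagram x y))"
    "AE t in lborel. \<forall>i<2 * n + m. diagram x y i t = source \<phi> \<xi> \<psi> i t + T (diagram x y) i t"
proof -
  have xy: "locally_L1 r n x" "locally_L1 r m y" using sol by (auto simp: ddae_solution_def)
  note mU = measurable_U[OF xy] and lU = locint_U[OF xy]
  show mz: "diagram x y j \<in> borel_measurable borel" for j
  proof -
    have [measurable]: "U x y j \<in> borel_measurable borel" "T (U x y) j \<in> borel_measurable borel"
      by (intro mU measurable_T)+
    show ?thesis unfolding diagram_def[abs_def] by measurable
  qed
  have "abv (diagram x y) j t \<le> abv (U x y) j t + P (abv (U x y)) j t" for j t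
  proof -
    have "ennreal (cmod (T (U x y) j t)) \<le> abv (U x y) j t + P (abv (U x y)) j t"
      using T_le_P[of "U x y" j t] by (metis add_increasing zero_le)
    then show ?thesis by (simp add: abv_def diagram_def)
  qed
  then show li: "locint (abv (diagram x y))"
    by (intro locint_mono[OF locint_add[OF lU locint_P[OF lU]] measurable_abv[OF mz]]) simp
  have zero: "diagram x y j t = 0" if "t \<le> 0" for j t using that by (simp add: diagram_def)
  have split: "AE t in lborel. \<forall>i<2 * n + m. n \<le> i \<longrightarrow> T (U x y) i t = T (init \<xi> \<psi>) i t + T (diagram x y) i t"
    by (rule T_split[OF mU measurable_init[OF D] mz locint_init[OF D] li solution_U_split[OF sol]])
  obtain f where f: "AE t in lborel. 0 < t \<longrightarrow>
      (\<forall>i<n. x t i = fun_conv heaviside (delay_conv r n A x i) t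
                    + fun_conv heaviside (delay_conv r m B y i) t + f i) \<and>
      (\<forall>i<m. y t i = delay_conv r n C x i t + delay_conv r m D y i t)"
    using sol by (auto simp: ddae_solution_def)
  have x: "AE t in lborel. 0 < t \<longrightarrow> x t i = \<phi> i + T (diagram x y) i t" if i: "i < n" for i
  proof -
    have "AE t in lborel. 0 < t \<longrightarrow> diagram x y (n + i) t = T (U x y) (n + i) t"
      using i by (simp add: diagram_def)
    then obtain c where c: "\<And>t. 0 < t \<Longrightarrow> fun_conv heaviside (delay_conv r n A x i) t +
        fun_conv heaviside (delay_conv r m B y i) t = c + T (diagram x y) i t"
      using integral_form[where z = "diagram x y", OF xy i mz zero] by blast
    have x: "AE t in lborel. 0 < t \<longrightarrow> x t i = c + T (diagram x y) i t + f i"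
      using f by eventually_elim (use c i in auto)
    let ?F = "inf (at_right 0) (ae_filter lborel) :: real filter"
    have "continuous_on {0..} (T (diagram x y) i)" "T (diagram x y) i 0 = 0"
      using continuous_T_x[where z = "diagram x y", OF i mz zero li] by simp_all
    then have "(T (diagram x y) i \<longlongrightarrow> 0) (at 0 within {0..})"
      by (metis atLeast_iff continuous_on_def order_refl)
    then have "(T (diagram x y) i \<longlongrightarrow> 0) (at_right 0)"
      by (rule tendsto_within_subset) auto
    then have "(T (diagram x y) i \<longlongrightarrow> 0) ?F" by (rule tendsto_mono[rotated]) simp
    then have 1: "((\<lambda>t. c + T (diagram x y) i t + f i) \<longlongrightarrow> c + 0 + f i) ?F" by (intro tendsto_intros)
    have "eventually (\<lambda>t. x t i = c + T (diagram x y) i t + f i) ?F"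
      unfolding eventually_inf using x eventually_at_right_less[of "0::real"] by blast
    then have "((\<lambda>t. x t i) \<longlongrightarrow> c + 0 + f i) ?F" using 1 by (simp cong: tendsto_cong)
    moreover have "((\<lambda>t. x t i) \<longlongrightarrow> \<phi> i) ?F" using sol i by (auto simp: ddae_solution_def)
    \<comment> \<open>\<open>T (diagram x y) i\<close> tends to 0 at 0 from the right, so
      \<open>x\<close> has the limit \<open>c + f i\<close>; comparison with the initial condition
      eliminates both unknown constants.\<close>
    ultimately have "\<phi> i = c + f i"
      using tendsto_unique[OF at_right_ae_filter] by fastforce
    then show ?thesis using x by (simp add: algebra_simps)
  qed
  then have "AE t in lborel. \<forall>i\<in>{..<n}. 0 < t \<longrightarrow> x t i = \<phi> i + T (diagram x y) i t"
    by (intro AE_finite_allI) auto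
  then show "AE t in lborel. \<forall>i<2 * n + m. diagram x y i t = source \<phi> \<xi> \<psi> i t + T (diagram x y) i t"
    using split f
  proof eventually_elim
    case (elim t)
    show ?case
    proof (intro allI impI)
      fix i assume i: "i < 2 * n + m"
      consider "t \<le> 0" | "0 < t" "i < n" | "0 < t" "n \<le> i" "i < 2 * n" | "0 < t" "2 * n \<le> i" by linarith
      then show "diagram x y i t = source \<phi> \<xi> \<psi> i t + T (diagram x y) i t"
      proof cases
        case 1
        then have "T (diagram x y) i t = 0" by (intro T_zero_past mz zero)
        then show ?thesis using 1 by (simp add: diagram_def source_def)
      next
        case 2
        then show ?thesis using elim(1) r by (simp add: diagram_def source_def U_def)
      next
        case 3
        then show ?thesis using elim(2) i by (simp add: diagram_def source_def)
      next
        case 4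
        have "diagram x y i t = y t (i - 2 * n)" using 4 i r by (simp add: diagram_def U_def)
        also have "\<dots> = T (U x y) i t" using elim(3) 4 i delay_conv_y[of "i - 2 * n" x t y] by simp
        finally show ?thesis using elim(2) 4 i by (simp add: source_def)
      qed
    qed
  qed
qed

text \<open>In the integrator rows, \<open>1 \<le> l\<close> bounds the integral of the weight over
  positive times by that of \<open>exp (- t)\<close>, which is 1. In the other rows
  \<open>energy2_P\<close> applies to the past, on which the weight is at most
  \<open>exp (2 * l * r)\<close>. The constant combines this factor with the sum of all
  \<open>w i\<close>.\<close>

lemma energy2_source:
  assumes D: "(\<phi>, \<xi>, \<psi>) \<in> product_space r n m"
  shows "energy2 (abv (source \<phi> \<xi> \<psi>)) \<le>
    2 * ((\<Sum>i<2 * n + m. ennreal (w i)) * ennreal (exp (2 * l * r))) * ennreal ((product_norm r n m (\<phi>, \<xi>, \<psi>))\<^sup>2)"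
proof -
  let ?W = "(\<Sum>i<2 * n + m. ennreal (w i)) * ennreal (exp (2 * l * r))"
  let ?J = "\<Sum>j<2 * n + m. \<integral>\<^sup>+t. (abv (init \<xi> \<psi>) j t)\<^sup>2 \<partial>lborel"
  define F :: "nat \<Rightarrow> real \<Rightarrow> ennreal" where "F = (\<lambda>i t. if 0 < t \<and> i < n then ennreal (cmod (\<phi> i)) else 0)"
  have mF: "F j \<in> borel_measurable borel" for j unfolding F_def by measurable
  have mI: "abv (init \<xi> \<psi>) j \<in> borel_measurable borel" for j by (intro measurable_abv measurable_init[OF D])
  have mP: "P (abv (init \<xi> \<psi>)) j \<in> borel_measurable borel" for j by (intro measurable_P mI)
  have e1: "ennreal 1 \<le> ennreal (exp (2 * l * r))" using l r by (intro ennreal_leI) simp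
  have W: "ennreal (w i) \<le> (\<Sum>i<2 * n + m. ennreal (w i))" if "i < 2 * n + m" for i
    by (rule member_le_sum) (use that in auto)
  have W1: "ennreal (w i) \<le> ?W" if "i < 2 * n + m" for i
    using mult_mono[OF W[OF that] e1] by simp
  have "abv (source \<phi> \<xi> \<psi>) j t \<le> F j t + P (abv (init \<xi> \<psi>)) j t" for j t
  proof -
    have "ennreal (cmod (T (init \<xi> \<psi>) j t)) \<le> F j t + P (abv (init \<xi> \<psi>)) j t"
      using T_le_P[of "init \<xi> \<psi>" j t] by (metis add_increasing zero_le)
    then show ?thesis by (auto simp: abv_def source_def F_def)
  qed
  then have "energy2 (abv (source \<phi> \<xi> \<psi>)) \<le> energy2 (\<lambda>j t. F j t + P (abv (init \<xi> \<psi>)) j t)"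
    by (rule energy2_mono)
  also have "\<dots> \<le> 2 * energy2 F + 2 * energy2 (P (abv (init \<xi> \<psi>)))" by (intro energy2_add mF mP)
  also have "\<dots> \<le> 2 * (?W * ennreal ((vnorm n \<phi>)\<^sup>2)) + 2 * (?W * ?J)"
  proof (intro add_mono mult_left_mono)
    have int: "(\<integral>\<^sup>+t. ennreal (exp (- (2 * l) * t)) * (F i t)\<^sup>2 \<partial>lborel) \<le> (if i < n then ennreal ((cmod (\<phi> i))\<^sup>2) else 0)" for i
    proof (cases "i < n")
      case True
      have "(\<integral>\<^sup>+t. ennreal (exp (- (2 * l) * t)) * (F i t)\<^sup>2 \<partial>lborel) \<le>
          (\<integral>\<^sup>+t. ennreal ((cmod (\<phi> i))\<^sup>2) * (ennreal (exp (- t)) * indicator {0..} t) \<partial>lborel)"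
      proof (rule nn_integral_mono)
        fix t show "ennreal (exp (- (2 * l) * t)) * (F i t)\<^sup>2 \<le>
            ennreal ((cmod (\<phi> i))\<^sup>2) * (ennreal (exp (- t)) * indicator {0..} t)"
        proof (cases "0 < t")
          case t: True
          have "ennreal (exp (- (2 * l) * t)) \<le> ennreal (exp (- t))"
            using l t by (intro ennreal_leI) simp
          then have "ennreal (exp (- (2 * l) * t)) * (F i t)\<^sup>2 \<le> ennreal (exp (- t)) * (F i t)\<^sup>2"
            by (rule mult_right_mono) simp
          then show ?thesis using t True by (simp add: F_def ennreal_power mult.commute)
        qed (simp add: F_def)
      qed
      also have "\<dots> = ennreal ((cmod (\<phi> i))\<^sup>2)"
        by (subst nn_integral_cmult) (simp_all add: nn_integral_exp_Ici)
      finally show ?thesis using True by simp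
    qed (simp add: F_def)
    have "energy2 F \<le> (\<Sum>i<2 * n + m. ?W * (if i < n then ennreal ((cmod (\<phi> i))\<^sup>2) else 0))"
      unfolding energy2_def by (intro sum_mono mult_mono W1 int) auto
    also have "\<dots> = ?W * (\<Sum>i<2 * n + m. if i < n then ennreal ((cmod (\<phi> i))\<^sup>2) else 0)"
      by (simp add: sum_distrib_left)
    also have "(\<Sum>i<2 * n + m. if i < n then ennreal ((cmod (\<phi> i))\<^sup>2) else 0) = ennreal ((vnorm n \<phi>)\<^sup>2)"
      by (subst sum_blocks) (auto simp: vnorm_square)
    finally show "energy2 F \<le> ?W * ennreal ((vnorm n \<phi>)\<^sup>2)" .
    have "energy2 (abv (init \<xi> \<psi>)) \<le> (\<Sum>i<2 * n + m. (\<Sum>i<2 * n + m. ennreal (w i)) *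
        (ennreal (exp (2 * l * r)) * (\<integral>\<^sup>+t. (abv (init \<xi> \<psi>) i t)\<^sup>2 \<partial>lborel)))"
      unfolding energy2_def
    proof (intro sum_mono mult_mono W)
      fix i
      have "(\<integral>\<^sup>+t. ennreal (exp (- (2 * l) * t)) * (abv (init \<xi> \<psi>) i t)\<^sup>2 \<partial>lborel) \<le>
          (\<integral>\<^sup>+t. ennreal (exp (2 * l * r)) * (abv (init \<xi> \<psi>) i t)\<^sup>2 \<partial>lborel)"
      proof (rule nn_integral_mono)
        fix t show "ennreal (exp (- (2 * l) * t)) * (abv (init \<xi> \<psi>) i t)\<^sup>2 \<le>
            ennreal (exp (2 * l * r)) * (abv (init \<xi> \<psi>) i t)\<^sup>2"
        proof (cases "- r \<le> t")
          case True
          then have "0 \<le> 2 * l * (r + t)" using l by simp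
          then show ?thesis by (intro mult_right_mono ennreal_leI) (simp_all add: algebra_simps)
        qed (simp add: abv_def init_def U_def)
      qed
      also have "\<dots> = ennreal (exp (2 * l * r)) * (\<integral>\<^sup>+t. (abv (init \<xi> \<psi>) i t)\<^sup>2 \<partial>lborel)"
        using mI[of i] by (intro nn_integral_cmult) simp
      finally show "(\<integral>\<^sup>+t. ennreal (exp (- (2 * l) * t)) * (abv (init \<xi> \<psi>) i t)\<^sup>2 \<partial>lborel) \<le>
          ennreal (exp (2 * l * r)) * (\<integral>\<^sup>+t. (abv (init \<xi> \<psi>) i t)\<^sup>2 \<partial>lborel)" .
    qed auto
    also have "\<dots> = ?W * ?J" by (simp only: sum_distrib_left mult.assoc)
    finally have E: "energy2 (abv (init \<xi> \<psi>)) \<le> ?W * ?J" .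
    have "energy2 (P (abv (init \<xi> \<psi>))) \<le> ennreal (1 / 4) * energy2 (abv (init \<xi> \<psi>))" by (rule energy2_P[OF mI])
    also have "\<dots> \<le> ennreal 1 * (?W * ?J)" by (intro mult_mono E ennreal_leI) auto
    finally show "energy2 (P (abv (init \<xi> \<psi>))) \<le> ?W * ?J" by simp
  qed auto
  also have "\<dots> = 2 * ?W * ennreal ((product_norm r n m (\<phi>, \<xi>, \<psi>))\<^sup>2)"
    unfolding product_norm_square[OF D] by (simp only: distrib_left mult.assoc)
  finally show ?thesis .
qed

lemma energy2_cong_AE:
  "AE t in lborel. \<forall>j<2 * n + m. u j t = v j t \<Longrightarrow> energy2 u = energy2 v"
  unfolding energy2_def by (intro sum.cong refl arg_cong2[of _ _ _ _ "(*)"] nn_integral_cong_AE)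
    (auto elim!: eventually_mono)

text \<open>The factor 8 is 4 times 2: the 4 comes from the Neumann series, the 2 from splitting the
  source into the contributions of \<phi> and of the past.\<close>

definition gain :: ennreal where
  "gain = 8 * ((\<Sum>i<2 * n + m. ennreal (w i)) * ennreal (exp (2 * l * r)))"

lemma gain_finite: "gain < \<infinity>"
  by (simp add: gain_def ennreal_mult_less_top ennreal_sum_less_top)

section \<open>From the block diagram to solutions of the delay equations\<close>

lemma diagram_solution_exists:
  assumes D: "(\<phi>, \<xi>, \<psi>) \<in> product_space r n m"
  obtains z where "\<And>j. z j \<in> borel_measurable borel" "\<And>j t. t \<le> 0 \<Longrightarrow> z j t = 0"
    "AE t in lborel. \<forall>i<2 * n + m. z i t = source \<phi> \<xi> \<psi> i t + T z i t" "locint (abv z)"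
    "energy2 (abv z) \<le> gain * ennreal ((product_norm r n m (\<phi>, \<xi>, \<psi>))\<^sup>2)"
proof -
  let ?g = "source \<phi> \<xi> \<psi>" and ?Q = "ennreal ((product_norm r n m (\<phi>, \<xi>, \<psi>))\<^sup>2)"
  let ?W = "(\<Sum>i<2 * n + m. ennreal (w i)) * ennreal (exp (2 * l * r))"
  have g: "energy2 (abv ?g) \<le> 2 * ?W * ?Q" by (rule energy2_source[OF D])
  also have "\<dots> < \<infinity>" by (simp add: ennreal_mult_less_top ennreal_sum_less_top)
  finally have fin: "energy2 (abv ?g) < \<infinity>" .
  obtain z where z: "\<And>j. z j \<in> borel_measurable borel" "\<And>j t. t \<le> 0 \<Longrightarrow> z j t = 0"
    "AE t in lborel. \<forall>i<2 * n + m. z i t = ?g i t + T z i t" "energy2 (abv z) \<le> 4 * energy2 (abv ?g)"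
    by (rule solution_exists[OF measurable_source[OF D] fin]) (auto simp: source_def)
  have "4 * energy2 (abv ?g) \<le> 4 * (2 * ?W * ?Q)" by (intro mult_left_mono g) simp
  also have "\<dots> = (4 * 2) * ?W * ?Q" by (simp only: mult.assoc)
  also have "(4 * 2 :: ennreal) = 8" by simp
  finally have E: "energy2 (abv z) \<le> gain * ?Q" using z(4) by (simp add: gain_def mult.assoc)
  then have "energy2 (abv z) < \<infinity>" using gain_finite by (auto simp: ennreal_mult_less_top intro: le_less_trans)
  then have "locint (abv z)"
    by (rule locint_if_energy2[where a = 0, OF measurable_abv[OF z(1)], rotated]) (simp add: abv_def z(2))
  then show ?thesis using z E that by blast
qed

text \<open>Data on \<open>[-r, 0]\<close> are glued to a function on positive times. Square
  integrability is known for \<open>z\<close>, while x is built from the continuous function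
  \<open>k\<close>, which agrees with \<open>z\<close> almost everywhere.\<close>

lemma L2_on_if_pieces:
  assumes h: "(\<lambda>t. indicator {- r..0} t *\<^sub>R h t i) \<in> borel_measurable borel"
    and k: "k i \<in> borel_measurable borel"
    and z: "AE t in lborel. 0 < t \<longrightarrow> k i t = z i t"
    and fin: "(\<integral>\<^sup>+t. (abv z i t)\<^sup>2 * indicator {..b} t \<partial>lborel) < \<infinity>" "z i \<in> borel_measurable borel"
    and fh: "set_integrable lborel {- r..0} (\<lambda>t. (cmod (h t i))\<^sup>2)"
  shows "set_borel_measurable lborel {- r..b} (\<lambda>t. if t \<le> 0 then h t i else k i t)"
    "set_integrable lborel {- r..b} (\<lambda>t. (cmod (if t \<le> 0 then h t i else k i t))\<^sup>2)"
proof -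
  let ?f = "\<lambda>t. if t \<le> 0 then h t i else k i t"
  have eq: "indicator {- r..b} t *\<^sub>R ?f t =
      indicator {..b} t *\<^sub>R (indicator {- r..0} t *\<^sub>R h t i) + indicator {max (- r) 0<..b} t *\<^sub>R k i t" for t
    using r by (auto simp: indicator_def)
  have "(\<lambda>t. indicator {..b} t *\<^sub>R (indicator {- r..0} t *\<^sub>R h t i) + indicator {max (- r) 0<..b} t *\<^sub>R k i t)
      \<in> borel_measurable borel"
    by (intro borel_measurable_add borel_measurable_scaleR h k borel_measurable_indicator) auto
  then show m: "set_borel_measurable lborel {- r..b} ?f"
    unfolding set_borel_measurable_def eq by simp
  have sq: "indicator {- r..b} t *\<^sub>R (cmod (?f t))\<^sup>2 = (cmod (indicator {- r..b} t *\<^sub>R ?f t))\<^sup>2" for t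
    by (simp add: indicator_def)
  show "set_integrable lborel {- r..b} (\<lambda>t. (cmod (?f t))\<^sup>2)"
    unfolding set_integrable_def
  proof (rule integrableI_bounded)
    show "(\<lambda>t. indicator {- r..b} t *\<^sub>R (cmod (?f t))\<^sup>2) \<in> borel_measurable lborel"
      using m unfolding sq set_borel_measurable_def by measurable
    have "(\<integral>\<^sup>+t. norm (indicator {- r..b} t *\<^sub>R (cmod (?f t))\<^sup>2) \<partial>lborel) \<le>
        (\<integral>\<^sup>+t. norm (indicator {- r..0} t *\<^sub>R (cmod (h t i))\<^sup>2) + (abv z i t)\<^sup>2 * indicator {..b} t \<partial>lborel)"
      by (rule nn_integral_mono_AE, use z in eventually_elim) (auto simp: indicator_def abv_def ennreal_power)
    also have "\<dots> = (\<integral>\<^sup>+t. norm (indicator {- r..0} t *\<^sub>R (cmod (h t i))\<^sup>2) \<partial>lborel) +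
        (\<integral>\<^sup>+t. (abv z i t)\<^sup>2 * indicator {..b} t \<partial>lborel)"
      using fh fin(2) unfolding abv_def
      by (intro nn_integral_add) (auto simp: set_integrable_def dest: borel_measurable_integrable)
    also have "\<dots> < \<infinity>" using fh fin(1) by (simp add: set_integrable_def integrable_iff_bounded)
    finally show "(\<integral>\<^sup>+t. norm (indicator {- r..b} t *\<^sub>R (cmod (?f t))\<^sup>2) \<partial>lborel) < \<infinity>" .
  qed
qed

lemma solution_from_diagram:
  assumes D: "(\<phi>, \<xi>, \<psi>) \<in> product_space r n m"
  obtains x y where "ddae_solution r n m A B C D (\<phi>, \<xi>, \<psi>) x y" "locally_L2 r n x" "locally_L2 r m y"
    "\<And>i. i < n \<Longrightarrow> continuous_on {0<..} (\<lambda>t. x t i)" "\<And>i. i < n \<Longrightarrow> ((\<lambda>t. x t i) \<longlongrightarrow> \<phi> i) (at_right 0)"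
proof -
  obtain z where mz: "\<And>j. z j \<in> borel_measurable borel" and zero: "\<And>j t. t \<le> 0 \<Longrightarrow> z j t = 0"
    and eq: "AE t in lborel. \<forall>i<2 * n + m. z i t = source \<phi> \<xi> \<psi> i t + T z i t" and li: "locint (abv z)"
    and E: "energy2 (abv z) \<le> gain * ennreal ((product_norm r n m (\<phi>, \<xi>, \<psi>))\<^sup>2)"
    using diagram_solution_exists[OF D] by blast
  \<comment> \<open>\<open>z i\<close> satisfies its equation almost everywhere only; the right-hand
    side \<open>\<phi> i + T z i\<close> is chosen as representative because it is
    continuous.\<close>
  define x where "x t i = (if t \<le> 0 then \<xi> t i else \<phi> i + T z i t)" for t i
  define y where "y t i = (if t \<le> 0 then \<psi> t i else z (2 * n + i) t)" for t i
  have sq: "(\<integral>\<^sup>+t. (abv z i t)\<^sup>2 * indicator {..b} t \<partial>lborel) < \<infinity>" if "i < 2 * n + m" for i b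
  proof -
    have "(\<integral>\<^sup>+t. (abv z i t)\<^sup>2 * indicator {..b} t \<partial>lborel) \<le> ennreal (exp (2 * l * b) / w i) * energy2 (abv z)"
      by (intro square_integral_le_energy2 measurable_abv mz that)
    also have "\<dots> < \<infinity>" using E gain_finite by (auto simp: ennreal_mult_less_top intro: le_less_trans)
    finally show ?thesis .
  qed
  have zx: "AE t in lborel. \<forall>i<n. 0 < t \<longrightarrow> \<phi> i + T z i t = z i t"
    using eq by eventually_elim (auto simp: source_def)
  have x2: "locally_L2 r n x"
    unfolding locally_L2_def L2_on_def
  proof (intro allI impI)
    fix b i assume i: "i < n"
    have "(\<lambda>t. indicator {- r..0} t *\<^sub>R \<xi> t i) \<in> borel_measurable borel"
      "set_integrable lborel {- r..0} (\<lambda>t. (cmod (\<xi> t i))\<^sup>2)"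
      using D i by (auto simp: product_space_def L2_on_def set_borel_measurable_def)
    moreover have "(\<lambda>t. \<phi> i + T z i t) \<in> borel_measurable borel"
      by (intro borel_measurable_add borel_measurable_const measurable_T mz)
    moreover have "AE t in lborel. 0 < t \<longrightarrow> \<phi> i + T z i t = z i t"
      using zx by eventually_elim (use i in auto)
    ultimately show "set_borel_measurable lborel {- r..b} (\<lambda>t. x t i) \<and>
        set_integrable lborel {- r..b} (\<lambda>t. (cmod (x t i))\<^sup>2)"
      using L2_on_if_pieces[of \<xi> i "\<lambda>i t. \<phi> i + T z i t" z b] sq[of i b] mz[of i] i by (simp add: x_def)
  qed
  have y2: "locally_L2 r m y"
    unfolding locally_L2_def L2_on_def
  proof (intro allI impI)
    fix b i assume i: "i < m"
    have "(\<lambda>t. indicator {- r..0} t *\<^sub>R \<psi> t i) \<in> borel_measurable borel"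
      "set_integrable lborel {- r..0} (\<lambda>t. (cmod (\<psi> t i))\<^sup>2)"
      using D i by (auto simp: product_space_def L2_on_def set_borel_measurable_def)
    moreover have "(\<integral>\<^sup>+t. (abv (\<lambda>i. z (2 * n + i)) i t)\<^sup>2 * indicator {..b} t \<partial>lborel) < \<infinity>"
      using sq[of "2 * n + i" b] i by (simp add: abv_def)
    ultimately show "set_borel_measurable lborel {- r..b} (\<lambda>t. y t i) \<and>
        set_integrable lborel {- r..b} (\<lambda>t. (cmod (y t i))\<^sup>2)"
      using L2_on_if_pieces[of \<psi> i "\<lambda>i. z (2 * n + i)" "\<lambda>i. z (2 * n + i)" b] mz[of "2 * n + i"]
      by (simp add: y_def)
  qed
  note xy = locally_L1_if_L2[OF x2] locally_L1_if_L2[OF y2]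
  have "AE t in lborel. \<forall>j<2 * n + m. j < n \<or> 2 * n \<le> j \<longrightarrow> U x y j t = init \<xi> \<psi> j t + z j t"
    using zx by eventually_elim (use r in \<open>auto simp: U_def init_def x_def y_def zero not_le\<close>)
  then have split: "AE t in lborel. \<forall>i<2 * n + m. n \<le> i \<longrightarrow> T (U x y) i t = T (init \<xi> \<psi>) i t + T z i t"
    by (intro T_split measurable_U[OF xy] measurable_init[OF D] mz locint_init[OF D] li)
  have v: "AE t in lborel. \<forall>i<2 * n + m. n \<le> i \<longrightarrow> 0 < t \<longrightarrow> z i t = T (U x y) i t"
    using split eq by eventually_elim (auto simp: source_def)
  have "\<exists>c. \<forall>t>0. fun_conv heaviside (delay_conv r n A x i) t +
      fun_conv heaviside (delay_conv r m B y i) t = c + T z i t" if i: "i < n" for i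
  proof -
    have "AE t in lborel. 0 < t \<longrightarrow> z (n + i) t = T (U x y) (n + i) t"
      using v by eventually_elim (use i in auto)
    then show ?thesis using integral_form[where z = z, OF xy i mz zero] by metis
  qed
  then obtain c where c: "\<And>i t. i < n \<Longrightarrow> 0 < t \<Longrightarrow> fun_conv heaviside (delay_conv r n A x i) t +
      fun_conv heaviside (delay_conv r m B y i) t = c i + T z i t"
    by metis
  have cont: "continuous_on {0<..} (\<lambda>t. x t i)" "((\<lambda>t. x t i) \<longlongrightarrow> \<phi> i) (at_right 0)" if i: "i < n" for i
  proof -
    have T: "continuous_on {0..} (T z i)" "T z i 0 = 0"
      using continuous_T_x[where z = z, OF i mz zero li] by simp_all
    have "continuous_on {0<..} (\<lambda>t. \<phi> i + T z i t)"
      by (intro continuous_intros continuous_on_subset[OF T(1)]) auto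
    then show "continuous_on {0<..} (\<lambda>t. x t i)" by (rule continuous_on_eq) (simp add: x_def)
    have "(T z i \<longlongrightarrow> 0) (at 0 within {0..})"
      using T by (metis atLeast_iff continuous_on_def order_refl)
    then have "(T z i \<longlongrightarrow> 0) (at_right 0)" by (rule tendsto_within_subset) auto
    then have "((\<lambda>t. \<phi> i + T z i t) \<longlongrightarrow> \<phi> i + 0) (at_right 0)" by (intro tendsto_intros)
    moreover have "eventually (\<lambda>t. \<phi> i + T z i t = x t i) (at_right 0)"
      using eventually_at_right_less[of "0::real"] by eventually_elim (simp add: x_def)
    ultimately show "((\<lambda>t. x t i) \<longlongrightarrow> \<phi> i) (at_right 0)" by (simp add: tendsto_cong)
  qed
  have "ddae_solution r n m A B C D (\<phi>, \<xi>, \<psi>) x y"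
    unfolding ddae_solution_def prod.case
  \<comment> \<open>The witness for f cancels the constant \<open>c i\<close> that convolution with
    e picks up at negative times.\<close>
  proof (intro conjI allI impI exI[of _ "\<lambda>i. \<phi> i - c i"] xy)
    show "((\<lambda>t. x t i) \<longlongrightarrow> \<phi> i) (inf (at_right 0) (ae_filter lborel))" if "i < n" for i
      using cont(2)[OF that] by (rule tendsto_mono[rotated]) simp
    show "ae_eq_on {- r..0} n (segment x 0) \<xi>" "ae_eq_on {- r..0} m (segment y 0) \<psi>"
      by (simp_all add: ae_eq_on_def segment_def x_def y_def)
    show "AE t in lborel. 0 < t \<longrightarrow>
        (\<forall>i<n. x t i = fun_conv heaviside (delay_conv r n A x i) t +
            fun_conv heaviside (delay_conv r m B y i) t + (\<phi> i - c i)) \<and>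
        (\<forall>i<m. y t i = delay_conv r n C x i t + delay_conv r m D y i t)"
      using v by eventually_elim (auto simp: c delay_conv_y x_def y_def)
  qed
  then show ?thesis using that x2 y2 cont by blast
qed

lemma ddae_solution_unique:
  assumes D: "(\<phi>, \<xi>, \<psi>) \<in> product_space r n m"
    and sol: "ddae_solution r n m A B C D (\<phi>, \<xi>, \<psi>) x y" "ddae_solution r n m A B C D (\<phi>, \<xi>, \<psi>) x' y'"
  shows "ae_eq_on {-r..} n x' x" "ae_eq_on {-r..} m y' y"
proof -
  note d = solution_diagram[OF D sol(1)] and d' = solution_diagram[OF D sol(2)]
  have "AE t in lborel. \<forall>i<2 * n + m. diagram x' y' i t = diagram x y i t"
    by (rule solution_unique[OF d'(2) d(2) d'(1) d(1) d'(3) d(3)])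
  then have "AE t in lborel. \<forall>j<2 * n + m. j < n \<or> 2 * n \<le> j \<longrightarrow> U x' y' j t = U x y j t"
    using solution_U_split[OF sol(1)] solution_U_split[OF sol(2)] by eventually_elim auto
  then have "AE t in lborel. - r \<le> t \<longrightarrow> (\<forall>i<n. x' t i = x t i) \<and> (\<forall>i<m. y' t i = y t i)"
  proof eventually_elim
    case (elim t)
    show ?case
    proof (intro impI conjI allI)
      fix i assume t: "- r \<le> t" and "i < n"
      then show "x' t i = x t i" using elim[rule_format, of i] by (simp add: U_def)
    next
      fix i assume t: "- r \<le> t" and "i < m"
      then show "y' t i = y t i" using elim[rule_format, of "2 * n + i"] by (simp add: U_def)
    qed
  qed
  then show "ae_eq_on {-r..} n x' x" "ae_eq_on {-r..} m y' y"
    unfolding ae_eq_on_def by (auto elim!: eventually_mono)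
qed

end

lemma product_norm_nonneg: "0 \<le> product_norm r n m (\<phi>, \<xi>, \<psi>)"
proof -
  have "0 \<le> (LINT t:{-r..0}|lborel. (vnorm n (\<xi> t))\<^sup>2 + (vnorm m (\<psi> t))\<^sup>2)"
    unfolding set_lebesgue_integral_def by (intro integral_nonneg_AE AE_I2) (simp add: indicator_def)
  then show ?thesis by (simp add: product_norm_def)
qed

section \<open>The bound on the state at a given time\<close>

context ddae_system
begin

text \<open>By uniqueness the diagram of the given solution is almost everywhere the one built from
  the Neumann series, which comes with the bound.\<close>

lemma energy2_diagram:
  assumes D: "(\<phi>, \<xi>, \<psi>) \<in> product_space r n m" and sol: "ddae_solution r n m A B C D (\<phi>, \<xi>, \<psi>) x y"
  shows "energy2 (abv (diagram x y)) \<le> gain * ennreal ((product_norm r n m (\<phi>, \<xi>, \<psi>))\<^sup>2)"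
proof -
  note d = solution_diagram[OF D sol]
  obtain z where z: "\<And>j. z j \<in> borel_measurable borel" and "\<And>j t. t \<le> 0 \<Longrightarrow> z j t = 0"
    and z': "AE t in lborel. \<forall>i<2 * n + m. z i t = source \<phi> \<xi> \<psi> i t + T z i t" "locint (abv z)"
    and E: "energy2 (abv z) \<le> gain * ennreal ((product_norm r n m (\<phi>, \<xi>, \<psi>))\<^sup>2)"
    using diagram_solution_exists[OF D] by blast
  have "AE t in lborel. \<forall>i<2 * n + m. diagram x y i t = z i t"
    by (rule solution_unique[OF d(2) z'(2) d(1) z d(3) z'(1)])
  then have "AE t in lborel. \<forall>i<2 * n + m. abv (diagram x y) i t = abv z i t"
    by eventually_elim (simp add: abv_def)
  then show ?thesis using E by (simp add: energy2_cong_AE)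
qed

text \<open>Cauchy-Schwarz on \<open>[0, t]\<close>, whose length is the factor \<open>t\<close>. An
  L2 bound on the derivative component thus controls x at a single time.\<close>

lemma T_x_square:
  assumes i: "i < n" and m: "\<And>j. z j \<in> borel_measurable borel" and zero: "\<And>j t. t \<le> 0 \<Longrightarrow> z j t = 0"
    and li: "locint (abv z)" and t: "0 < t"
  shows "ennreal ((cmod (T z i t))\<^sup>2) \<le> ennreal t * (\<integral>\<^sup>+s. (abv z (n + i) s)\<^sup>2 * indicator {..t} s \<partial>lborel)"
proof -
  have [measurable]: "abv z (n + i) \<in> borel_measurable borel" by (intro measurable_abv m)
  have [measurable]: "(indicator S :: real \<Rightarrow> ennreal) \<in> borel_measurable borel" if "S \<in> sets borel" for S
    using that by (rule borel_measurable_indicator)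
  have "ennreal (cmod (T z i t)) \<le> (\<integral>\<^sup>+s. norm (indicator {..t} s *\<^sub>R z (n + i) s) \<partial>lborel)"
    unfolding T_x[OF i m] using i by (intro integral_norm_bound_ennreal locint_integrable li m) auto
  also have "\<dots> = (\<integral>\<^sup>+s. indicator {0..t} s * (abv z (n + i) s * indicator {..t} s) \<partial>lborel)"
    by (intro nn_integral_cong) (auto simp: indicator_def abv_def zero)
  finally have "(ennreal (cmod (T z i t)))\<^sup>2 \<le>
      (\<integral>\<^sup>+s. indicator {0..t} s * (abv z (n + i) s * indicator {..t} s) \<partial>lborel)\<^sup>2"
    by (rule power_mono) simp
  also have "\<dots> \<le> (\<integral>\<^sup>+s. (indicator {0..t} s)\<^sup>2 \<partial>lborel) *
      (\<integral>\<^sup>+s. (abv z (n + i) s * indicator {..t} s)\<^sup>2 \<partial>lborel)"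
    by (rule Cauchy_Schwarz_nn_integral) auto
  also have "(\<integral>\<^sup>+s. (indicator {0..t} s)\<^sup>2 \<partial>lborel) = (\<integral>\<^sup>+s. indicator {0..t} s \<partial>lborel)"
    by (intro nn_integral_cong) (simp add: indicator_def)
  also have "\<dots> = ennreal t" using t by simp
  also have "(\<integral>\<^sup>+s. (abv z (n + i) s * indicator {..t} s)\<^sup>2 \<partial>lborel) =
      (\<integral>\<^sup>+s. (abv z (n + i) s)\<^sup>2 * indicator {..t} s \<partial>lborel)"
    by (intro nn_integral_cong) (simp add: indicator_def)
  finally show ?thesis by (simp add: ennreal_power)
qed

lemma segment_integral_le:
  assumes D: "(\<phi>, \<xi>, \<psi>) \<in> product_space r n m" and sol: "ddae_solution r n m A B C D (\<phi>, \<xi>, \<psi>) x y"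
    and t: "0 < t"
  shows "(\<integral>\<^sup>+\<theta>. ennreal (indicator {- r..0} \<theta> * ((vnorm n (segment x t \<theta>))\<^sup>2 + (vnorm m (segment y t \<theta>))\<^sup>2)) \<partial>lborel) \<le>
    (\<Sum>j<2 * n + m. \<integral>\<^sup>+s. (abv (init \<xi> \<psi>) j s)\<^sup>2 \<partial>lborel) +
    (\<Sum>j<2 * n + m. \<integral>\<^sup>+s. (abv (diagram x y) j s)\<^sup>2 * indicator {..t} s \<partial>lborel)"
proof -
  have xy: "locally_L1 r n x" "locally_L1 r m y" using sol by (auto simp: ddae_solution_def)
  have [measurable]: "abv (U x y) j \<in> borel_measurable borel" for j by (intro measurable_abv measurable_U xy)
  have [measurable]: "abv (init \<xi> \<psi>) j \<in> borel_measurable borel" for j by (intro measurable_abv measurable_init[OF D])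
  have [measurable]: "abv (diagram x y) j \<in> borel_measurable borel" for j
    by (intro measurable_abv solution_diagram(1)[OF D sol])
  have [measurable]: "(indicator S :: real \<Rightarrow> ennreal) \<in> borel_measurable borel" if "S \<in> sets borel" for S
    using that by (rule borel_measurable_indicator)
  define H where "H u = (\<Sum>j<2 * n + m. (abv (U x y) j u)\<^sup>2)" for u
  have [measurable]: "H \<in> borel_measurable borel" unfolding H_def by measurable
  \<comment> \<open>The form \<open>t + 1 * \<theta>\<close> prepares the affine substitution. As
    \<open>0 < t\<close>, these times stay to the right of \<open>- r\<close>, where
    \<open>U x y\<close> carries the full pair.\<close>
  have "(\<integral>\<^sup>+\<theta>. ennreal (indicator {- r..0} \<theta> * ((vnorm n (segment x t \<theta>))\<^sup>2 + (vnorm m (segment y t \<theta>))\<^sup>2)) \<partial>lborel) =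
      (\<integral>\<^sup>+\<theta>. indicator {- r..0} ((t + 1 * \<theta>) - t) * H (t + 1 * \<theta>) \<partial>lborel)"
    by (intro nn_integral_cong) (use t in \<open>auto simp: H_def sum_abv_U_square segment_def indicator_def\<close>)
  also have "\<dots> = (\<integral>\<^sup>+u. indicator {- r..0} (u - t) * H u \<partial>lborel)"
    by (subst nn_integral_real_affine[of _ 1 t]) auto
  also have "\<dots> \<le> (\<integral>\<^sup>+u. (\<Sum>j<2 * n + m. (abv (init \<xi> \<psi>) j u)\<^sup>2) +
      (\<Sum>j<2 * n + m. (abv (diagram x y) j u)\<^sup>2 * indicator {..t} u) \<partial>lborel)"
  proof (rule nn_integral_mono_AE, use solution_U_split[OF sol] in eventually_elim)
    case (elim u)
    show ?case
    proof (cases "u \<le> t")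
      case True
      have "(abv (U x y) j u)\<^sup>2 \<le> (abv (init \<xi> \<psi>) j u)\<^sup>2 + (abv (diagram x y) j u)\<^sup>2" if j: "j < 2 * n + m" for j
      proof (cases "j < n \<or> 2 * n \<le> j")
        case True
        then have "U x y j u = init \<xi> \<psi> j u + diagram x y j u" using elim j by blast
        \<comment> \<open>One summand lives up to time 0 and the other after it, so the squares add
          without a factor 2.\<close>
        moreover have "init \<xi> \<psi> j u = 0 \<or> diagram x y j u = 0" by (auto simp: init_def diagram_def)
        ultimately show ?thesis by (auto simp: abv_def)
      qed (simp add: abv_def U_def)
      then have "H u \<le> (\<Sum>j<2 * n + m. (abv (init \<xi> \<psi>) j u)\<^sup>2 + (abv (diagram x y) j u)\<^sup>2)"
        unfolding H_def by (intro sum_mono) simp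
      then show ?thesis using True by (auto simp: sum.distrib indicator_def)
    qed (simp add: indicator_def)
  qed
  also have "\<dots> = (\<Sum>j<2 * n + m. \<integral>\<^sup>+s. (abv (init \<xi> \<psi>) j s)\<^sup>2 \<partial>lborel) +
    (\<Sum>j<2 * n + m. \<integral>\<^sup>+s. (abv (diagram x y) j s)\<^sup>2 * indicator {..t} s \<partial>lborel)"
    by (subst nn_integral_add, measurable, subst nn_integral_sum, measurable, subst nn_integral_sum, measurable)
  finally show ?thesis .
qed

lemma state_bound:
  assumes t: "0 < t"
  shows "\<exists>\<alpha>>0. \<forall>\<phi> \<xi> \<psi> x y. (\<phi>, \<xi>, \<psi>) \<in> product_space r n m \<longrightarrow>
    ddae_solution r n m A B C D (\<phi>, \<xi>, \<psi>) x y \<longrightarrow> (\<forall>i<n. continuous_on {0<..} (\<lambda>s. x s i)) \<longrightarrow>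
    product_norm r n m (x t, segment x t, segment y t) \<le> \<alpha> * product_norm r n m (\<phi>, \<xi>, \<psi>)"
proof -
  \<comment> \<open>Removing the weights on times up to \<open>t\<close> costs the sum of these
    factors, and \<open>gain\<close> bounds the energy by the data. The product depends on
    \<open>t\<close> but not on the data.\<close>
  define K where "K = (\<Sum>j<2 * n + m. ennreal (exp (2 * l * t) / w j)) * gain"
  have "K < \<infinity>" using gain_finite by (simp add: K_def ennreal_mult_less_top ennreal_sum_less_top)
  then obtain c where c: "K = ennreal c" "0 \<le> c" by (cases K) auto
  \<comment> \<open>With q the squared norm of the data, the squared norm of x at time t is at most
    2 q + 2 t c q and the integral over the segment at most q + c q; the total is a q.\<close>
  define a where "a = 3 + (2 * t + 1) * c"
  have a: "0 < a" using c t by (simp add: a_def add_pos_nonneg)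
  show ?thesis
  proof (intro exI[of _ "sqrt a"] conjI allI impI)
    show "0 < sqrt a" using a by simp
    fix \<phi> \<xi> \<psi> x y
    assume D: "(\<phi>, \<xi>, \<psi>) \<in> product_space r n m" and sol: "ddae_solution r n m A B C D (\<phi>, \<xi>, \<psi>) x y"
      and cont: "\<forall>i<n. continuous_on {0<..} (\<lambda>s. x s i)"
    define q where "q = (product_norm r n m (\<phi>, \<xi>, \<psi>))\<^sup>2"
    define z where "z = diagram x y"
    define S where "S = (\<Sum>j<2 * n + m. \<integral>\<^sup>+s. (abv z j s)\<^sup>2 * indicator {..t} s \<partial>lborel)"
    let ?J = "\<Sum>j<2 * n + m. \<integral>\<^sup>+s. (abv (init \<xi> \<psi>) j s)\<^sup>2 \<partial>lborel"
    have q: "ennreal q = ennreal ((vnorm n \<phi>)\<^sup>2) + ?J" "0 \<le> q"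
      using product_norm_square[OF D] by (simp_all add: q_def)
    note dz = solution_diagram[OF D sol, folded z_def]
    have zero: "z j s = 0" if "s \<le> 0" for j s using that by (simp add: z_def diagram_def)
    have "S \<le> (\<Sum>j<2 * n + m. ennreal (exp (2 * l * t) / w j) * energy2 (abv z))"
      unfolding S_def by (intro sum_mono square_integral_le_energy2 measurable_abv dz) auto
    also have "\<dots> = (\<Sum>j<2 * n + m. ennreal (exp (2 * l * t) / w j)) * energy2 (abv z)"
      by (simp add: sum_distrib_right)
    also have "\<dots> \<le> (\<Sum>j<2 * n + m. ennreal (exp (2 * l * t) / w j)) * (gain * ennreal q)"
      unfolding z_def q_def by (intro mult_left_mono energy2_diagram[OF D sol]) simp
    finally have S: "S \<le> ennreal (c * q)" using c q(2) by (simp add: K_def ennreal_mult mult.assoc[symmetric])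
    have x: "x t i = \<phi> i + T z i t" if i: "i < n" for i
    proof (rule continuous_AE_eq[OF _ _ _ t])
      show "continuous_on {0<..} (\<lambda>t. x t i)" using cont i by simp
      have "continuous_on {0..} (T z i)" using continuous_T_x[where z = z, OF i dz(1) zero dz(2)] by simp
      then have "continuous_on {0<..} (T z i)" by (rule continuous_on_subset) auto
      then show "continuous_on {0<..} (\<lambda>t. \<phi> i + T z i t)"
        by (intro continuous_on_add continuous_on_const)
      show "AE t in lborel. 0 < t \<longrightarrow> x t i = \<phi> i + T z i t"
        using dz(3)
      proof eventually_elim
        case (elim t)
        have "z i t = source \<phi> \<xi> \<psi> i t + T z i t" using elim i by simp
        then show ?case using i r by (auto simp: z_def diagram_def U_def source_def)
      qed
    qed
    have "(vnorm n (x t))\<^sup>2 \<le> (\<Sum>i<n. 2 * (cmod (\<phi> i))\<^sup>2 + 2 * (cmod (T z i t))\<^sup>2)"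
      unfolding vnorm_square
    proof (intro sum_mono)
      fix i assume "i \<in> {..<n}"
      then have "cmod (x t i) \<le> cmod (\<phi> i) + cmod (T z i t)" using x by (simp add: norm_triangle_ineq)
      then have "(cmod (x t i))\<^sup>2 \<le> (cmod (\<phi> i) + cmod (T z i t))\<^sup>2" by (intro power_mono) auto
      also have "\<dots> \<le> 2 * (cmod (\<phi> i))\<^sup>2 + 2 * (cmod (T z i t))\<^sup>2"
        using zero_le_power2[of "cmod (\<phi> i) - cmod (T z i t)"] by (simp add: power2_eq_square algebra_simps)
      finally show "(cmod (x t i))\<^sup>2 \<le> 2 * (cmod (\<phi> i))\<^sup>2 + 2 * (cmod (T z i t))\<^sup>2" .
    qed
    then have V1: "(vnorm n (x t))\<^sup>2 \<le> 2 * (vnorm n \<phi>)\<^sup>2 + 2 * (\<Sum>i<n. (cmod (T z i t))\<^sup>2)"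
      by (simp add: vnorm_square sum.distrib sum_distrib_left)
    have "ennreal (\<Sum>i<n. (cmod (T z i t))\<^sup>2) = (\<Sum>i<n. ennreal ((cmod (T z i t))\<^sup>2))"
      by (simp add: sum_ennreal)
    also have "\<dots> \<le> (\<Sum>i<n. ennreal t * (\<integral>\<^sup>+s. (abv z (n + i) s)\<^sup>2 * indicator {..t} s \<partial>lborel))"
      using t by (intro sum_mono T_x_square dz zero) auto
    also have "\<dots> = ennreal t * (\<Sum>j\<in>(+) n ` {..<n}. \<integral>\<^sup>+s. (abv z j s)\<^sup>2 * indicator {..t} s \<partial>lborel)"
      by (subst sum.reindex) (auto simp: sum_distrib_left)
    also have "\<dots> \<le> ennreal t * S"
      unfolding S_def by (intro mult_left_mono sum_mono2) auto
    also have "\<dots> \<le> ennreal t * ennreal (c * q)" by (intro mult_left_mono S) simp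
    also have "\<dots> = ennreal (t * (c * q))" using t c q by (simp add: ennreal_mult)
    finally have V2: "(\<Sum>i<n. (cmod (T z i t))\<^sup>2) \<le> t * (c * q)" using t c q by (simp add: ennreal_le_iff)
    have "ennreal ((vnorm n \<phi>)\<^sup>2) \<le> ennreal q" unfolding q(1) by simp
    then have V3: "(vnorm n \<phi>)\<^sup>2 \<le> q" using q(2) by (simp add: ennreal_le_iff)
    have "(\<integral>\<^sup>+\<theta>. ennreal (indicator {- r..0} \<theta> * ((vnorm n (segment x t \<theta>))\<^sup>2 + (vnorm m (segment y t \<theta>))\<^sup>2)) \<partial>lborel) \<le> ?J + S"
      unfolding S_def z_def by (rule segment_integral_le[OF D sol t])
    also have "\<dots> \<le> ennreal q + ennreal (c * q)" using S q(1) by (intro add_mono) simp_all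
    also have "\<dots> = ennreal (q + c * q)" using q(2) c by simp
    finally have L: "(LINT \<theta>:{-r..0}|lborel. (vnorm n (segment x t \<theta>))\<^sup>2 + (vnorm m (segment y t \<theta>))\<^sup>2) \<le> q + c * q"
      unfolding set_lebesgue_integral_def using q(2) c by (intro integral_real_bounded) auto
    have "product_norm r n m (x t, segment x t, segment y t) \<le> sqrt (a * q)"
      unfolding product_norm_def prod.case
      by (rule real_sqrt_le_mono) (use V1 V2 V3 L in \<open>simp add: a_def algebra_simps\<close>)
    also have "\<dots> = sqrt a * product_norm r n m (\<phi>, \<xi>, \<psi>)"
      by (simp add: real_sqrt_mult q_def product_norm_nonneg)
    finally show "product_norm r n m (x t, segment x t, segment y t) \<le> sqrt a * product_norm r n m (\<phi>, \<xi>, \<psi>)" .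
  qed
qed

end

theorem mainTheorem5:
  fixes r :: real and n m :: nat
    and A B C D :: "(real \<Rightarrow> nat \<Rightarrow> complex) \<Rightarrow> nat \<Rightarrow> complex"
    and \<mu>A \<mu>B \<mu>C \<mu>D :: "nat \<Rightarrow> nat \<Rightarrow> real set \<Rightarrow> complex"
  assumes "0 \<le> r"
    and "delay_operator r n n A" and "riesz_matrix r n n A \<mu>A"
    and "delay_operator r n m B" and "riesz_matrix r n m B \<mu>B"
    and "delay_operator r m n C" and "riesz_matrix r m n C \<mu>C"
    and "delay_operator r m m D" and "riesz_matrix r m m D \<mu>D"
    and "\<not> ddae_has_causality_loop n m \<mu>A \<mu>B \<mu>C \<mu>D"
  shows "(\<forall>\<phi> \<xi> \<psi>. (\<phi>, \<xi>, \<psi>) \<in> product_space r n m \<longrightarrow>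
            (\<exists>x y. ddae_solution r n m \<mu>A \<mu>B \<mu>C \<mu>D (\<phi>, \<xi>, \<psi>) x y \<and>
                   locally_L2 r n x \<and> locally_L2 r m y \<and>
                   (\<forall>i<n. continuous_on {0<..} (\<lambda>t. x t i)) \<and>
                   (\<forall>i<n. ((\<lambda>t. x t i) \<longlongrightarrow> \<phi> i) (at_right 0)) \<and>
                   (\<forall>x' y'. ddae_solution r n m \<mu>A \<mu>B \<mu>C \<mu>D (\<phi>, \<xi>, \<psi>) x' y' \<longrightarrow>
                      ae_eq_on {-r..} n x' x \<and> ae_eq_on {-r..} m y' y)))
       \<and> (\<forall>t>0. \<exists>\<alpha>>0. \<forall>\<phi> \<xi> \<psi> x y.
            (\<phi>, \<xi>, \<psi>) \<in> product_space r n m \<longrightarrow>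
            ddae_solution r n m \<mu>A \<mu>B \<mu>C \<mu>D (\<phi>, \<xi>, \<psi>) x y \<longrightarrow>
            (\<forall>i<n. continuous_on {0<..} (\<lambda>s. x s i)) \<longrightarrow>
            product_norm r n m (x t, segment x t, segment y t)
              \<le> \<alpha> * product_norm r n m (\<phi>, \<xi>, \<psi>))"
proof -
  obtain l w where "causal_system (2 * n + m) (ddae_meas n m \<mu>A \<mu>B \<mu>C \<mu>D) l w"
    using ddae_causal_system[of r n \<mu>A m \<mu>B \<mu>C \<mu>D] assms by (auto intro: causal_kernels_riesz)
  then interpret ddae_system n m \<mu>A \<mu>B \<mu>C \<mu>D l w r
    using \<open>0 \<le> r\<close> by (intro ddae_system.intro ddae_system_axioms.intro)
  show ?thesis
  proof (intro conjI allI impI)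
    fix \<phi> \<xi> \<psi> assume D: "(\<phi>, \<xi>, \<psi>) \<in> product_space r n m"
    obtain x y where xy: "ddae_solution r n m \<mu>A \<mu>B \<mu>C \<mu>D (\<phi>, \<xi>, \<psi>) x y" "locally_L2 r n x" "locally_L2 r m y"
      "\<And>i. i < n \<Longrightarrow> continuous_on {0<..} (\<lambda>t. x t i)"
      "\<And>i. i < n \<Longrightarrow> ((\<lambda>t. x t i) \<longlongrightarrow> \<phi> i) (at_right 0)"
      using solution_from_diagram[OF D] by blast
    show "\<exists>x y. ddae_solution r n m \<mu>A \<mu>B \<mu>C \<mu>D (\<phi>, \<xi>, \<psi>) x y \<and>
                   locally_L2 r n x \<and> locally_L2 r m y \<and>
                   (\<forall>i<n. continuous_on {0<..} (\<lambda>t. x t i)) \<and>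
                   (\<forall>i<n. ((\<lambda>t. x t i) \<longlongrightarrow> \<phi> i) (at_right 0)) \<and>
                   (\<forall>x' y'. ddae_solution r n m \<mu>A \<mu>B \<mu>C \<mu>D (\<phi>, \<xi>, \<psi>) x' y' \<longrightarrow>
                      ae_eq_on {-r..} n x' x \<and> ae_eq_on {-r..} m y' y)"
      by (intro exI[of _ x] exI[of _ y] conjI allI impI xy ddae_solution_unique[OF D xy(1)])
  qed (rule state_bound)
qed

end
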